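(* Let $X$ be a second-countable locally compact Hausdorff space and let $\kappa$ be a perfect kernel on $X$ satisfying the domination principle and the $h$-Ugaheri maximum principle for some $h\in[1,\infty)$. Assume that the set of all $\varphi\in C_0(X)$ representable as potentials $U^\theta$ of measures $\theta\in\mathcal E$ is dense in $C_0(X)$ equipped with the inductive limit topology. Then there exists a countable set $\mathcal E^\circ\subset\mathcal E$, depending on $X$ and $\kappa$ only, such that the following holds for every $A\subset X$ with $\mathrm{cap}_*A>0$ and every $\xi\in\mathfrak M$ such that each of $\omega=\xi^+$ and $\omega=\xi^-$ is bounded, has potential $U^\omega$ continuous on every compact subset of $A$, and satisfies $\sup_{x\in A}U^\omega(x)<\infty$. The inner balayage $\xi^A$ is uniquely determined within $\mathcal E$ by the relation $$I(\xi^A,\theta)=I(\theta^A,\xi)\quad\text{for all }\theta\in\mathcal E^\circ;$$ that is, $\xi^A$ satisfies this relation, and if for some $\zeta\in\mathcal E$ one has $I(\zeta,\theta)=I(\theta^A,\xi)$ for all $\theta\in\mathcal E^\circ$, then $\zeta=\xi^A$. If $A=B$ is Borel, then the same remains valid with $\xi^A$ and $\theta^A$ replaced by the outer swept measures $\xi^{*B}$ and $\theta^{*B}$, respectively.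
   Context: Measures and energies. $\mathfrak M$ is the space of (signed, real-valued) Radon measures on $X$ with the vague topology (pointwise convergence on $C_0(X)$, the continuous functions $X\to\mathbb R$ of compact support); $\mathfrak M^+$ is the cone of positive ones; $\xi^\pm$ are the positive and negative parts of $\xi\in\mathfrak M$ in the Hahn--Jordan decomposition. A kernel on $X$ is a symmetric lower semicontinuous function $\kappa:X\times X\to[0,\infty]$. For $\mu,\nu\in\mathfrak M$, $I(\mu,\nu):=\int\kappa(x,y)\,d(\mu\otimes\nu)(x,y)$ and $U^\mu(x):=\int\kappa(x,y)\,d\mu(y)$, whenever well defined as a finite number or $\pm\infty$; $I(\mu):=I(\mu,\mu)$. $\mathcal E$ is the set of $\mu\in\mathfrak M$ with $I(\mu)$ finite, $\mathcal E^+:=\mathcal E\cap\mathfrak M^+$. The kernel satisfies the energy principle (is strictly positive definite) if $I(\mu)\geqslant0$ for all signed $\mu$ (whenever defined), with $I(\mu)=0$ only for $\mu=0$; then $\mathcal E$ is a pre-Hilbert space with inner product $I(\mu,\nu)$ and norm $\|\mu\|:=\sqrt{I(\mu)}$, whose topology is called strong; moreover $\theta\in\mathcal E$ if and only if $\theta^\pm\in\mathcal E^+$. The kernel is perfect if it satisfies the energy principle, $\mathcal E^+$ is strongly complete, and the strong topology on $\mathcal E^+$ is finer than the induced vague topology. Domination principle: for $\mu\in\mathcal E^+$, $\nu\in\mathfrak M^+$ with $U^\mu\leqslant U^\nu$ $\mu$-a.e., one has $U^\mu\leqslant U^\nu$ on $X$. $h$-Ugaheri maximum principle: for each $\mu\in\mathcal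 E^+$ with $U^\mu\leqslant c$ $\mu$-a.e., where $c\in(0,\infty)$, one has $U^\mu\leqslant hc$ on $X$. Inductive limit topology on $C_0(X)$: the finest locally convex topology for which all the canonical injections $C_0(K;X)\to C_0(X)$, $K\subset X$ compact, are continuous, where $C_0(K;X)$ is the space of $\varphi\in C_0(X)$ with support in $K$, with the topology of uniform convergence on $K$. Capacity. For compact $K$, $\mathrm{cap}\,K:=1/\inf\{I(\mu):\mu\in\mathfrak M^+,\ \mathrm{Supp}(\mu)\subset K,\ \mu(X)=1\}$ (with $1/\infty:=0$); $\mathrm{cap}_*A:=\sup\{\mathrm{cap}\,K: K\subset A\text{ compact}\}$ (inner capacity); $\mathrm{cap}^*A:=\inf\{\mathrm{cap}_*D: D\supset A\text{ open}\}$ (outer capacity). A property holds n.e. (resp. q.e.) on $A$ if the set of points of $A$ where it fails has inner (resp. outer) capacity zero. Balayage. $\mu\in\mathfrak M^+$ is concentrated on $A$ if $X\setminus A$ is locally $\mu$-negligible; $\mathcal E^+(A)$ is the set of $\mu\in\mathcal E^+$ concentrated on $A$, and $\mathcal E'(A)$ is its strong closure in $\mathcal E^+$. For $\lambda\in\mathcal E^+$, $\lambda^A$ denotes the only measure in $\mathcal E'(A)$ with $U^{\lambda^A}=U^\lambda$ n.e. on $A$ and, for $A$ Borel, $\lambda^{*A}$ the only measure in $\mathcal E'(A)$ with $U^{\lambda^{*A}}=U^\lambda$ q.e. on $A$ (both known to exist and be unique here). For $\omega\in\mathfrak M^+$, the inner (resp., for $A$ Borel, outer) balayage is the measure $\omega^A\in\mathcal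 E'(A)$ (resp. $\omega^{*A}\in\mathcal E'(A)$) with $I(\omega^A,\lambda)=I(\lambda^A,\omega)$ (resp. $I(\omega^{*A},\lambda)=I(\lambda^{*A},\omega)$) for all $\lambda\in\mathcal E^+$; it exists and is unique for $\omega=\xi^\pm$ as in the claim. For signed $\xi$ put $\xi^A:=(\xi^+)^A-(\xi^-)^A$ and $\xi^{*A}:=(\xi^+)^{*A}-(\xi^-)^{*A}$; likewise $\theta^A:=(\theta^+)^A-(\theta^-)^A$, $\theta^{*A}:=(\theta^+)^{*A}-(\theta^-)^{*A}$ for $\theta\in\mathcal E$. *)

theory Defs
  imports "HOL-Analysis.Analysis"
begin

section \<open>Signed Radon measures\<close>

text \<open>
  On a second-countable locally compact Hausdorff space, the positive Radon measures are exactly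
  the Borel measures that are finite on compact sets (regularity is automatic).
\<close>

definition pos_radon :: "'a::topological_space measure \<Rightarrow> bool" where
  "pos_radon m \<longleftrightarrow> sets m = sets borel \<and> (\<forall>K. compact K \<longrightarrow> emeasure m K < \<infinity>)"

definition singular_measures :: "'a::topological_space measure \<Rightarrow> 'a measure \<Rightarrow> bool" where
  "singular_measures m n \<longleftrightarrow> (\<exists>S\<in>sets borel. emeasure m S = 0 \<and> emeasure n (- S) = 0)"

text \<open>
  Both variations of a signed Radon measure may be infinite, so that it is in general not a set
  function on the Borel sets. It is represented by its Hahn--Jordan decomposition.
\<close>

typedef (overloaded) ('a::topological_space) radon =
  "{(p :: 'a measure, q). pos_radon p \<and> pos_radon q \<and> singular_measures p q}"
  morphisms jordan_decomp Abs_radon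
proof
  show "(null_measure borel, null_measure borel) \<in>
      {(p :: 'a measure, q). pos_radon p \<and> pos_radon q \<and> singular_measures p q}"
    by (auto simp: pos_radon_def singular_measures_def)
qed

definition pos_var :: "'a::topological_space radon \<Rightarrow> 'a measure" where
  "pos_var \<mu> = fst (jordan_decomp \<mu>)"

definition neg_var :: "'a::topological_space radon \<Rightarrow> 'a measure" where
  "neg_var \<mu> = snd (jordan_decomp \<mu>)"

definition of_pos_radon :: "'a::topological_space measure \<Rightarrow> 'a radon" where
  "of_pos_radon m = Abs_radon (m, null_measure borel)"

definition pos_part :: "'a::topological_space radon \<Rightarrow> 'a radon" where
  "pos_part \<mu> = of_pos_radon (pos_var \<mu>)"

definition neg_part :: "'a::topological_space radon \<Rightarrow> 'a radon" where
  "neg_part \<mu> = of_pos_radon (neg_var \<mu>)"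

definition radon_cone :: "'a::topological_space radon set" where
  "radon_cone = {\<mu>. neg_var \<mu> = null_measure borel}"

instantiation radon :: (topological_space) "{zero, minus}"
begin

definition zero_radon :: "'a radon" where
  "zero_radon = of_pos_radon (null_measure borel)"

text \<open>
  The equation \<open>\<eta> = \<mu> - \<nu>\<close>, with the negative terms moved to the other side so that no difference
  of infinite values occurs.
\<close>

definition minus_radon :: "'a radon \<Rightarrow> 'a radon \<Rightarrow> 'a radon" where
  "\<mu> - \<nu> = (THE \<eta>. \<forall>B\<in>sets borel.
     emeasure (pos_var \<eta>) B + emeasure (neg_var \<mu>) B + emeasure (pos_var \<nu>) B =
     emeasure (neg_var \<eta>) B + emeasure (pos_var \<mu>) B + emeasure (neg_var \<nu>) B)"

instance ..

end

definition bounded_radon :: "'a::topological_space radon \<Rightarrow> bool" where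
  "bounded_radon \<mu> \<longleftrightarrow> emeasure (pos_var \<mu>) UNIV < \<infinity> \<and> emeasure (neg_var \<mu>) UNIV < \<infinity>"

section \<open>Continuous functions of compact support\<close>

definition C0 :: "('a::topological_space \<Rightarrow> real) set" where
  "C0 = {\<phi>. continuous_on UNIV \<phi> \<and> compact (closure {x. \<phi> x \<noteq> 0})}"

definition C0_on :: "'a::topological_space set \<Rightarrow> ('a \<Rightarrow> real) set" where
  "C0_on K = {\<phi>\<in>C0. closure {x. \<phi> x \<noteq> 0} \<subseteq> K}"

text \<open>
  The supremum over \<open>K\<close> is taken over the whole space, where the functions vanish off \<open>K\<close>; this
  avoids the supremum of the empty set of reals for \<open>K = {}\<close>.
\<close>

definition uniform_topology_on :: "'a::topological_space set \<Rightarrow> ('a \<Rightarrow> real) topology" where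
  "uniform_topology_on K = Metric_space.mtopology (C0_on K) (\<lambda>\<phi> \<psi>. SUP x. \<bar>\<phi> x - \<psi> x\<bar>)"

definition locally_convex_on_C0 :: "('a::topological_space \<Rightarrow> real) topology \<Rightarrow> bool" where
  "locally_convex_on_C0 T \<longleftrightarrow>
     topspace T = C0 \<and>
     continuous_map (prod_topology T T) T (\<lambda>(\<phi>, \<psi>) x. \<phi> x + \<psi> x) \<and>
     continuous_map (prod_topology euclideanreal T) T (\<lambda>(c, \<phi>) x. c * \<phi> x) \<and>
     (\<forall>U. openin T U \<and> (\<lambda>x. 0) \<in> U \<longrightarrow>
       (\<exists>V. openin T V \<and> (\<lambda>x. 0) \<in> V \<and> V \<subseteq> U \<and>
         (\<forall>\<phi>\<in>V. \<forall>\<psi>\<in>V. \<forall>t\<in>{0..1}. (\<lambda>x. (1 - t) * \<phi> x + t * \<psi> x) \<in> V)))"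

text \<open>
  The supremum of all locally convex topologies making the injections continuous is itself such
  a topology, hence the finest one.
\<close>

definition inductive_limit_topology :: "('a::topological_space \<Rightarrow> real) topology" where
  "inductive_limit_topology = topology_generated_by
     {U. \<exists>T. locally_convex_on_C0 T \<and>
           (\<forall>K. compact K \<longrightarrow> continuous_map (uniform_topology_on K) T (\<lambda>\<phi>. \<phi>)) \<and>
           openin T U}"

definition radon_integral :: "'a::topological_space radon \<Rightarrow> ('a \<Rightarrow> real) \<Rightarrow> real" where
  "radon_integral \<mu> \<phi> = (\<integral>x. \<phi> x \<partial>pos_var \<mu>) - (\<integral>x. \<phi> x \<partial>neg_var \<mu>)"

definition vague_topology :: "'a::topological_space radon topology" where
  "vague_topology = pullback_topology UNIV (\<lambda>\<mu>. restrict (radon_integral \<mu>) C0)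
     (product_topology (\<lambda>_. euclideanreal) C0)"

section \<open>Kernels, potentials and energies\<close>

type_synonym 'a kernel = "'a \<Rightarrow> 'a \<Rightarrow> ennreal"

definition is_kernel :: "'a::topological_space kernel \<Rightarrow> bool" where
  "is_kernel \<kappa> \<longleftrightarrow> (\<forall>x y. \<kappa> x y = \<kappa> y x) \<and> (\<forall>c. open {(x, y). c < \<kappa> x y})"

text \<open>
  A potential or energy is a difference of two values in \<open>[0, \<infinity>]\<close>. It is well defined (as a finite
  number or \<open>\<plusminus>\<infinity>\<close>) unless both are infinite.
\<close>

definition potential_defined :: "'a::topological_space kernel \<Rightarrow> 'a radon \<Rightarrow> 'a \<Rightarrow> bool" where
  "potential_defined \<kappa> \<mu> x \<longleftrightarrow>
     (\<integral>\<^sup>+y. \<kappa> x y \<partial>pos_var \<mu>) < \<infinity> \<or> (\<integral>\<^sup>+y. \<kappa> x y \<partial>neg_var \<mu>) < \<infinity>"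

definition potential :: "'a::topological_space kernel \<Rightarrow> 'a radon \<Rightarrow> 'a \<Rightarrow> ereal" where
  "potential \<kappa> \<mu> x =
     enn2ereal (\<integral>\<^sup>+y. \<kappa> x y \<partial>pos_var \<mu>) - enn2ereal (\<integral>\<^sup>+y. \<kappa> x y \<partial>neg_var \<mu>)"

text \<open>The integrals of \<open>\<kappa>\<close> with respect to the positive and the negative part of \<open>\<mu> \<otimes> \<nu>\<close>.\<close>

definition energy_plus :: "'a::topological_space kernel \<Rightarrow> 'a radon \<Rightarrow> 'a radon \<Rightarrow> ennreal" where
  "energy_plus \<kappa> \<mu> \<nu> =
     (\<integral>\<^sup>+(x, y). \<kappa> x y \<partial>(pos_var \<mu> \<Otimes>\<^sub>M pos_var \<nu>)) +
     (\<integral>\<^sup>+(x, y). \<kappa> x y \<partial>(neg_var \<mu> \<Otimes>\<^sub>M neg_var \<nu>))"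

definition energy_minus :: "'a::topological_space kernel \<Rightarrow> 'a radon \<Rightarrow> 'a radon \<Rightarrow> ennreal" where
  "energy_minus \<kappa> \<mu> \<nu> =
     (\<integral>\<^sup>+(x, y). \<kappa> x y \<partial>(pos_var \<mu> \<Otimes>\<^sub>M neg_var \<nu>)) +
     (\<integral>\<^sup>+(x, y). \<kappa> x y \<partial>(neg_var \<mu> \<Otimes>\<^sub>M pos_var \<nu>))"

definition energy_defined :: "'a::topological_space kernel \<Rightarrow> 'a radon \<Rightarrow> 'a radon \<Rightarrow> bool" where
  "energy_defined \<kappa> \<mu> \<nu> \<longleftrightarrow> energy_plus \<kappa> \<mu> \<nu> < \<infinity> \<or> energy_minus \<kappa> \<mu> \<nu> < \<infinity>"

definition energy :: "'a::topological_space kernel \<Rightarrow> 'a radon \<Rightarrow> 'a radon \<Rightarrow> ereal" where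
  "energy \<kappa> \<mu> \<nu> = enn2ereal (energy_plus \<kappa> \<mu> \<nu>) - enn2ereal (energy_minus \<kappa> \<mu> \<nu>)"

definition energy_space :: "'a::topological_space kernel \<Rightarrow> 'a radon set" where
  "energy_space \<kappa> = {\<mu>. energy_defined \<kappa> \<mu> \<mu> \<and> \<bar>energy \<kappa> \<mu> \<mu>\<bar> \<noteq> \<infinity>}"

definition energy_cone :: "'a::topological_space kernel \<Rightarrow> 'a radon set" where
  "energy_cone \<kappa> = energy_space \<kappa> \<inter> radon_cone"

definition energy_dist :: "'a::topological_space kernel \<Rightarrow> 'a radon \<Rightarrow> 'a radon \<Rightarrow> real" where
  "energy_dist \<kappa> \<mu> \<nu> = sqrt (real_of_ereal (energy \<kappa> (\<mu> - \<nu>) (\<mu> - \<nu>)))"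

definition strong_topology :: "'a::topological_space kernel \<Rightarrow> 'a radon topology" where
  "strong_topology \<kappa> = Metric_space.mtopology (energy_space \<kappa>) (energy_dist \<kappa>)"

definition energy_principle :: "'a::topological_space kernel \<Rightarrow> bool" where
  "energy_principle \<kappa> \<longleftrightarrow>
     (\<forall>\<mu>. energy_defined \<kappa> \<mu> \<mu> \<longrightarrow>
        energy \<kappa> \<mu> \<mu> \<ge> 0 \<and> (energy \<kappa> \<mu> \<mu> = 0 \<longrightarrow> \<mu> = 0))"

definition perfect_kernel :: "'a::topological_space kernel \<Rightarrow> bool" where
  "perfect_kernel \<kappa> \<longleftrightarrow>
     is_kernel \<kappa> \<and>
     energy_principle \<kappa> \<and>
     Metric_space.mcomplete (energy_cone \<kappa>) (energy_dist \<kappa>) \<and>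
     (\<forall>U. openin (subtopology vague_topology (energy_cone \<kappa>)) U \<longrightarrow>
          openin (subtopology (strong_topology \<kappa>) (energy_cone \<kappa>)) U)"

definition domination_principle :: "'a::topological_space kernel \<Rightarrow> bool" where
  "domination_principle \<kappa> \<longleftrightarrow>
     (\<forall>\<mu>\<in>energy_cone \<kappa>. \<forall>\<nu>\<in>radon_cone.
        (AE x in pos_var \<mu>. potential \<kappa> \<mu> x \<le> potential \<kappa> \<nu> x) \<longrightarrow>
        (\<forall>x. potential \<kappa> \<mu> x \<le> potential \<kappa> \<nu> x))"

definition ugaheri_principle :: "real \<Rightarrow> 'a::topological_space kernel \<Rightarrow> bool" where
  "ugaheri_principle h \<kappa> \<longleftrightarrow>
     (\<forall>\<mu>\<in>energy_cone \<kappa>. \<forall>c>0.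
        (AE x in pos_var \<mu>. potential \<kappa> \<mu> x \<le> ereal c) \<longrightarrow>
        (\<forall>x. potential \<kappa> \<mu> x \<le> ereal (h * c)))"

text \<open>The representing potentials are required to be well defined and finite at every point.\<close>

definition C0_potentials :: "'a::topological_space kernel \<Rightarrow> ('a \<Rightarrow> real) set" where
  "C0_potentials \<kappa> =
     {\<phi>\<in>C0. \<exists>\<theta>\<in>energy_space \<kappa>.
        \<forall>x. potential_defined \<kappa> \<theta> x \<and> potential \<kappa> \<theta> x = ereal (\<phi> x)}"

section \<open>Capacity\<close>

definition measure_support :: "'a::topological_space measure \<Rightarrow> 'a set" where
  "measure_support m = {x. \<forall>U. open U \<and> x \<in> U \<longrightarrow> emeasure m U \<noteq> 0}"

definition compact_cap :: "'a::topological_space kernel \<Rightarrow> 'a set \<Rightarrow> ereal" where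
  "compact_cap \<kappa> K =
     1 / (INF \<mu>\<in>{\<mu>\<in>radon_cone. measure_support (pos_var \<mu>) \<subseteq> K \<and> emeasure (pos_var \<mu>) UNIV = 1}.
            energy \<kappa> \<mu> \<mu>)"

definition inner_cap :: "'a::topological_space kernel \<Rightarrow> 'a set \<Rightarrow> ereal" where
  "inner_cap \<kappa> A = (SUP K\<in>{K. compact K \<and> K \<subseteq> A}. compact_cap \<kappa> K)"

definition outer_cap :: "'a::topological_space kernel \<Rightarrow> 'a set \<Rightarrow> ereal" where
  "outer_cap \<kappa> A = (INF D\<in>{D. open D \<and> A \<subseteq> D}. inner_cap \<kappa> D)"

section \<open>Balayage\<close>

definition concentrated_on :: "'a::topological_space set \<Rightarrow> 'a radon \<Rightarrow> bool" where
  "concentrated_on A \<mu> \<longleftrightarrow>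
     (\<forall>K. compact K \<longrightarrow> (\<exists>N\<in>null_sets (pos_var \<mu>). K - A \<subseteq> N))"

definition energy_cone_on :: "'a::topological_space kernel \<Rightarrow> 'a set \<Rightarrow> 'a radon set" where
  "energy_cone_on \<kappa> A = {\<mu>\<in>energy_cone \<kappa>. concentrated_on A \<mu>}"

definition energy_cone_closure :: "'a::topological_space kernel \<Rightarrow> 'a set \<Rightarrow> 'a radon set" where
  "energy_cone_closure \<kappa> A =
     subtopology (strong_topology \<kappa>) (energy_cone \<kappa>) closure_of energy_cone_on \<kappa> A"

text \<open>
  Inner and outer balayage are obtained by taking \<open>cap\<close> to be \<open>inner_cap \<kappa>\<close> (exceptional sets of
  inner capacity zero, "n.e.") and \<open>outer_cap \<kappa>\<close> ("q.e."), respectively. The first definition is for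
  \<open>\<sigma>\<close> in the energy cone, the second for positive measures.
\<close>

definition swept_energy ::
  "('a::topological_space set \<Rightarrow> ereal) \<Rightarrow> 'a kernel \<Rightarrow> 'a set \<Rightarrow> 'a radon \<Rightarrow> 'a radon" where
  "swept_energy cap \<kappa> A \<sigma> =
     (THE \<eta>. \<eta> \<in> energy_cone_closure \<kappa> A \<and> cap {x\<in>A. potential \<kappa> \<eta> x \<noteq> potential \<kappa> \<sigma> x} = 0)"

definition swept_pos ::
  "('a::topological_space set \<Rightarrow> ereal) \<Rightarrow> 'a kernel \<Rightarrow> 'a set \<Rightarrow> 'a radon \<Rightarrow> 'a radon" where
  "swept_pos cap \<kappa> A \<omega> =
     (THE \<eta>. \<eta> \<in> energy_cone_closure \<kappa> A \<and>
        (\<forall>\<sigma>\<in>energy_cone \<kappa>. energy \<kappa> \<eta> \<sigma> = energy \<kappa> (swept_energy cap \<kappa> A \<sigma>) \<omega>))"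

definition swept_energy_signed ::
  "('a::topological_space set \<Rightarrow> ereal) \<Rightarrow> 'a kernel \<Rightarrow> 'a set \<Rightarrow> 'a radon \<Rightarrow> 'a radon" where
  "swept_energy_signed cap \<kappa> A \<theta> =
     swept_energy cap \<kappa> A (pos_part \<theta>) - swept_energy cap \<kappa> A (neg_part \<theta>)"

definition swept ::
  "('a::topological_space set \<Rightarrow> ereal) \<Rightarrow> 'a kernel \<Rightarrow> 'a set \<Rightarrow> 'a radon \<Rightarrow> 'a radon" where
  "swept cap \<kappa> A \<xi> = swept_pos cap \<kappa> A (pos_part \<xi>) - swept_pos cap \<kappa> A (neg_part \<xi>)"

definition sweepable :: "'a::topological_space kernel \<Rightarrow> 'a set \<Rightarrow> 'a radon \<Rightarrow> bool" where
  "sweepable \<kappa> A \<omega> \<longleftrightarrow>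
     bounded_radon \<omega> \<and>
     (\<forall>K. compact K \<and> K \<subseteq> A \<longrightarrow> continuous_on K (potential \<kappa> \<omega>)) \<and>
     (SUP x\<in>A. potential \<kappa> \<omega> x) < \<infinity>"

text \<open>The equality \<open>I(\<eta>, \<theta>) = I(\<tau>, \<xi>)\<close>, including that both sides are well defined.\<close>

definition energies_agree ::
  "'a::topological_space kernel \<Rightarrow> 'a radon \<Rightarrow> 'a radon \<Rightarrow> 'a radon \<Rightarrow> 'a radon \<Rightarrow> bool" where
  "energies_agree \<kappa> \<eta> \<theta> \<tau> \<xi> \<longleftrightarrow>
     energy_defined \<kappa> \<eta> \<theta> \<and> energy_defined \<kappa> \<tau> \<xi> \<and> energy \<kappa> \<eta> \<theta> = energy \<kappa> \<tau> \<xi>"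

definition determined_within_energy_space ::
  "('a::topological_space set \<Rightarrow> ereal) \<Rightarrow> 'a kernel \<Rightarrow> 'a radon set \<Rightarrow> 'a set \<Rightarrow> 'a radon \<Rightarrow> bool"
  where
  "determined_within_energy_space cap \<kappa> \<E>\<^sub>0 A \<xi> \<longleftrightarrow>
     swept cap \<kappa> A \<xi> \<in> energy_space \<kappa> \<and>
     (\<forall>\<theta>\<in>\<E>\<^sub>0. energies_agree \<kappa> (swept cap \<kappa> A \<xi>) \<theta> (swept_energy_signed cap \<kappa> A \<theta>) \<xi>) \<and>
     (\<forall>\<zeta>\<in>energy_space \<kappa>.
        (\<forall>\<theta>\<in>\<E>\<^sub>0. energies_agree \<kappa> \<zeta> \<theta> (swept_energy_signed cap \<kappa> A \<theta>) \<xi>) \<longrightarrow>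
        \<zeta> = swept cap \<kappa> A \<xi>)"

end

theory Submission
  imports Defs
begin

text \<open>
  Sweeping a measure \<open>\<sigma>\<close> of finite energy onto \<open>A\<close> is the orthogonal projection onto the closed
  convex cone \<open>\<E>'(A)\<close>. For compact \<open>A\<close> a projection, or the minimizer of the Gauss functional in the
  case of a measure \<open>\<omega>\<close> of infinite energy, has the potential of the given measure almost everywhere
  with respect to itself, so that the domination principle makes it a minorant everywhere. For general
  \<open>A\<close> one passes to the strong limit along an increasing sequence of compact subsets, the energies
  being bounded by the Ugaheri principle; lower semicontinuity of potentials along vague limits yields
  the reciprocity \<open>I(\<omega>\<^sup>A, \<sigma>) = I(\<sigma>\<^sup>A, \<omega>)\<close>.

  To pass from n.e. to q.e., one observes that \<open>U \<mapsto> \<parallel>\<sigma>\<^sup>U\<parallel>\<^sup>2\<close> is strongly subadditive on open sets.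
  Its outer extension is therefore a Choquet capacity, for which Borel sets are capacitable; it vanishes
  on Borel sets of inner capacity zero, and on \<open>{U\<^sup>\<sigma> > 0}\<close> its null sets have outer capacity zero.

  A countable set \<open>\<E>\<^sup>0\<close> determines measures of finite energy by their mutual energies with its elements,
  because in a perfect kernel a bounded vaguely convergent sequence has convex combinations that
  converge strongly to the same limit, and bounded sets of measures are vaguely separable.
\<close>

text \<open>Signs are the obstacle: a signed measure may have two infinite variations, and an energy
  two infinite halves, so a difference may be formed only after finiteness has been secured.
  Equations p - q = a - b are therefore kept in the form p + b = q + a, and all Hilbert space
  arguments take place in the cone of positive measures, with sums, nonnegative multiples, midpoints
  and squared norms of formal differences.

  The hinge is the relation \<open>bal\<close>. It asks for equality of potentials almost everywhere
  with respect to every measure of finite energy carried by the set, together with a global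
  inequality; no capacity occurs in it. One and the same measure thus serves as inner and as outer
  swept measure, and the two cases differ only in how small the exceptional set is shown to be.

  A measure of infinite energy is not controlled by Cauchy-Schwarz; reciprocity is what makes its
  mutual energies with swept measures finite. The countable set consists of positive measures chosen
  without reference to \<open>A\<close>, so that uniqueness amounts to comparing two positive
  measures of finite energy.\<close>

locale lch_space =
  fixes X :: "'a::{second_countable_topology, t2_space} itself"
  assumes locally_compact: "locally_compact_space (euclidean :: 'a topology)"
begin

section \<open>Compact neighbourhoods, exhaustions and cutoff functions\<close>

lemma Hausdorff_euclidean: "Hausdorff_space (euclidean :: 'a topology)"
  unfolding Hausdorff_space_def disjnt_def by (metis hausdorff open_openin)

lemma completely_regular_euclidean: "completely_regular_space (euclidean :: 'a topology)"
  using locally_compact_regular_imp_completely_regular_space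
    locally_compact_Hausdorff_imp_regular_space locally_compact Hausdorff_euclidean by blast

lemma compact_neighbourhood:
  fixes x :: 'a
  assumes "open U" "x \<in> U"
  obtains V K where "open V" "compact K" "x \<in> V" "V \<subseteq> K" "K \<subseteq> U"
proof -
  have "neighbourhood_base_of (compactin euclidean) (euclidean :: 'a topology)"
    by (intro locally_compact_imp_neighbourhood_base locally_compact
        locally_compact_Hausdorff_imp_regular_space Hausdorff_euclidean)
  then have "\<exists>V K. open V \<and> compact K \<and> x \<in> V \<and> V \<subseteq> K \<and> K \<subseteq> U"
    unfolding neighbourhood_base_of using assms by (auto simp: compactin_euclidean_iff)
  then show thesis using that by blast
qed

lemma compact_between:
  fixes K U :: "'a set"
  assumes "compact K" "open U" "K \<subseteq> U"
  obtains C where "compact C" "K \<subseteq> interior C" "C \<subseteq> U"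
proof -
  have "\<exists>V C. open V \<and> compact C \<and> x \<in> V \<and> V \<subseteq> C \<and> C \<subseteq> U" if "x \<in> K" for x
  proof -
    have "x \<in> U" using that assms(3) by auto
    then obtain V C where "open V" "compact C" "x \<in> V" "V \<subseteq> C" "C \<subseteq> U"
      by (rule compact_neighbourhood[OF assms(2), of x])
    then show ?thesis by blast
  qed
  then obtain V C where VC: "\<And>x. x \<in> K \<Longrightarrow> open (V x) \<and> compact (C x) \<and> x \<in> V x \<and> V x \<subseteq> C x \<and> C x \<subseteq> U"
    by metis
  obtain F where F: "F \<subseteq> K" "finite F" "K \<subseteq> (\<Union>x\<in>F. V x)"
    by (rule compactE_image[OF assms(1), of K V]) (use VC in auto)
  show thesis
  proof
    show "compact (\<Union>x\<in>F. C x)" using F VC by (auto intro!: compact_UN)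
    have "(\<Union>x\<in>F. V x) \<subseteq> interior (\<Union>x\<in>F. C x)"
      by (intro interior_maximal open_UN) (use F VC in blast)+
    then show "K \<subseteq> interior (\<Union>x\<in>F. C x)" using F(3) by blast
    show "(\<Union>x\<in>F. C x) \<subseteq> U" using F(1) VC by (intro UN_least) auto
  qed
qed

text \<open>By Lindelof, countably many open sets with compact hulls inside \<open>U\<close> cover
  \<open>U\<close>; each \<open>Q (Suc n)\<close> is chosen as a neighbourhood of \<open>Q n\<close>
  that also swallows the n-th hull.\<close>

lemma compact_exhaustion:
  fixes U :: "'a set"
  assumes "open U"
  shows "\<exists>Q :: nat \<Rightarrow> 'a set. (\<forall>n. compact (Q n)) \<and> (\<forall>n. Q n \<subseteq> interior (Q (Suc n))) \<and> (\<Union>n. Q n) = U"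
proof -
  define \<F> where "\<F> = {V. open V \<and> (\<exists>K. compact K \<and> V \<subseteq> K \<and> K \<subseteq> U)}"
  obtain \<F>' where \<F>': "\<F>' \<subseteq> \<F>" "countable \<F>'" "\<Union>\<F>' = \<Union>\<F>"
    using Lindelof[of \<F>] unfolding \<F>_def by blast
  have U: "\<Union>\<F> = U"
  proof
    show "U \<subseteq> \<Union>\<F>"
    proof
      fix x assume "x \<in> U"
      then obtain V K where "open V" "compact K" "x \<in> V" "V \<subseteq> K" "K \<subseteq> U"
        using compact_neighbourhood[OF assms] by metis
      then show "x \<in> \<Union>\<F>" unfolding \<F>_def by blast
    qed
  qed (auto simp: \<F>_def)
  \<comment> \<open>The empty set is added so that the enumeration makes sense for an empty
    cover.\<close>
  define W where "W n = from_nat_into (insert {} \<F>') n" for n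
  have Wr: "range W = insert {} \<F>'" unfolding W_def using \<F>'(2) by (intro range_from_nat_into) auto
  have "\<exists>K. compact K \<and> W n \<subseteq> K \<and> K \<subseteq> U" for n
  proof -
    have "W n \<in> insert {} \<F>'" using Wr by blast
    then show ?thesis using \<F>'(1) unfolding \<F>_def by (cases "W n = {}") (auto intro: exI[of _ "{}"])
  qed
  then obtain L where L: "\<And>n. compact (L n) \<and> W n \<subseteq> L n \<and> L n \<subseteq> U" by metis
  have "\<exists>Q. \<forall>n. (compact (Q n) \<and> Q n \<subseteq> U) \<and> (Q n \<subseteq> interior (Q (Suc n)) \<and> L n \<subseteq> Q (Suc n))"
  proof (rule dependent_nat_choice)
    show "\<exists>x. compact x \<and> x \<subseteq> U" by (rule exI[of _ "{}"]) simp
  next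
    fix C n assume C: "compact C \<and> C \<subseteq> U"
    obtain C' where "compact C'" "C \<subseteq> interior C'" "C' \<subseteq> U"
      using compact_between[OF _ assms, of C] C by blast
    then show "\<exists>y. (compact y \<and> y \<subseteq> U) \<and> C \<subseteq> interior y \<and> L n \<subseteq> y"
      using L[of n] by (intro exI[of _ "C' \<union> L n"])
        (auto intro: compact_Un subsetD[OF interior_mono[of C' "C' \<union> L n"]])
  qed
  then obtain Q where Q: "\<And>n. compact (Q n)" "\<And>n. Q n \<subseteq> U" "\<And>n. Q n \<subseteq> interior (Q (Suc n))" "\<And>n. L n \<subseteq> Q (Suc n)"
    by blast
  have "U \<subseteq> (\<Union>n. Q n)"
  proof
    fix x assume "x \<in> U"
    then have "x \<in> \<Union>(range W)" using U \<F>'(3) Wr by auto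
    then show "x \<in> (\<Union>n. Q n)" using L Q(4) by blast
  qed
  with Q show ?thesis by (intro exI[of _ Q]) auto
qed

lemma exhaustion_mono:
  assumes "\<And>n. Q n \<subseteq> interior (Q (Suc n))"
  shows "incseq (Q :: nat \<Rightarrow> 'a set)"
  using assms interior_subset by (intro incseq_SucI) blast

lemma C0_cutoff:
  fixes K U :: "'a set"
  assumes "compact K" "open U" "K \<subseteq> U"
  obtains \<phi> where "\<phi> \<in> C0" "\<And>x. \<phi> x \<in> {0..1}" "\<And>x. x \<in> K \<Longrightarrow> \<phi> x = 1" "\<And>x. x \<notin> U \<Longrightarrow> \<phi> x = 0"
proof -
  obtain C where C: "compact C" "K \<subseteq> interior C" "C \<subseteq> U" using compact_between assms by blast
  obtain f where f: "continuous_map euclidean (subtopology euclidean {0..1::real}) f"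
      "f ` (- interior C) \<subseteq> {0}" "f ` K \<subseteq> {1}"
    by (rule Urysohn_completely_regular_compact_closed[OF _ completely_regular_euclidean, of 0 1 K "- interior C"])
      (use assms C in \<open>auto simp: disjnt_def compactin_euclidean_iff\<close>)
  have r: "f x \<in> {0..1}" for x using f(1) by (auto simp: continuous_map_in_subtopology)
  have s: "{x. f x \<noteq> 0} \<subseteq> C" using f(2) interior_subset by auto
  have cl: "closure {x. f x \<noteq> 0} \<subseteq> C"
    using closure_minimal[OF s compact_imp_closed[OF C(1)]] .
  have "compact (closure {x. f x \<noteq> 0})"
    using C(1) cl by (metis compact_Int_closed closed_closure inf.absorb_iff2)
  then have "f \<in> C0" using f(1) unfolding C0_def by (auto simp: continuous_map_in_subtopology)
  then show thesis using r f(3) s C(3) by (intro that[of f]) auto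
qed

text \<open>Tietze gives a continuous extension without control of its support; multiplying by a
  cutoff that is 1 on \<open>K\<close> makes the support compact.\<close>

lemma C0_extension:
  fixes K :: "'a set" and f :: "'a \<Rightarrow> real"
  assumes "compact K" "continuous_on K f"
  obtains \<phi> where "\<phi> \<in> C0" "\<And>x. x \<in> K \<Longrightarrow> \<phi> x = f x"
proof -
  obtain g where g: "continuous_map euclidean euclideanreal g" "\<And>x. x \<in> K \<Longrightarrow> g x = f x"
    by (rule Tietze_extension_completely_regular[OF completely_regular_euclidean, of K UNIV f])
      (use assms in \<open>auto simp: compactin_euclidean_iff\<close>)
  obtain \<phi> where \<phi>: "\<phi> \<in> C0" "\<And>x. x \<in> K \<Longrightarrow> \<phi> x = 1"
    by (rule C0_cutoff[OF assms(1) open_UNIV]) auto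
  have "closure {x. g x * \<phi> x \<noteq> 0} \<subseteq> closure {x. \<phi> x \<noteq> 0}" by (intro closure_mono) auto
  then have "compact (closure {x. g x * \<phi> x \<noteq> 0})"
    using \<phi>(1) unfolding C0_def by (metis (no_types, lifting) closed_closure compact_Int_closed inf.absorb_iff2 mem_Collect_eq)
  then have "(\<lambda>x. g x * \<phi> x) \<in> C0"
    using g(1) \<phi>(1) unfolding C0_def by (auto intro!: continuous_on_mult)
  then show thesis using g(2) \<phi>(2) by (intro that[of "\<lambda>x. g x * \<phi> x"]) auto
qed

section \<open>Positive Radon measures\<close>

lemma compact_borel: "compact (K :: 'a set) \<Longrightarrow> K \<in> sets borel"
  by (intro borel_closed compact_imp_closed)

lemma pos_radon_sets: "pos_radon (m :: 'a measure) \<Longrightarrow> sets m = sets borel"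
  by (simp add: pos_radon_def)

lemma pos_radon_space: "pos_radon (m :: 'a measure) \<Longrightarrow> space m = UNIV"
  using sets_eq_imp_space_eq[OF pos_radon_sets] by (metis space_borel)

lemma pos_radon_finite: "pos_radon (m :: 'a measure) \<Longrightarrow> compact K \<Longrightarrow> emeasure m K < \<infinity>"
  by (simp add: pos_radon_def)

lemma pos_radon_sigma_finite:
  assumes m: "pos_radon (m :: 'a measure)"
  shows "sigma_finite_measure m"
proof -
  obtain Q where Q: "\<And>n. compact (Q n)" "\<And>n. Q n \<subseteq> interior (Q (Suc n))" "(\<Union>n. Q n) = (UNIV :: 'a set)"
    using compact_exhaustion[OF open_UNIV] by auto
  show ?thesis
  proof
    have "emeasure m (Q n) \<noteq> \<infinity>" for n using pos_radon_finite[OF m, of "Q n"] Q(1) by auto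
    then show "\<exists>A. countable A \<and> A \<subseteq> sets m \<and> \<Union> A = space m \<and> (\<forall>a\<in>A. emeasure m a \<noteq> \<infinity>)"
      using Q m by (intro exI[of _ "range Q"])
        (auto simp: pos_radon_space pos_radon_sets compact_borel)
  qed
qed

text \<open>The sets that can be squeezed between a closed and an open set up to small mass form a
  sigma-algebra; it contains the open sets because these are countable increasing unions of compact
  sets.\<close>

lemma finite_measure_closed_open_approx:
  fixes m :: "'a measure"
  assumes m: "sets m = sets borel" "finite_measure m" and B: "B \<in> sets borel" and e: "0 < (e::real)"
  shows "\<exists>F U. closed F \<and> open U \<and> F \<subseteq> B \<and> B \<subseteq> U \<and> measure m (U - F) < e"
proof -
  interpret finite_measure m by fact
  have [measurable_cong]: "sets m = sets borel" by fact
  have op: "\<exists>F. closed F \<and> F \<subseteq> U \<and> measure m (U - F) < e" if U: "open U" and e: "0 < e" for U e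
  proof -
    obtain Q where Q: "\<And>n. compact (Q n)" "\<And>n. Q n \<subseteq> interior (Q (Suc n))" "(\<Union>n. Q n) = U"
      using compact_exhaustion[OF U] by auto
    have "(\<lambda>n. measure m (U - Q n)) \<longlonglongrightarrow> measure m (\<Inter>n. U - Q n)"
      using exhaustion_mono[of Q, OF Q(2)] U Q(1)
      by (intro finite_Lim_measure_decseq)
        (auto simp: m(1) decseq_def incseq_def compact_borel[OF Q(1)] intro!: sets.Diff)
    also have "(\<Inter>n. U - Q n) = {}" using Q(3) by auto
    finally have "eventually (\<lambda>n. measure m (U - Q n) < e) sequentially"
      using order_tendstoD(2)[of _ 0 _ e] e by simp
    then obtain n where "measure m (U - Q n) < e" by (auto simp: eventually_sequentially)
    then show ?thesis using Q by (intro exI[of _ "Q n"]) (auto intro: compact_imp_closed)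
  qed
  have "B \<in> sigma_sets UNIV {S. open S}" using B unfolding borel_def by simp
  then show ?thesis using e
  proof (induction arbitrary: e)
    case (Basic U)
    then show ?case using op[of U e] by auto
  next
    case Empty
    then show ?case by (intro exI[of _ "{}"]) auto
  next
    case (Compl B)
    obtain F U where FU: "closed F" "open U" "F \<subseteq> B" "B \<subseteq> U" "measure m (U - F) < e"
      using Compl.IH[OF Compl.prems] by blast
    have "- F - - U = U - F" by auto
    then have 1: "measure m (- F - - U) < e" using FU(5) by simp
    have 2: "- U \<subseteq> UNIV - B" "UNIV - B \<subseteq> - F" using FU(3,4) by auto
    show ?case
      by (intro exI[of _ "- U"] exI[of _ "- F"] conjI closed_Compl[OF FU(2)] open_Compl[OF FU(1)] 1 2)
  next
    case (Union B)
    have pos: "0 < e / 2 * (1/2) ^ Suc n" for n using Union.prems by simp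
    have "\<exists>F U. closed F \<and> open U \<and> F \<subseteq> B n \<and> B n \<subseteq> U \<and> measure m (U - F) < e / 2 * (1/2) ^ Suc n" for n
      using Union.IH[OF pos] .
    then obtain F U where FU: "\<And>n. closed (F n) \<and> open (U n) \<and> F n \<subseteq> B n \<and> B n \<subseteq> U n \<and> measure m (U n - F n) < e / 2 * (1/2) ^ Suc n"
      by metis
    have [measurable]: "F n \<in> sets borel" "U n \<in> sets borel" for n
      using FU by (auto intro: borel_closed borel_open)
    let ?U = "\<Union>n. U n"
    have sm: "summable (\<lambda>n. e / 2 * (1/2) ^ Suc n)" 
      using sums_mult[OF power_half_series, of "e/2"] by (rule sums_summable)
    have le: "measure m (U n - F n) \<le> e / 2 * (1/2) ^ Suc n" for n using FU[of n] by linarith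
    have sm2: "summable (\<lambda>n. measure m (U n - F n))"
      using le by (intro summable_comparison_test'[OF sm, of 0]) auto
    have "measure m (?U - (\<Union>n. F n)) \<le> measure m (\<Union>n. U n - F n)"
      by (intro finite_measure_mono) (auto, measurable)
    also have "\<dots> \<le> (\<Sum>n. measure m (U n - F n))"
      by (rule finite_measure_subadditive_countably[OF _ sm2]) (auto simp: m(1))
    also have "\<dots> \<le> (\<Sum>n. e / 2 * (1/2) ^ Suc n)"
      using suminf_le[OF le sm2 sm] .
    also have "\<dots> = e / 2" using sums_unique[OF sums_mult[OF power_half_series, of "e/2"]] by simp
    finally have 1: "measure m (?U - (\<Union>n. F n)) \<le> e / 2" .
    \<comment> \<open>A countable union of closed sets need not be closed: half of \<open>e\<close>
      is spent on the errors of the sets \<open>B n\<close>, the other half on cutting the union off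
      at a finite stage.\<close>
    have "(\<lambda>k. measure m (?U - (\<Union>n\<le>k. F n))) \<longlonglongrightarrow> measure m (\<Inter>k. ?U - (\<Union>n\<le>k. F n))"
      by (intro finite_Lim_measure_decseq) (auto simp: decseq_def)
    also have "(\<Inter>k. ?U - (\<Union>n\<le>k. F n)) = ?U - (\<Union>n. F n)" by auto
    finally have lim: "(\<lambda>k. measure m (?U - (\<Union>n\<le>k. F n))) \<longlonglongrightarrow> measure m (?U - (\<Union>n. F n))" .
    have "measure m (?U - (\<Union>n. F n)) < e" using 1 Union.prems by linarith
    from order_tendstoD(2)[OF lim this]
    have "eventually (\<lambda>k. measure m (?U - (\<Union>n\<le>k. F n)) < e) sequentially" .
    then obtain k where k: "measure m (?U - (\<Union>n\<le>k. F n)) < e" by (auto simp: eventually_sequentially)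
    moreover have "closed (\<Union>n\<le>k. F n)" using FU by (intro closed_UN) auto
    moreover have "open ?U" using FU by (intro open_UN) auto
    moreover have "(\<Union>n\<le>k. F n) \<subseteq> (\<Union>n. B n)"
    proof (intro UN_least)
      fix n show "F n \<subseteq> (\<Union>n. B n)" using FU[of n] by (meson UN_upper UNIV_I subset_trans)
    qed
    moreover have "(\<Union>n. B n) \<subseteq> ?U" using FU by (intro UN_mono) auto
    ultimately show ?case by (intro exI[of _ "\<Union>n\<le>k. F n"] exI[of _ ?U] conjI)
  qed
qed


lemma C0_integrable:
  assumes m: "pos_radon (m :: 'a measure)" and f: "f \<in> C0"
  shows "integrable m f"
proof -
  let ?S = "closure {x. f x \<noteq> 0}"
  have c: "compact ?S" "continuous_on UNIV f" using f by (auto simp: C0_def)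
  have "bounded (f ` ?S)"
    by (intro compact_imp_bounded compact_continuous_image c continuous_on_subset[OF c(2)]) simp
  then obtain B where B: "\<And>x. x \<in> ?S \<Longrightarrow> norm (f x) \<le> B" unfolding bounded_iff by auto
  have bm: "f \<in> borel_measurable m"
    using borel_measurable_continuous_onI[OF c(2)] measurable_cong_sets[OF pos_radon_sets[OF m] refl] by blast
  have z: "f x = 0" if "x \<notin> ?S" for x using that closure_subset[of "{x. f x \<noteq> 0}"] by auto
  show ?thesis
  proof (rule integrableI_bounded_set)
    show "?S \<in> sets m" using compact_borel[OF c(1)] pos_radon_sets[OF m] by simp
    show "emeasure m ?S < \<infinity>" by (rule pos_radon_finite[OF m c(1)])
    show "AE x in m. x \<in> ?S \<longrightarrow> norm (f x) \<le> B" using B by (intro AE_I2) blast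
    show "AE x in m. x \<notin> ?S \<longrightarrow> f x = 0" using z by (intro AE_I2) blast
  qed (rule bm)
qed

text \<open>Regularity of finite measures is applied to the restriction of \<open>m\<close> to each
  compact set \<open>L j\<close> of an exhaustion; the compact sets
  \<open>L j \<inter> F j i\<close>, united over finite index ranges, fill \<open>B\<close> up to a
  null set.\<close>

lemma radon_compact_inner_approx:
  assumes m: "pos_radon (m :: 'a measure)" and B: "B \<in> sets borel"
  shows "\<exists>Q :: nat \<Rightarrow> 'a set. incseq Q \<and> (\<forall>n. compact (Q n)) \<and> (\<forall>n. Q n \<subseteq> B) \<and> emeasure m (B - (\<Union>n. Q n)) = 0"
proof -
  note [measurable_cong] = pos_radon_sets[OF m]
  have [measurable]: "B \<in> sets borel" by fact
  obtain L where L: "\<And>n. compact (L n)" "\<And>n. L n \<subseteq> interior (L (Suc n))" "(\<Union>n. L n) = (UNIV :: 'a set)"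
    using compact_exhaustion[OF open_UNIV] by auto
  have [measurable]: "L n \<in> sets borel" for n using compact_borel[OF L(1)] .
  have ex: "\<exists>F. closed F \<and> F \<subseteq> B \<and> emeasure m (L j \<inter> (B - F)) < ennreal (1 / Suc n)" for j n
  proof -
    let ?m = "density m (indicator (L j))"
    have em: "emeasure ?m A = emeasure m (L j \<inter> A)" if "A \<in> sets borel" for A
    proof -
      have [measurable]: "A \<in> sets borel" by fact
      show ?thesis
        by (subst emeasure_density) (auto simp: pos_radon_sets[OF m] nn_integral_indicator[symmetric] indicator_inter_arith simp del: nn_integral_indicator intro!: nn_integral_cong)
    qed
    have sp: "space m = UNIV" by (rule pos_radon_space[OF m])
    have fin: "finite_measure ?m"
      by (rule finite_measureI) (use em[of UNIV] pos_radon_finite[OF m L(1), of j] sp in auto)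
    then interpret M: finite_measure ?m .
    obtain F U where FU: "closed F" "open U" "F \<subseteq> B" "B \<subseteq> U" "measure ?m (U - F) < 1 / Suc n"
      using finite_measure_closed_open_approx[of ?m B "1 / Suc n"] fin B pos_radon_sets[OF m] by auto
    have [measurable]: "F \<in> sets borel" "U \<in> sets borel" using FU by (auto intro: borel_closed borel_open)
    have "emeasure m (L j \<inter> (B - F)) = emeasure ?m (B - F)" by (subst em) auto
    also have "\<dots> \<le> emeasure ?m (U - F)" using FU by (intro emeasure_mono) auto
    also have "\<dots> < ennreal (1 / Suc n)"
      using FU(5) by (simp add: M.emeasure_eq_measure ennreal_lessI)
    finally show ?thesis using FU(1,3) by blast
  qed
  then obtain F where F: "\<And>j n. closed (F j n) \<and> F j n \<subseteq> B \<and> emeasure m (L j \<inter> (B - F j n)) < ennreal (1 / Suc n)"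
    by metis
  have [measurable]: "F j n \<in> sets borel" for j n using F by (intro borel_closed) auto
  define Q where "Q n = (\<Union>j\<le>n. \<Union>i\<le>n. L j \<inter> F j i)" for n
  have "incseq Q" unfolding Q_def incseq_def by (auto intro: order_trans)
  moreover have "compact (Q n)" for n
    unfolding Q_def using F L(1) by (intro compact_UN compact_Int_closed) auto
  moreover have "Q n \<subseteq> B" for n unfolding Q_def using F by fastforce
  moreover have "emeasure m (B - (\<Union>n. Q n)) = 0"
  proof -
    have z: "emeasure m (L j \<inter> (B - (\<Union>n. Q n))) = 0" for j
    proof -
      have "emeasure m (L j \<inter> (B - (\<Union>n. Q n))) \<le> ennreal (1 / Suc n)" for n
      proof -
        have "L j \<inter> F j n \<subseteq> Q (max j n)" unfolding Q_def by fastforce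
        then have "L j \<inter> (B - (\<Union>n. Q n)) \<subseteq> L j \<inter> (B - F j n)" by auto
        then have "emeasure m (L j \<inter> (B - (\<Union>n. Q n))) \<le> emeasure m (L j \<inter> (B - F j n))"
          by (intro emeasure_mono) (auto simp: pos_radon_sets[OF m])
        then show ?thesis using F[of j n] by (meson order.trans less_imp_le)
      qed
      then have "emeasure m (L j \<inter> (B - (\<Union>n. Q n))) \<le> ennreal 0"
        by (intro LIMSEQ_le_const[OF tendsto_ennrealI[OF LIMSEQ_Suc[OF lim_1_over_n]]]) (auto simp: add.commute)
      then show ?thesis by simp
    qed
    have [measurable]: "Q n \<in> sets borel" for n unfolding Q_def by measurable
    have "B - (\<Union>n. Q n) = (\<Union>j. L j \<inter> (B - (\<Union>n. Q n)))" using L(3) by auto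
    also have "emeasure m \<dots> = 0"
      using z by (intro emeasure_UN_eq_0) (auto simp: pos_radon_sets[OF m])
    finally show ?thesis .
  qed
  ultimately show ?thesis by blast
qed

lemma radon_compact_subset_pos:
  assumes m: "pos_radon (m :: 'a measure)" and B: "B \<in> sets borel" and pos: "emeasure m B \<noteq> 0"
  shows "\<exists>K. compact K \<and> K \<subseteq> B \<and> emeasure m K \<noteq> 0"
proof -
  obtain Q where Q: "incseq Q" "\<And>n. compact (Q n)" "\<And>n. Q n \<subseteq> B" "emeasure m (B - (\<Union>n. Q n)) = 0"
    using radon_compact_inner_approx[OF m B] by auto
  have s: "Q n \<in> sets m" "B \<in> sets m" for n using compact_borel[OF Q(2)] B pos_radon_sets[OF m] by auto
  show ?thesis
  proof (rule ccontr)
    assume "\<not> ?thesis"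
    then have "emeasure m (Q n) = 0" for n using Q(2,3) by blast
    then have "emeasure m (\<Union>n. Q n) = 0" using s by (intro emeasure_UN_eq_0) auto
    then have "emeasure m ((B - (\<Union>n. Q n)) \<union> (\<Union>n. Q n)) = 0"
      using Q(4) s by (subst emeasure_Un_null_set) (auto simp: null_sets_def)
    moreover have "(B - (\<Union>n. Q n)) \<union> (\<Union>n. Q n) = B" using Q(3) by auto
    ultimately show False using pos by simp
  qed
qed

text \<open>One sequence of cutoffs, built from \<open>U\<close> alone, serves all measures at once;
  both the countable separating family and the semicontinuity under vague limits rest on this
  uniformity.\<close>

lemma open_measure_SUP_C0:
  fixes U :: "'a set"
  assumes U: "open U"
  shows "\<exists>\<phi> :: nat \<Rightarrow> 'a \<Rightarrow> real. (\<forall>n. \<phi> n \<in> C0) \<and> (\<forall>n x. 0 \<le> \<phi> n x) \<and> (\<forall>n x. \<phi> n x \<le> indicator U x) \<and>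
     (\<forall>m. pos_radon m \<longrightarrow> emeasure m U = (SUP n. ennreal (\<integral>x. \<phi> n x \<partial>m)))"
proof -
  obtain Q where Q: "\<And>n. compact (Q n)" "\<And>n. Q n \<subseteq> interior (Q (Suc n))" "(\<Union>n. Q n) = U"
    using compact_exhaustion[OF U] by auto
  have "\<exists>\<phi>. \<phi> \<in> C0 \<and> (\<forall>x. \<phi> x \<in> {0..1}) \<and> (\<forall>x\<in>Q n. \<phi> x = 1) \<and> (\<forall>x. x \<notin> U \<longrightarrow> \<phi> x = 0)" for n
    using C0_cutoff[OF Q(1) U, of n] Q(3) by (metis UN_upper UNIV_I)
  then obtain \<phi> where \<phi>: "\<And>n. \<phi> n \<in> C0 \<and> (\<forall>x. \<phi> n x \<in> {0..1}) \<and> (\<forall>x\<in>Q n. \<phi> n x = 1) \<and> (\<forall>x. x \<notin> U \<longrightarrow> \<phi> n x = 0)"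
    by metis
  have ind: "\<phi> n x \<le> indicator U x" "indicator (Q n) x \<le> \<phi> n x" for n x
    using \<phi>[of n] by (auto simp: indicator_def)
  have "emeasure m U = (SUP n. ennreal (\<integral>x. \<phi> n x \<partial>m))" if m: "pos_radon m" for m
  proof -
    have s: "Q n \<in> sets m" "U \<in> sets m" for n
      using compact_borel[OF Q(1)] borel_open[OF U] pos_radon_sets[OF m] by auto
    have i: "ennreal (\<integral>x. \<phi> n x \<partial>m) = (\<integral>\<^sup>+x. ennreal (\<phi> n x) \<partial>m)" for n
      using C0_integrable[OF m, of "\<phi> n"] \<phi>[of n] by (intro nn_integral_eq_integral[symmetric]) auto
    have "emeasure m (Q n) \<le> ennreal (\<integral>x. \<phi> n x \<partial>m)" for n
    proof -
      have "emeasure m (Q n) = (\<integral>\<^sup>+x. indicator (Q n) x \<partial>m)" using s by simp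
      also have "\<dots> \<le> (\<integral>\<^sup>+x. ennreal (\<phi> n x) \<partial>m)"
        using ind by (intro nn_integral_mono) (metis ennreal_indicator ennreal_leI)
      finally show ?thesis using i by simp
    qed
    moreover have "emeasure m U = (SUP n. emeasure m (Q n))"
      using SUP_emeasure_incseq[of Q m] s exhaustion_mono[of Q, OF Q(2)] Q(3) by (simp add: image_subset_iff)
    ultimately have le: "emeasure m U \<le> (SUP n. ennreal (\<integral>x. \<phi> n x \<partial>m))"
      using SUP_mono'[of "\<lambda>n. emeasure m (Q n)" "\<lambda>n. ennreal (\<integral>x. \<phi> n x \<partial>m)" UNIV] by simp
    have "ennreal (\<integral>x. \<phi> n x \<partial>m) \<le> emeasure m U" for n
    proof -
      have "(\<integral>\<^sup>+x. ennreal (\<phi> n x) \<partial>m) \<le> (\<integral>\<^sup>+x. indicator U x \<partial>m)"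
        using ind by (intro nn_integral_mono) (metis ennreal_indicator ennreal_leI)
      then show ?thesis using i s by simp
    qed
    then have "(SUP n. ennreal (\<integral>x. \<phi> n x \<partial>m)) \<le> emeasure m U" by (rule SUP_least)
    with le show ?thesis by (rule antisym)
  qed
  moreover have "0 \<le> \<phi> n x" for n x using \<phi>[of n] by (meson atLeastAtMost_iff)
  moreover have "\<phi> n \<in> C0" for n using \<phi>[of n] by simp
  ultimately show ?thesis using ind(1) by (intro exI[of _ \<phi>] conjI allI impI)
qed

lemma radon_eqI_open:
  assumes p: "pos_radon (p :: 'a measure)" and q: "pos_radon q"
    and eq: "\<And>U. open U \<Longrightarrow> emeasure p U = emeasure q U"
  shows "p = q"
proof -
  obtain L where L: "\<And>n. compact (L n)" "\<And>n. L n \<subseteq> interior (L (Suc n))" "(\<Union>n. L n) = (UNIV :: 'a set)"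
    using compact_exhaustion[OF open_UNIV] by auto
  show ?thesis
  proof (rule measure_eqI_generator_eq[where E="{S. open S}" and \<Omega>=UNIV and A="\<lambda>n. interior (L n)"])
    show "Int_stable {S :: 'a set. open S}" by (auto simp: Int_stable_def)
    show "sets p = sigma_sets UNIV {S. open S}" "sets q = sigma_sets UNIV {S. open S}"
      using pos_radon_sets[OF p] pos_radon_sets[OF q] by (auto simp: borel_def)
    have "(\<Union>n. L n) \<subseteq> (\<Union>n. interior (L n))" using L(2) by (intro UN_least) (rule subset_trans[OF _ UN_upper], auto)
    then show "(\<Union>n. interior (L n)) = UNIV" unfolding L(3) by (rule top.extremum_uniqueI)
    show "emeasure p (interior (L i)) \<noteq> \<infinity>" for i
    proof -
      have "emeasure p (interior (L i)) \<le> emeasure p (L i)"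
        by (rule emeasure_mono[OF interior_subset]) (simp add: pos_radon_sets[OF p] compact_borel[OF L(1)])
      also have "\<dots> < \<infinity>" by (rule pos_radon_finite[OF p L(1)])
      finally show ?thesis by simp
    qed
  qed (auto simp: eq)
qed

text \<open>Every open set is an increasing union of finite unions of basic sets. There are
  countably many such finite unions, and each contributes the one sequence of functions that
  computes its mass for every Radon measure.\<close>

lemma countable_separating_C0:
  "\<exists>\<Phi> :: ('a \<Rightarrow> real) set. countable \<Phi> \<and> \<Phi> \<subseteq> C0 \<and> (\<forall>\<phi>\<in>\<Phi>. \<forall>x. 0 \<le> \<phi> x) \<and>
    (\<forall>p q. pos_radon p \<and> pos_radon q \<and> (\<forall>\<phi>\<in>\<Phi>. (\<integral>x. \<phi> x \<partial>p) = (\<integral>x. \<phi> x \<partial>q)) \<longrightarrow> p = q)"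
proof -
  obtain \<B> :: "'a set set" where \<B>: "countable \<B>" "topological_basis \<B>" using ex_countable_basis by blast
  define \<C> where "\<C> = Union ` {F. finite F \<and> F \<subseteq> \<B>}"
  have cC: "countable \<C>" unfolding \<C>_def using countable_Collect_finite_subset[OF \<B>(1)] by auto
  have oC: "open U" if "U \<in> \<C>" for U
    using that topological_basis_open[OF \<B>(2)] unfolding \<C>_def by auto
  define good where "good U \<phi> \<longleftrightarrow> (\<forall>n. \<phi> n \<in> C0) \<and> (\<forall>n x. 0 \<le> \<phi> n x) \<and>
     (\<forall>m. pos_radon m \<longrightarrow> emeasure m U = (SUP n. ennreal (\<integral>x. \<phi> n x \<partial>m)))"
    for U and \<phi> :: "nat \<Rightarrow> 'a \<Rightarrow> real"
  have "\<exists>\<phi>. good U \<phi>" if "U \<in> \<C>" for U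
    using open_measure_SUP_C0[OF oC[OF that]] unfolding good_def by blast
  then obtain \<phi> where "\<And>U. U \<in> \<C> \<Longrightarrow> good U (\<phi> U)" by metis
  then have \<phi>: "\<phi> U n \<in> C0" "pos_radon m \<Longrightarrow> emeasure m U = (SUP n. ennreal (\<integral>x. \<phi> U n x \<partial>m))"
    and \<phi>0: "0 \<le> \<phi> U n x"
    if "U \<in> \<C>" for U n m x using that unfolding good_def by auto
  define \<Phi> where "\<Phi> = (\<Union>U\<in>\<C>. range (\<phi> U))"
  have "p = q" if p: "pos_radon p" and q: "pos_radon q" and eq: "\<forall>\<phi>\<in>\<Phi>. (\<integral>x. \<phi> x \<partial>p) = (\<integral>x. \<phi> x \<partial>q)" for p q
  proof (rule radon_eqI_open[OF p q])
    fix U :: "'a set" assume "open U"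
    then obtain F where F: "F \<subseteq> \<B>" "\<Union>F = U" using \<B>(2) unfolding topological_basis_def by metis
    show "emeasure p U = emeasure q U"
    proof (cases "F = {}")
      case False
      define b where "b = from_nat_into F"
      have cF: "countable F" by (rule countable_subset[OF F(1) \<B>(1)])
      have rb: "range b = F" unfolding b_def using False cF by (rule range_from_nat_into)
      define V where "V n = \<Union>(b ` {..n})" for n
      have VC: "V n \<in> \<C>" for n unfolding V_def \<C>_def using rb F(1) by (intro imageI) auto
      have inc: "incseq V" unfolding V_def incseq_def by (auto intro: order_trans)
      have VU: "(\<Union>n. V n) = U" unfolding V_def using F(2) rb by auto
      have s: "range V \<subseteq> sets p" "range V \<subseteq> sets q"
        using oC[OF VC] pos_radon_sets[OF p] pos_radon_sets[OF q] by auto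
      have "emeasure p (V n) = emeasure q (V n)" for n
      proof -
        have "(\<integral>x. \<phi> (V n) k x \<partial>p) = (\<integral>x. \<phi> (V n) k x \<partial>q)" for k
          using eq VC[of n] unfolding \<Phi>_def by auto
        then show ?thesis using \<phi>(2)[OF VC[of n] p] \<phi>(2)[OF VC[of n] q] by simp
      qed
      then show ?thesis
        using SUP_emeasure_incseq[OF s(1) inc] SUP_emeasure_incseq[OF s(2) inc] VU by simp
    qed (use F in auto)
  qed
  moreover have "countable \<Phi>" "\<Phi> \<subseteq> C0" "\<forall>\<phi>\<in>\<Phi>. \<forall>x. 0 \<le> \<phi> x" unfolding \<Phi>_def using cC \<phi>(1) \<phi>0 by auto
  ultimately show ?thesis by blast
qed

end

section \<open>Sums, multiples and restrictions of Borel measures; Jordan decompositions\<close>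

definition radd :: "'a::topological_space measure \<Rightarrow> 'a measure \<Rightarrow> 'a measure" where
  "radd p q = measure_of UNIV (sets borel) (\<lambda>B. emeasure p B + emeasure q B)"

definition rscale :: "real \<Rightarrow> 'a measure \<Rightarrow> 'a measure" where
  "rscale t p = scale_measure (ennreal t) p"

definition rrestrict :: "'a measure \<Rightarrow> 'a set \<Rightarrow> 'a measure" where
  "rrestrict p B = density p (indicator B)"

lemma sets_radd [simp]: "sets (radd p q) = sets borel"
  unfolding radd_def by (metis sets.sets_measure_of_eq space_borel)

lemma space_radd [simp]: "space (radd p q) = UNIV"
  using sets_eq_imp_space_eq[OF sets_radd[of p q]] by simp

lemma emeasure_radd:
  assumes "sets p = sets borel" "sets q = sets borel"
  shows "emeasure (radd p q) B = emeasure p B + emeasure q B"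
proof (cases "B \<in> sets borel")
  case True
  show ?thesis
  proof (rule emeasure_measure_of[OF radd_def])
    show "countably_additive (sets (radd p q)) (\<lambda>B. emeasure p B + emeasure q B)"
      unfolding countably_additive_def
    proof (intro allI impI)
      fix A :: "nat \<Rightarrow> 'a set"
      assume A: "range A \<subseteq> sets (radd p q)" "disjoint_family A"
      then have "range A \<subseteq> sets p" "range A \<subseteq> sets q" using assms by auto
      then show "(\<Sum>i. emeasure p (A i) + emeasure q (A i)) = emeasure p (\<Union>i. A i) + emeasure q (\<Union>i. A i)"
        using A(2) by (simp add: suminf_add[symmetric] suminf_emeasure)
    qed
  qed (use True in \<open>auto simp: positive_def\<close>)
qed (use assms in \<open>simp add: emeasure_notin_sets\<close>)

lemma nn_integral_radd:
  assumes p: "sets p = sets borel" and q: "sets q = sets borel" and f: "f \<in> borel_measurable borel"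
  shows "(\<integral>\<^sup>+x. f x \<partial>radd p q) = (\<integral>\<^sup>+x. f x \<partial>p) + (\<integral>\<^sup>+x. f x \<partial>q)"
proof -
  note [measurable_cong] = p q
  from f show ?thesis
  proof (induction rule: borel_measurable_induct)
    case (cong f g)
    then have "f = g" by auto
    then show ?case using cong(4) by simp
  next
    case (set A)
    then show ?case by (simp add: emeasure_radd[OF p q] p q)
  next
    case (mult u c)
    have "u \<in> borel_measurable r" if "sets r = sets borel" for r
      using mult(2) measurable_cong_sets[OF that refl] by blast
    then show ?case using p q by (simp add: nn_integral_cmult mult.IH distrib_left)
  next
    case (add u v)
    have "u \<in> borel_measurable r" "v \<in> borel_measurable r" if "sets r = sets borel" for r
      using add(1,3) measurable_cong_sets[OF that refl] by blast+
    then show ?case using p q by (simp add: nn_integral_add add.IH ac_simps)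
  next
    case (seq U)
    note [measurable] = seq(1)
    have sp: "space p = UNIV" "space q = UNIV" using sets_eq_imp_space_eq[OF p] sets_eq_imp_space_eq[OF q] by auto
    have i: "incseq U" "\<And>x. incseq (\<lambda>i. U i x)" using seq(3) by (auto simp: incseq_def le_fun_def)
    have m: "(\<integral>\<^sup>+x. (SUP i. U i) x \<partial>r) = (SUP i. \<integral>\<^sup>+x. U i x \<partial>r)" if "sets r = sets borel" for r
    proof -
      have "U i \<in> borel_measurable r" for i using seq(1) measurable_cong_sets[OF that refl] by blast
      from nn_integral_monotone_convergence_SUP[OF i(1) this] show ?thesis by (simp add: SUP_apply image_comp)
    qed
    show ?case
      unfolding m[OF p] m[OF q] m[OF sets_radd] seq.IH
      by (rule ennreal_SUP_add) (auto intro!: incseq_SucI nn_integral_mono simp: incseq_SucD[OF i(2)])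
  qed
qed

lemma sets_rscale [simp]: "sets (rscale t p) = sets p"
  by (simp add: rscale_def)

lemma emeasure_rscale: "emeasure (rscale t p) B = ennreal t * emeasure p B"
  by (simp add: rscale_def)

lemma nn_integral_rscale:
  assumes "f \<in> borel_measurable p"
  shows "(\<integral>\<^sup>+x. f x \<partial>rscale t p) = ennreal t * (\<integral>\<^sup>+x. f x \<partial>p)"
  using assms by (simp add: rscale_def nn_integral_scale_measure)

lemma sets_rrestrict [simp]: "sets (rrestrict p B) = sets p"
  by (simp add: rrestrict_def)

lemma emeasure_rrestrict:
  assumes "B \<in> sets p" "C \<in> sets p"
  shows "emeasure (rrestrict p B) C = emeasure p (B \<inter> C)"
proof -
  have "emeasure (rrestrict p B) C = (\<integral>\<^sup>+x. indicator B x * indicator C x \<partial>p)"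
    using assms unfolding rrestrict_def by (subst emeasure_density) auto
  also have "\<dots> = (\<integral>\<^sup>+x. indicator (B \<inter> C) x \<partial>p)" by (simp add: indicator_inter_arith)
  finally show ?thesis using assms by simp
qed

lemma nn_integral_rrestrict:
  assumes "B \<in> sets p" "f \<in> borel_measurable p"
  shows "(\<integral>\<^sup>+x. f x \<partial>rrestrict p B) = (\<integral>\<^sup>+x. indicator B x * f x \<partial>p)"
  using assms unfolding rrestrict_def by (subst nn_integral_density) auto

lemma nn_integral_mono_measure:
  assumes s: "sets p = sets borel" "sets q = sets borel" and le: "\<And>B. B \<in> sets borel \<Longrightarrow> emeasure p B \<le> emeasure q B"
    and f: "f \<in> borel_measurable borel"
  shows "(\<integral>\<^sup>+x. f x \<partial>p) \<le> (\<integral>\<^sup>+x. f x \<partial>q)"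
proof -
  note [measurable_cong] = s
  from f show ?thesis
  proof (induction rule: borel_measurable_induct)
    case (cong f g)
    then have "f = g" by auto
    then show ?case using cong(4) by simp
  next
    case (set A)
    then show ?case using le s by simp
  next
    case (mult u c)
    have "u \<in> borel_measurable r" if "sets r = sets borel" for r
      using mult(2) measurable_cong_sets[OF that refl] by blast
    then show ?case using s by (simp add: nn_integral_cmult mult.IH mult_left_mono)
  next
    case (add u v)
    have "u \<in> borel_measurable r" "v \<in> borel_measurable r" if "sets r = sets borel" for r
      using add(1,3) measurable_cong_sets[OF that refl] by blast+
    then show ?case using s by (simp add: nn_integral_add add.IH add_mono)
  next
    case (seq U)
    have i: "incseq U" using seq(3) by (auto simp: incseq_def le_fun_def)
    have m: "(\<integral>\<^sup>+x. (SUP i. U i) x \<partial>r) = (SUP i. \<integral>\<^sup>+x. U i x \<partial>r)" if "sets r = sets borel" for r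
    proof -
      have "U i \<in> borel_measurable r" for i using seq(1) measurable_cong_sets[OF that refl] by blast
      from nn_integral_monotone_convergence_SUP[OF i this] show ?thesis by (simp add: SUP_apply image_comp)
    qed
    show ?case
      unfolding m[OF s(1)] m[OF s(2)] by (intro SUP_mono' seq.IH)
  qed
qed

lemma measure_eqI_borel:
  assumes "sets p = sets borel" "sets q = sets borel" "\<And>B. B \<in> sets borel \<Longrightarrow> emeasure p B = emeasure q B"
  shows "p = q"
  using assms by (intro measure_eqI) auto

lemma pos_radon_dominated:
  assumes "sets p = sets borel" "pos_radon q" "\<And>B. B \<in> sets borel \<Longrightarrow> emeasure p B \<le> emeasure q B"
  shows "pos_radon (p :: 'a::t2_space measure)"
  unfolding pos_radon_def
proof (intro conjI allI impI)
  fix K :: "'a set" assume K: "compact K"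
  then have "emeasure p K \<le> emeasure q K" using assms(3) by (simp add: borel_closed compact_imp_closed)
  then show "emeasure p K < \<infinity>" using assms(2) K unfolding pos_radon_def by (meson order.strict_trans1)
qed (fact assms)

lemma pos_radon_null [simp]: "pos_radon (null_measure borel)"
  by (simp add: pos_radon_def)

lemma pos_radon_radd: "pos_radon p \<Longrightarrow> pos_radon q \<Longrightarrow> pos_radon (radd p q)"
  by (simp add: pos_radon_def emeasure_radd)

lemma pos_radon_rscale: "pos_radon p \<Longrightarrow> pos_radon (rscale t p)"
  by (auto simp: pos_radon_def emeasure_rscale ennreal_mult_less_top)

lemma pos_radon_rrestrict:
  assumes "pos_radon (p :: 'a::t2_space measure)" "B \<in> sets borel" 
  shows "pos_radon (rrestrict p B)"
proof (rule pos_radon_dominated[OF _ assms(1)])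
  show s: "sets (rrestrict p B) = sets borel" using assms by (simp add: pos_radon_def)
  show "emeasure (rrestrict p B) C \<le> emeasure p C" if "C \<in> sets borel" for C
    using assms that by (subst emeasure_rrestrict) (auto simp: pos_radon_def intro!: emeasure_mono)
qed

text \<open>Infinite values forbid subtraction. The separating sets \<open>S\<close> and
  \<open>T\<close> cut \<open>B\<close> into four pieces, and on each piece one of
  \<open>p1\<close>, \<open>q1\<close> and one of \<open>p2\<close>, \<open>q2\<close> vanish; the
  equation then equates the two remaining terms or forces both to be zero.\<close>

lemma jordan_unique:
  assumes s: "sets p1 = sets borel" "sets q1 = sets borel" "sets p2 = sets borel" "sets q2 = sets borel"
    and sing: "singular_measures p1 q1" "singular_measures p2 q2"
    and eq: "\<And>B. B \<in> sets borel \<Longrightarrow> emeasure p1 B + emeasure q2 B = emeasure q1 B + emeasure p2 B"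
  shows "p1 = p2 \<and> q1 = q2"
proof -
  obtain S T where S: "S \<in> sets borel" "emeasure p1 S = 0" "emeasure q1 (- S) = 0"
    and T: "T \<in> sets borel" "emeasure p2 T = 0" "emeasure q2 (- T) = 0"
    using sing unfolding singular_measures_def by auto
  have sub: "emeasure r B = 0" if "emeasure r A = 0" "B \<subseteq> A" "A \<in> sets borel" "sets r = sets borel" for r A B
    using emeasure_mono[of B A r] that by auto
  have "emeasure p1 B = emeasure p2 B \<and> emeasure q1 B = emeasure q2 B" if B: "B \<in> sets borel" for B
  proof -
    have nS: "- S \<in> sets borel" "- T \<in> sets borel" using S(1) T(1) by auto
    have split: "emeasure r B = emeasure r (B \<inter> S \<inter> T) + emeasure r (B \<inter> S \<inter> - T) + emeasure r (B \<inter> - S \<inter> T) + emeasure r (B \<inter> - S \<inter> - T)"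
      if r: "sets r = sets borel" for r
    proof -
      have 1: "emeasure r B = emeasure r (B \<inter> S) + emeasure r (B \<inter> - S)"
        using B S(1) r by (subst plus_emeasure) (auto intro!: arg_cong[where f="emeasure r"])
      have 2: "emeasure r C = emeasure r (C \<inter> T) + emeasure r (C \<inter> - T)" if "C \<in> sets borel" for C
        using that T(1) r by (subst plus_emeasure) (auto intro!: arg_cong[where f="emeasure r"])
      show ?thesis using 1 2[of "B \<inter> S"] 2[of "B \<inter> - S"] B S(1) by (simp add: ac_simps)
    qed
    have z: "emeasure p1 (B \<inter> S \<inter> T) = 0" "emeasure p1 (B \<inter> S \<inter> - T) = 0"
      "emeasure q1 (B \<inter> - S \<inter> T) = 0" "emeasure q1 (B \<inter> - S \<inter> - T) = 0"
      "emeasure p2 (B \<inter> S \<inter> T) = 0" "emeasure p2 (B \<inter> - S \<inter> T) = 0"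
      "emeasure q2 (B \<inter> S \<inter> - T) = 0" "emeasure q2 (B \<inter> - S \<inter> - T) = 0"
      using S T nS s by (auto intro: sub[OF S(2)] sub[OF S(3)] sub[OF T(2)] sub[OF T(3)])
    have e: "emeasure p1 C + emeasure q2 C = emeasure q1 C + emeasure p2 C"
      if "C = B \<inter> S \<inter> T \<or> C = B \<inter> S \<inter> - T \<or> C = B \<inter> - S \<inter> T \<or> C = B \<inter> - S \<inter> - T" for C
      using that B S(1) T(1) by (intro eq) auto
    show ?thesis
      using z e[of "B \<inter> S \<inter> T"] e[of "B \<inter> S \<inter> - T"] e[of "B \<inter> - S \<inter> T"] e[of "B \<inter> - S \<inter> - T"]
      unfolding split[OF s(1)] split[OF s(2)] split[OF s(3)] split[OF s(4)] by auto
  qed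
  then show ?thesis using s by (auto intro!: measure_eqI_borel)
qed

text \<open>Minimality of the Jordan decomposition: \<open>q\<close> is carried by \<open>S\<close>,
  so off \<open>S\<close> the equation reads p + b = a, while \<open>p\<close> has no mass in
  \<open>S\<close>.\<close>

lemma jordan_dominated:
  assumes s: "sets p = sets borel" "sets q = sets borel" "sets a = sets borel"
    and sing: "singular_measures p q"
    and eq: "\<And>B. B \<in> sets borel \<Longrightarrow> emeasure p B + emeasure b B = emeasure q B + emeasure a B"
    and B: "B \<in> sets borel"
  shows "emeasure p B \<le> emeasure a B"
proof -
  obtain S where S: "S \<in> sets borel" "emeasure p S = 0" "emeasure q (- S) = 0"
    using sing unfolding singular_measures_def by auto
  have "emeasure p (B \<inter> S) = 0" using emeasure_mono[of "B \<inter> S" S p] S s by auto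
  moreover have "emeasure q (B \<inter> - S) = 0"
    using emeasure_mono[of "B \<inter> - S" "- S" q] S s by auto
  moreover have "emeasure p B = emeasure p (B \<inter> S) + emeasure p (B \<inter> - S)"
    using B S(1) s by (subst plus_emeasure) (auto intro!: arg_cong[where f="emeasure p"])
  ultimately have "emeasure p B + emeasure b (B \<inter> - S) = emeasure a (B \<inter> - S)"
    using eq[of "B \<inter> - S"] B S(1) by auto
  also have "\<dots> \<le> emeasure a B" using B s by (intro emeasure_mono) auto
  finally show ?thesis using order_trans[of _ "emeasure p B + emeasure b (B \<inter> - S)"] by auto
qed

text \<open>Both measures have densities with respect to their sum, and the truncated differences of
  these densities define the two parts.\<close>

lemma (in lch_space) jordan_exists:
  assumes a: "pos_radon (a :: 'a measure)" and b: "pos_radon b"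
  shows "\<exists>p q. pos_radon p \<and> pos_radon q \<and> singular_measures p q \<and>
     (\<forall>B\<in>sets borel. emeasure p B + emeasure b B = emeasure q B + emeasure a B)"
proof -
  define N where "N = radd a b"
  have sa: "sets a = sets borel" "sets b = sets borel" and sN: "sets N = sets borel"
    using a b by (auto simp: pos_radon_sets N_def)
  note [measurable_cong] = sN
  interpret N: sigma_finite_measure N
    unfolding N_def by (intro pos_radon_sigma_finite pos_radon_radd a b)
  have eN: "emeasure N B = emeasure a B + emeasure b B" for B
    unfolding N_def by (rule emeasure_radd[OF sa])
  have "absolutely_continuous N a" "absolutely_continuous N b"
    unfolding absolutely_continuous_def null_sets_def using eN sa sN by auto
  then obtain f g where f[measurable]: "f \<in> borel_measurable N" and fa: "density N f = a"
    and g[measurable]: "g \<in> borel_measurable N" and gb: "density N g = b"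
    using N.Radon_Nikodym[of a] N.Radon_Nikodym[of b] sa sN by auto
  \<comment> \<open>The case distinction yields 0 where \<open>f\<close> and \<open>g\<close> are
    both infinite; the bare difference would be infinite there, since
    \<open>top - top = top\<close>.\<close>
  define p where "p = density N (\<lambda>x. if f x \<le> g x then 0 else f x - g x)"
  define q where "q = density N (\<lambda>x. if g x \<le> f x then 0 else g x - f x)"
  have s: "sets p = sets borel" "sets q = sets borel" by (auto simp: p_def q_def sN)
  have pa: "emeasure p B \<le> emeasure a B" if "B \<in> sets borel" for B
    using that unfolding p_def fa[symmetric]
    by (auto simp: emeasure_density sN intro!: nn_integral_mono split: split_indicator)
  have qb: "emeasure q B \<le> emeasure b B" if "B \<in> sets borel" for B
    using that unfolding q_def gb[symmetric]
    by (auto simp: emeasure_density sN intro!: nn_integral_mono split: split_indicator)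
  have sum: "emeasure p B + emeasure b B = emeasure q B + emeasure a B" if B: "B \<in> sets borel" for B
  proof -
    have [measurable]: "B \<in> sets N" using B sN by simp
    have "emeasure p B + emeasure b B = (\<integral>\<^sup>+x. (if f x \<le> g x then 0 else f x - g x) * indicator B x + g x * indicator B x \<partial>N)"
      unfolding p_def gb[symmetric] by (simp add: emeasure_density nn_integral_add)
    also have "\<dots> = (\<integral>\<^sup>+x. (if g x \<le> f x then 0 else g x - f x) * indicator B x + f x * indicator B x \<partial>N)"
      by (intro nn_integral_cong) (auto split: split_indicator simp: diff_add_self_ennreal)
    also have "\<dots> = emeasure q B + emeasure a B"
      unfolding q_def fa[symmetric] by (simp add: emeasure_density nn_integral_add)
    finally show ?thesis .
  qed
  have "singular_measures p q"
    unfolding singular_measures_def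
  proof (intro bexI conjI)
    define S where "S = {x\<in>space N. f x \<le> g x}"
    have [measurable]: "S \<in> sets N" unfolding S_def by measurable
    then show "S \<in> sets borel" using sN by simp
    have sp: "space N = UNIV" using sets_eq_imp_space_eq[OF sN] by simp
    have "- S \<in> sets N" using \<open>S \<in> sets N\<close> sN by simp
    note [measurable] = this
    have "(\<integral>\<^sup>+x. (if f x \<le> g x then 0 else f x - g x) * indicator S x \<partial>N) = (\<integral>\<^sup>+x. 0 \<partial>N)"
      by (intro nn_integral_cong) (auto simp: S_def split: split_indicator)
    then show "emeasure p S = 0" unfolding p_def by (simp add: emeasure_density)
    have "(\<integral>\<^sup>+x. (if g x \<le> f x then 0 else g x - f x) * indicator (- S) x \<partial>N) = (\<integral>\<^sup>+x. 0 \<partial>N)"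
      by (intro nn_integral_cong) (auto simp: S_def sp split: split_indicator)
    then show "emeasure q (- S) = 0" unfolding q_def by (simp add: emeasure_density)
  qed
  moreover have "pos_radon p" "pos_radon q"
    using pos_radon_dominated[OF s(1) a pa] pos_radon_dominated[OF s(2) b qb] by auto
  ultimately show ?thesis using sum by blast
qed

section \<open>Vague convergence and lower semicontinuity\<close>

context lch_space
begin

definition vague_lim :: "(nat \<Rightarrow> 'a measure) \<Rightarrow> 'a measure \<Rightarrow> bool" where
  "vague_lim ms m \<longleftrightarrow> (\<forall>\<phi>\<in>C0. (\<lambda>n. \<integral>x. \<phi> x \<partial>ms n) \<longlonglongrightarrow> (\<integral>x. \<phi> x \<partial>m))"

text \<open>The mass of an open set is a supremum of integrals of functions in \<open>C0\<close>,
  each of which is vaguely continuous.\<close>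

lemma vague_lim_open:
  assumes m: "pos_radon m" "\<And>n. pos_radon (ms n)" and v: "vague_lim ms m" and U: "open U"
  shows "emeasure m U \<le> liminf (\<lambda>n. emeasure (ms n) U)"
proof -
  obtain \<phi> :: "nat \<Rightarrow> 'a \<Rightarrow> real" where "\<forall>k. \<phi> k \<in> C0"
      "\<forall>p. pos_radon p \<longrightarrow> emeasure p U = (SUP k. ennreal (\<integral>x. \<phi> k x \<partial>p))"
    using open_measure_SUP_C0[OF U] by (elim exE conjE) (rule that)
  then have \<phi>: "\<phi> k \<in> C0" "pos_radon p \<Longrightarrow> emeasure p U = (SUP k. ennreal (\<integral>x. \<phi> k x \<partial>p))" for k p
    by auto
  have "ennreal (\<integral>x. \<phi> k x \<partial>m) \<le> liminf (\<lambda>n. emeasure (ms n) U)" for k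
  proof -
    have "(\<lambda>n. ennreal (\<integral>x. \<phi> k x \<partial>ms n)) \<longlonglongrightarrow> ennreal (\<integral>x. \<phi> k x \<partial>m)"
      using v \<phi>(1) unfolding vague_lim_def by (intro tendsto_ennrealI) auto
    then have "ennreal (\<integral>x. \<phi> k x \<partial>m) = liminf (\<lambda>n. ennreal (\<integral>x. \<phi> k x \<partial>ms n))"
      by (simp add: lim_imp_Liminf)
    also have "\<dots> \<le> liminf (\<lambda>n. emeasure (ms n) U)"
      by (intro Liminf_mono always_eventually allI) (subst \<phi>(2)[OF m(2)], rule SUP_upper, simp)
    finally show ?thesis .
  qed
  then show ?thesis unfolding \<phi>(2)[OF m(1)] by (intro SUP_least) auto
qed

text \<open>Integrals are reduced to masses of superlevel sets, which are open if the function is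
  lower semicontinuous. Measurability in the level \<open>t\<close> is recorded for the use of
  Fatou's lemma.\<close>

lemma layer_cake:
  fixes f :: "'b \<Rightarrow> ennreal"
  assumes m: "sigma_finite_measure m" and f[measurable]: "f \<in> borel_measurable m"
  shows "(\<integral>\<^sup>+x. f x \<partial>m) = (\<integral>\<^sup>+t. indicator {0..} t * emeasure m {x\<in>space m. ennreal t < f x} \<partial>lborel)"
    and "(\<lambda>t. indicator {0..} t * emeasure m {x\<in>space m. ennreal t < f x}) \<in> borel_measurable lborel"
proof -
  interpret sigma_finite_measure m by fact
  interpret P: pair_sigma_finite lborel m by unfold_locales
  let ?h = "\<lambda>t x. indicator {0..} t * (if ennreal t < f x then 1 else 0 :: ennreal)"
  have h[measurable]: "(\<lambda>(t, x). ?h t x) \<in> borel_measurable (lborel \<Otimes>\<^sub>M m)" by measurable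
  have i: "(\<integral>\<^sup>+x. ?h t x \<partial>m) = indicator {0..} t * emeasure m {x\<in>space m. ennreal t < f x}" for t
  proof -
    have "(\<integral>\<^sup>+x. (if ennreal t < f x then 1 else 0 :: ennreal) \<partial>m) = (\<integral>\<^sup>+x. indicator {x\<in>space m. ennreal t < f x} x \<partial>m)"
      by (intro nn_integral_cong) auto
    also have "\<dots> = emeasure m {x\<in>space m. ennreal t < f x}" by (intro nn_integral_indicator) measurable
    finally show ?thesis by (simp add: nn_integral_cmult)
  qed
  have inner: "(\<integral>\<^sup>+t. ?h t x \<partial>lborel) = f x" for x
  proof (cases "f x")
    case (real r)
    have "(\<integral>\<^sup>+t. ?h t x \<partial>lborel) = (\<integral>\<^sup>+t. indicator {0..<r} t \<partial>lborel)"
      using real by (intro nn_integral_cong) (auto split: split_indicator simp: ennreal_less_iff)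
    then show ?thesis using real by simp
  next
    case top
    have "(\<integral>\<^sup>+t. ?h t x \<partial>lborel) = (\<integral>\<^sup>+t. indicator {0::real..} t \<partial>lborel)"
      using top by (intro nn_integral_cong) (auto split: split_indicator)
    then have e: "(\<integral>\<^sup>+t. ?h t x \<partial>lborel) = emeasure lborel {0::real..}" by simp
    have "of_nat n \<le> emeasure lborel {0::real..}" for n
      using emeasure_mono[of "{0..real n}" "{0..}" lborel] by (simp add: ennreal_of_nat_eq_real_of_nat)
    then have "emeasure lborel {0::real..} = top"
      by (metis ennreal_SUP_of_nat_eq_top SUP_least top.extremum_unique)
    then show ?thesis using e top by simp
  qed
  have "(\<integral>\<^sup>+x. f x \<partial>m) = (\<integral>\<^sup>+x. \<integral>\<^sup>+t. ?h t x \<partial>lborel \<partial>m)" by (simp only: inner)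
  also have "\<dots> = (\<integral>\<^sup>+t. \<integral>\<^sup>+x. ?h t x \<partial>m \<partial>lborel)" by (rule P.Fubini') measurable
  finally show "(\<integral>\<^sup>+x. f x \<partial>m) = (\<integral>\<^sup>+t. indicator {0..} t * emeasure m {x\<in>space m. ennreal t < f x} \<partial>lborel)"
    by (simp only: i)
  have "(\<lambda>t. \<integral>\<^sup>+x. ?h t x \<partial>m) \<in> borel_measurable lborel" by measurable
  then show "(\<lambda>t. indicator {0..} t * emeasure m {x\<in>space m. ennreal t < f x}) \<in> borel_measurable lborel"
    by (simp only: i)
qed

lemma lsc_borel_measurable:
  fixes f :: "'b::topological_space \<Rightarrow> ennreal"
  assumes "\<And>c. open {x. c < f x}"
  shows "f \<in> borel_measurable borel"
  using assms by (intro borel_measurableI_greater) auto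

text \<open>The layer cake formula leaves only the open superlevel sets of \<open>f\<close> to be
  treated; Fatou's lemma in the level \<open>t\<close> then moves the lower limit outside the
  integral.\<close>

lemma vague_lim_lsc:
  assumes m: "pos_radon m" "\<And>n. pos_radon (ms n)" and v: "vague_lim ms m"
    and f: "\<And>c. open {x. c < f x}"
  shows "(\<integral>\<^sup>+x. f x \<partial>m) \<le> liminf (\<lambda>n. \<integral>\<^sup>+x. f x \<partial>ms n)"
proof -
  have fm: "f \<in> borel_measurable p" if "pos_radon p" for p
    using lsc_borel_measurable[OF f] measurable_cong_sets[OF pos_radon_sets[OF that] refl] by blast
  let ?g = "\<lambda>p t. indicator {0..} t * emeasure p {x. ennreal t < f x}"
  have lc: "(\<integral>\<^sup>+x. f x \<partial>p) = (\<integral>\<^sup>+t. ?g p t \<partial>lborel)" "?g p \<in> borel_measurable lborel" if "pos_radon p" for p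
    using layer_cake[OF pos_radon_sigma_finite[OF that] fm[OF that]] pos_radon_space[OF that] by auto
  have "(\<integral>\<^sup>+t. ?g m t \<partial>lborel) \<le> (\<integral>\<^sup>+t. liminf (\<lambda>n. ?g (ms n) t) \<partial>lborel)"
  proof (intro nn_integral_mono)
    fix t :: real
    show "?g m t \<le> liminf (\<lambda>n. ?g (ms n) t)"
      using vague_lim_open[OF m v f] by (auto split: split_indicator)
  qed
  also have "\<dots> \<le> liminf (\<lambda>n. \<integral>\<^sup>+t. ?g (ms n) t \<partial>lborel)"
    by (intro nn_integral_liminf lc m)
  finally show ?thesis using lc(1)[OF m(1)] lc(1)[OF m(2)] by simp
qed

end

section \<open>Potentials and mutual energies of positive measures\<close>

locale kernel_space =
  fixes \<kappa> :: "'a::{second_countable_topology, t2_space} kernel"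
  assumes locally_compact: "locally_compact_space (euclidean :: 'a topology)"
    and kernel: "is_kernel \<kappa>"

sublocale kernel_space \<subseteq> lch_space "TYPE('a)"
  by unfold_locales (rule locally_compact)

text \<open>
  Positive measures are handled as such, not as elements of the type \<open>radon\<close>. In the paper's notation
  \<open>pot m = U\<^sup>m\<close>, \<open>mut m n = I(m, n)\<close> with values in \<open>[0, \<infinity>]\<close>, \<open>en m n = I(m, n)\<close> as a real number (0 if
  infinite), \<open>P = \<E>\<^sup>+\<close>, \<open>PA A = \<E>\<^sup>+(A)\<close>, \<open>PC A = \<E>'(A)\<close>, \<open>D m n = \<parallel>m - n\<parallel>\<^sup>2\<close>; \<open>conv\<close> is strong convergence.
\<close>

context kernel_space
begin

definition pot :: "'a measure \<Rightarrow> 'a \<Rightarrow> ennreal" where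
  "pot m x = (\<integral>\<^sup>+y. \<kappa> x y \<partial>m)"

definition mut :: "'a measure \<Rightarrow> 'a measure \<Rightarrow> ennreal" where
  "mut m n = (\<integral>\<^sup>+x. pot n x \<partial>m)"

lemma kernel_sym: "\<kappa> x y = \<kappa> y x"
  using kernel unfolding is_kernel_def by auto

lemma kernel_lsc: "open {(x, y). c < \<kappa> x y}"
  using kernel unfolding is_kernel_def by auto

lemma kernel_measurable: "(\<lambda>(x, y). \<kappa> x y) \<in> borel_measurable (borel \<Otimes>\<^sub>M borel)"
proof -
  have "(\<lambda>z. case z of (x, y) \<Rightarrow> \<kappa> x y) \<in> borel_measurable borel"
  proof (rule lsc_borel_measurable)
    fix c
    have "{z. c < (case z of (x, y) \<Rightarrow> \<kappa> x y)} = {(x, y). c < \<kappa> x y}" by auto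
    then show "open {z. c < (case z of (x, y) \<Rightarrow> \<kappa> x y)}" using kernel_lsc by simp
  qed
  \<comment> \<open>Second countability identifies the Borel sets of the product with the product
    sigma-algebra.\<close>
  then show ?thesis unfolding borel_prod .
qed

lemma kernel_measurable_pair:
  assumes "pos_radon m" "pos_radon n"
  shows "(\<lambda>(x, y). \<kappa> x y) \<in> borel_measurable (m \<Otimes>\<^sub>M n)"
  using kernel_measurable
    measurable_cong_sets[OF sets_pair_measure_cong[OF pos_radon_sets[OF assms(1)] pos_radon_sets[OF assms(2)]] refl]
  by blast

lemma kernel_section_lsc: "open {y. c < \<kappa> x y}"
proof -
  have "{y. c < \<kappa> x y} = Pair x -` {(x, y). c < \<kappa> x y}" by auto
  moreover have "open (Pair x -` {(x, y). c < \<kappa> x y})"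
    by (intro open_vimage kernel_lsc continuous_intros)
  ultimately show ?thesis by simp
qed

lemma kernel_section_measurable: "sets m = sets borel \<Longrightarrow> \<kappa> x \<in> borel_measurable m"
  using lsc_borel_measurable[OF kernel_section_lsc] measurable_cong_sets by blast

text \<open>Fatou's lemma along a sequence; sequences suffice to test closedness because the space
  is first countable.\<close>

lemma pot_lsc:
  assumes m: "pos_radon m"
  shows "open {x. c < pot m x}"
proof -
  have "closed {x. pot m x \<le> c}"
    unfolding closed_sequential_limits
  proof (intro allI impI)
    fix xs :: "nat \<Rightarrow> 'a" and l assume a: "(\<forall>n. xs n \<in> {x. pot m x \<le> c}) \<and> xs \<longlonglongrightarrow> l"
    have "\<kappa> l y \<le> liminf (\<lambda>n. \<kappa> (xs n) y)" for y
    proof (rule le_Liminf_iff[THEN iffD2], intro allI impI)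
      fix d assume "d < \<kappa> l y"
      then have "l \<in> {x. d < \<kappa> y x}" by (simp add: kernel_sym)
      then have "eventually (\<lambda>n. xs n \<in> {x. d < \<kappa> y x}) sequentially"
        using a kernel_section_lsc[of d y] topological_tendstoD by blast
      then show "eventually (\<lambda>n. d < \<kappa> (xs n) y) sequentially" by (simp add: kernel_sym)
    qed
    then have "pot m l \<le> (\<integral>\<^sup>+y. liminf (\<lambda>n. \<kappa> (xs n) y) \<partial>m)"
      unfolding pot_def by (intro nn_integral_mono) auto
    also have "\<dots> \<le> liminf (\<lambda>n. pot m (xs n))"
      unfolding pot_def using kernel_section_measurable[OF pos_radon_sets[OF m]] by (intro nn_integral_liminf)
    also have "\<dots> \<le> liminf (\<lambda>n :: nat. c)" using a by (intro Liminf_mono always_eventually) auto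
    also have "\<dots> = c" by (simp add: Liminf_const)
    finally show "l \<in> {x. pot m x \<le> c}" by simp
  qed
  moreover have "- {x. pot m x \<le> c} = {x. c < pot m x}" by auto
  ultimately show ?thesis by (metis open_Compl)
qed

lemma pot_borel: "pos_radon m \<Longrightarrow> pot m \<in> borel_measurable borel"
  by (intro lsc_borel_measurable pot_lsc)

lemma pot_measurable: "pos_radon m \<Longrightarrow> sets n = sets borel \<Longrightarrow> pot m \<in> borel_measurable n"
  using pot_borel measurable_cong_sets by blast

lemma mut_eq_pair:
  assumes "pos_radon m" "pos_radon n"
  shows "(\<integral>\<^sup>+(x, y). \<kappa> x y \<partial>(m \<Otimes>\<^sub>M n)) = mut m n"
proof -
  interpret sigma_finite_measure n by (rule pos_radon_sigma_finite[OF assms(2)])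
  show ?thesis
    unfolding mut_def pot_def using nn_integral_fst[OF kernel_measurable_pair[OF assms]] by simp
qed

lemma mut_sym:
  assumes "pos_radon m" "pos_radon n"
  shows "mut m n = mut n m"
proof -
  interpret m: sigma_finite_measure m by (rule pos_radon_sigma_finite[OF assms(1)])
  interpret n: sigma_finite_measure n by (rule pos_radon_sigma_finite[OF assms(2)])
  interpret P: pair_sigma_finite n m by unfold_locales
  have "mut m n = (\<integral>\<^sup>+x. \<integral>\<^sup>+y. \<kappa> y x \<partial>n \<partial>m)" unfolding mut_def pot_def by (simp add: kernel_sym)
  also have "\<dots> = (\<integral>\<^sup>+y. \<integral>\<^sup>+x. \<kappa> y x \<partial>m \<partial>n)"
    by (rule P.Fubini') (rule kernel_measurable_pair[OF assms(2,1)])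
  finally show ?thesis unfolding mut_def pot_def .
qed

lemma pot_null [simp]: "pot (null_measure borel) x = 0"
  by (simp add: pot_def)

lemma mut_null [simp]: "mut (null_measure borel) m = 0" "mut m (null_measure borel) = 0"
  by (simp_all add: mut_def)

lemma mut_radd_left:
  "pos_radon m \<Longrightarrow> pos_radon n \<Longrightarrow> pos_radon p \<Longrightarrow> mut (radd m n) p = mut m p + mut n p"
  unfolding mut_def by (intro nn_integral_radd pos_radon_sets pot_borel)

lemma mut_rscale_left:
  "pos_radon m \<Longrightarrow> pos_radon p \<Longrightarrow> mut (rscale t m) p = ennreal t * mut m p"
  unfolding mut_def by (intro nn_integral_rscale pot_measurable pos_radon_sets)

lemma mut_mono_left:
  assumes "pos_radon m" "pos_radon n" "pos_radon p" "\<And>B. B \<in> sets borel \<Longrightarrow> emeasure m B \<le> emeasure n B"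
  shows "mut m p \<le> mut n p"
  unfolding mut_def using assms by (intro nn_integral_mono_measure pos_radon_sets pot_borel)

lemma mut_mono_pot:
  assumes "\<And>x. pot n x \<le> pot p x"
  shows "mut m n \<le> mut m p"
  unfolding mut_def using assms by (intro nn_integral_mono) auto

end

section \<open>Cones with a positive definite bilinear form\<close>

text \<open>The cone has only sums and nonnegative multiples, so positivity is demanded of formal
  differences: the expression in \<open>en_pos\<close> is the squared norm of a - b.\<close>

locale energy_form =
  fixes P :: "'m set" and add :: "'m \<Rightarrow> 'm \<Rightarrow> 'm" and scl :: "real \<Rightarrow> 'm \<Rightarrow> 'm" and en :: "'m \<Rightarrow> 'm \<Rightarrow> real"
  assumes add_closed: "a \<in> P \<Longrightarrow> b \<in> P \<Longrightarrow> add a b \<in> P"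
    and scl_closed: "0 \<le> t \<Longrightarrow> a \<in> P \<Longrightarrow> scl t a \<in> P"
    and en_sym: "a \<in> P \<Longrightarrow> b \<in> P \<Longrightarrow> en a b = en b a"
    and en_add_left: "a \<in> P \<Longrightarrow> b \<in> P \<Longrightarrow> c \<in> P \<Longrightarrow> en (add a b) c = en a c + en b c"
    and en_scl_left: "0 \<le> t \<Longrightarrow> a \<in> P \<Longrightarrow> c \<in> P \<Longrightarrow> en (scl t a) c = t * en a c"
    and en_pos: "a \<in> P \<Longrightarrow> b \<in> P \<Longrightarrow> 0 \<le> en a a - 2 * en a b + en b b"
begin

definition D :: "'m \<Rightarrow> 'm \<Rightarrow> real" where
  "D a b = en a a - 2 * en a b + en b b"

definition conv :: "(nat \<Rightarrow> 'm) \<Rightarrow> 'm \<Rightarrow> bool" where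
  "conv u a \<longleftrightarrow> (\<lambda>n. D (u n) a) \<longlonglongrightarrow> 0"

lemma en_add_right: "a \<in> P \<Longrightarrow> b \<in> P \<Longrightarrow> c \<in> P \<Longrightarrow> en c (add a b) = en c a + en c b"
  by (simp add: en_sym[of c] en_add_left add_closed)

lemma en_scl_right: "0 \<le> t \<Longrightarrow> a \<in> P \<Longrightarrow> c \<in> P \<Longrightarrow> en c (scl t a) = t * en c a"
  by (simp add: en_sym[of c] en_scl_left scl_closed)

lemmas en_simps = en_add_left en_add_right en_scl_left en_scl_right add_closed scl_closed

lemma D_nonneg: "a \<in> P \<Longrightarrow> b \<in> P \<Longrightarrow> 0 \<le> D a b"
  using en_pos by (simp add: D_def)

lemma D_sym: "a \<in> P \<Longrightarrow> b \<in> P \<Longrightarrow> D a b = D b a"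
  by (simp add: D_def en_sym[of b a])

lemma D_self: "D a a = 0"
  by (simp add: D_def)

lemma D_zero: "a \<in> P \<Longrightarrow> b \<in> P \<Longrightarrow> D a (scl 0 b) = en a a"
  by (simp add: D_def en_simps)

lemma en_nonneg: "a \<in> P \<Longrightarrow> 0 \<le> en a a"
  using D_nonneg[of a "scl 0 a"] by (simp add: D_zero scl_closed)

text \<open>This is the Cauchy-Schwarz inequality for the formal differences a - b and c - d,
  obtained from positivity on their combinations with coefficients \<open>s\<close> and
  \<open>t\<close>.\<close>

lemma cauchy_schwarz_diff:
  assumes P: "a \<in> P" "b \<in> P" "c \<in> P" "d \<in> P"
  shows "\<bar>en a c - en a d - en b c + en b d\<bar> \<le> sqrt (D a b) * sqrt (D c d)"
proof -
  let ?B = "en a c - en a d - en b c + en b d"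
  have q: "0 \<le> s\<^sup>2 * D a b + 2 * s * t * ?B + t\<^sup>2 * D c d" if "0 \<le> s" "0 \<le> t" for s t
    using D_nonneg[of "add (scl s a) (scl t c)" "add (scl s b) (scl t d)"] P that
    by (simp add: D_def en_simps en_sym[of c a] en_sym[of d a] en_sym[of c b] en_sym[of d b] en_sym[of b a] en_sym[of d c] power2_eq_square algebra_simps)
  \<comment> \<open>Coefficients must be nonnegative; the opposite sign is produced by exchanging
    \<open>c\<close> and \<open>d\<close>.\<close>
  have q': "0 \<le> s\<^sup>2 * D a b - 2 * s * t * ?B + t\<^sup>2 * D c d" if "0 \<le> s" "0 \<le> t" for s t
    using D_nonneg[of "add (scl s a) (scl t d)" "add (scl s b) (scl t c)"] P that
    by (simp add: D_def en_simps en_sym[of c a] en_sym[of d a] en_sym[of c b] en_sym[of d b] en_sym[of b a] en_sym[of d c] power2_eq_square algebra_simps)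
  have abs: "2 * s * t * \<bar>?B\<bar> \<le> s\<^sup>2 * D a b + t\<^sup>2 * D c d" if "0 \<le> s" "0 \<le> t" for s t
    using q[OF that] q'[OF that] by (cases "0 \<le> ?B") (simp_all add: abs_of_nonneg abs_of_neg algebra_simps)
  have n: "0 \<le> D a b" "0 \<le> D c d" using P D_nonneg by auto
  show ?thesis
  proof (cases "D a b = 0 \<or> D c d = 0")
    case False
    then have pos: "0 < sqrt (D a b)" "0 < sqrt (D c d)" using n by auto
    \<comment> \<open>The optimal coefficients are the norms themselves: \<open>s\<close> is that of
      c - d and \<open>t\<close> that of a - b.\<close>
    have "2 * sqrt (D c d) * sqrt (D a b) * \<bar>?B\<bar> \<le> 2 * (D a b * D c d)"
      using abs[of "sqrt (D c d)" "sqrt (D a b)"] n by simp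
    also have "\<dots> = 2 * ((sqrt (D a b) * sqrt (D a b)) * (sqrt (D c d) * sqrt (D c d)))" using n by simp
    also have "\<dots> = 2 * sqrt (D c d) * sqrt (D a b) * (sqrt (D a b) * sqrt (D c d))"
      by (simp only: mult.assoc mult.commute mult.left_commute)
    finally have "2 * sqrt (D c d) * sqrt (D a b) * \<bar>?B\<bar> \<le> 2 * sqrt (D c d) * sqrt (D a b) * (sqrt (D a b) * sqrt (D c d))" .
    moreover have "0 < 2 * sqrt (D c d) * sqrt (D a b)" using pos by (intro mult_pos_pos) auto
    ultimately show ?thesis by (rule mult_le_cancel_left_pos[THEN iffD1, rotated])
  next
    case True
    have "\<bar>?B\<bar> = 0"
    proof (rule ccontr)
      assume nz: "\<bar>?B\<bar> \<noteq> 0"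
      then have p: "0 < \<bar>?B\<bar>" by simp
      show False
      proof (cases "D a b = 0")
        case True
        \<comment> \<open>With one square term gone, a large coefficient violates the bound; the
          added 1 ensures this even if both norms vanish.\<close>
        have "2 * ((D c d + 1) / \<bar>?B\<bar>) * 1 * \<bar>?B\<bar> \<le> D c d"
          using abs[of "(D c d + 1) / \<bar>?B\<bar>" 1] True n p by simp
        also have "2 * ((D c d + 1) / \<bar>?B\<bar>) * 1 * \<bar>?B\<bar> = 2 * (D c d + 1)" using nz by simp
        finally show False using n by simp
      next
        case False
        then have "D c d = 0" using \<open>D a b = 0 \<or> D c d = 0\<close> by simp
        then have "2 * 1 * ((D a b + 1) / \<bar>?B\<bar>) * \<bar>?B\<bar> \<le> D a b"
          using abs[of 1 "(D a b + 1) / \<bar>?B\<bar>"] n p by simp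
        also have "2 * 1 * ((D a b + 1) / \<bar>?B\<bar>) * \<bar>?B\<bar> = 2 * (D a b + 1)" using nz by simp
        finally show False using n by simp
      qed
    qed
    then show ?thesis using n by simp
  qed
qed

lemma cauchy_schwarz_left:
  assumes P: "a \<in> P" "b \<in> P" "c \<in> P"
  shows "\<bar>en a c - en b c\<bar> \<le> sqrt (D a b) * sqrt (en c c)"
  using cauchy_schwarz_diff[of a b c "scl 0 c"] P by (simp add: D_zero en_simps)

lemma cauchy_schwarz:
  assumes P: "a \<in> P" "c \<in> P"
  shows "en a c \<le> sqrt (en a a) * sqrt (en c c)"
  using cauchy_schwarz_left[of a "scl 0 a" c] P by (simp add: D_zero en_simps)

lemma D_triangle:
  assumes P: "a \<in> P" "b \<in> P" "c \<in> P"
  shows "sqrt (D a c) \<le> sqrt (D a b) + sqrt (D b c)"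
proof -
  have "D a c = D a b + D b c + 2 * (en a b - en a c - en b b + en b c)"
    by (simp add: D_def)
  also have "\<dots> \<le> D a b + D b c + 2 * (sqrt (D a b) * sqrt (D b c))"
    using cauchy_schwarz_diff[of a b b c] P by simp
  also have "\<dots> = (sqrt (D a b) + sqrt (D b c))\<^sup>2"
    using P D_nonneg by (simp add: power2_sum)
  finally show ?thesis using P D_nonneg by (intro real_le_lsqrt) auto
qed

lemma conv_en:
  assumes u: "\<And>n. u n \<in> P" "a \<in> P" "conv u a" and c: "c \<in> P"
  shows "(\<lambda>n. en (u n) c) \<longlonglongrightarrow> en a c"
proof -
  have "(\<lambda>n. sqrt (D (u n) a) * sqrt (en c c)) \<longlonglongrightarrow> sqrt 0 * sqrt (en c c)"
    using u(3) unfolding conv_def by (intro tendsto_intros)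
  then have "(\<lambda>n. sqrt (D (u n) a) * sqrt (en c c)) \<longlonglongrightarrow> 0" by simp
  then have "(\<lambda>n. en (u n) c - en a c) \<longlonglongrightarrow> 0"
    by (rule Lim_null_comparison[rotated]) (simp add: cauchy_schwarz_left u c)
  then show ?thesis by (simp add: LIM_zero_iff)
qed

lemma conv_norm:
  assumes u: "\<And>n. u n \<in> P" "a \<in> P" "conv u a"
  shows "(\<lambda>n. en (u n) (u n)) \<longlonglongrightarrow> en a a"
proof -
  have "(\<lambda>n. D (u n) a + 2 * en (u n) a - en a a) \<longlonglongrightarrow> 0 + 2 * en a a - en a a"
    using u(3) conv_en[OF u u(2)] unfolding conv_def by (intro tendsto_intros)
  then show ?thesis by (simp add: D_def)
qed

lemma conv_eqI:
  assumes "conv u a" "\<And>n. u n \<in> P" "\<And>n. v n \<in> P" "a \<in> P" "(\<lambda>n. D (v n) (u n)) \<longlonglongrightarrow> 0"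
  shows "conv v a"
proof -
  have "(\<lambda>n. (sqrt (D (v n) (u n)) + sqrt (D (u n) a))\<^sup>2) \<longlonglongrightarrow> (sqrt 0 + sqrt 0)\<^sup>2"
    using assms(1,5) unfolding conv_def by (intro tendsto_intros)
  then have l: "(\<lambda>n. (sqrt (D (v n) (u n)) + sqrt (D (u n) a))\<^sup>2) \<longlonglongrightarrow> 0" by simp
  have "norm (D (v n) a) \<le> (sqrt (D (v n) (u n)) + sqrt (D (u n) a))\<^sup>2" for n
    using D_triangle[of "v n" "u n" a] D_nonneg[of "v n" a] assms sqrt_le_D by auto
  then show ?thesis unfolding conv_def by (intro Lim_null_comparison[OF _ l] always_eventually) auto
qed

definition mid :: "'m \<Rightarrow> 'm \<Rightarrow> 'm" where
  "mid a b = scl (1/2) (add a b)"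

text \<open>The parallelogram law for the functional \<open>en a a - 2 * L a\<close>; its linear
  part cancels because \<open>L\<close> is affine at the midpoint.\<close>

lemma D_mid:
  assumes "a \<in> P" "b \<in> P" "L (mid a b) = (L a + L b) / 2"
  shows "D a b = 2 * (en a a - 2 * L a) + 2 * (en b b - 2 * L b) - 4 * (en (mid a b) (mid a b) - 2 * L (mid a b))"
  using assms unfolding mid_def by (simp add: D_def en_simps en_sym[of b a] algebra_simps)

end

locale complete_energy_form = energy_form P add scl en
  for P :: "'m set" and add scl en +
  assumes complete: "(\<And>n. u n \<in> P) \<Longrightarrow>
    (\<And>e. 0 < e \<Longrightarrow> \<exists>N. \<forall>m n. N \<le> n \<longrightarrow> n \<le> m \<longrightarrow> en (u m) (u m) - 2 * en (u m) (u n) + en (u n) (u n) < e) \<Longrightarrow>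
    \<exists>a\<in>P. (\<lambda>n. en (u n) (u n) - 2 * en (u n) a + en a a) \<longlonglongrightarrow> 0"
begin

lemma conv_exists:
  assumes u: "\<And>n. u n \<in> P" and \<delta>: "\<delta> \<longlonglongrightarrow> 0" and le: "\<And>m n. n \<le> m \<Longrightarrow> D (u m) (u n) \<le> \<delta> n"
  shows "\<exists>a\<in>P. conv u a"
  unfolding conv_def D_def
proof (rule complete[OF u])
  fix e :: real assume "0 < e"
  then obtain N where N: "\<And>n. N \<le> n \<Longrightarrow> \<delta> n < e"
    using order_tendstoD(2)[OF \<delta>] by (auto simp: eventually_sequentially)
  show "\<exists>N. \<forall>m n. N \<le> n \<longrightarrow> n \<le> m \<longrightarrow> en (u m) (u m) - 2 * en (u m) (u n) + en (u n) (u n) < e"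
    using N le unfolding D_def by (intro exI[of _ N]) (metis le_less_trans)
qed

text \<open>
  The hypothesis on midpoints says that the values \<open>J (u n)\<close> are nearly minimal among those
  on the convex hull of the tail of \<open>u\<close>.
\<close>

lemma conv_exists_minimizing:
  fixes L :: "'m \<Rightarrow> real"
  defines "J \<equiv> \<lambda>a. en a a - 2 * L a"
  assumes u: "\<And>n. u n \<in> P" and L: "\<And>m n. L (mid (u m) (u n)) = (L (u m) + L (u n)) / 2"
    and j: "(\<lambda>n. J (u n)) \<longlonglongrightarrow> j" "\<And>n. J (u n) \<le> j + \<epsilon> n" and \<epsilon>: "\<epsilon> \<longlonglongrightarrow> 0"
    and \<delta>: "\<delta> \<longlonglongrightarrow> 0" and le: "\<And>m n. n \<le> m \<Longrightarrow> j - \<delta> n \<le> J (mid (u m) (u n))"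
    and dec: "\<And>m n. n \<le> m \<Longrightarrow> \<epsilon> m \<le> \<epsilon> n"
  shows "\<exists>a\<in>P. conv u a"
proof (rule conv_exists[OF u])
  show "(\<lambda>n. 4 * \<epsilon> n + 4 * \<delta> n) \<longlonglongrightarrow> 0" using tendsto_add[OF tendsto_mult_left[OF \<epsilon>, of 4] tendsto_mult_left[OF \<delta>, of 4]] by simp
  fix m n :: nat assume nm: "n \<le> m"
  \<comment> \<open>In the parallelogram law both values of \<open>J\<close> are at most
    \<open>j\<close> plus an error and the midpoint value is at least \<open>j\<close> minus an
    error; the terms in \<open>j\<close> cancel.\<close>
  have arith: "d \<le> 4 * e + 4 * f" if "d = 2 * a + 2 * b - 4 * c" "a \<le> j + e'" "b \<le> j + e" "j - f \<le> c" "e' \<le> e"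
    for a b c d e e' f :: real using that by linarith
  show "D (u m) (u n) \<le> 4 * \<epsilon> n + 4 * \<delta> n"
    by (rule arith[OF _ j(2)[of m] j(2)[of n] le[OF nm] dec[OF nm]]) (unfold J_def, rule D_mid[of "u m" "u n" L, OF u u L])
qed

text \<open>The Gauss functional \<open>en a a - 2 * L a\<close> is minimized over the cone.
  Variation towards \<open>\<nu>\<close> gives the inequality, shrinking \<open>\<eta>\<close> along
  its ray gives \<open>en \<eta> \<eta> \<le> L \<eta>\<close>. If \<open>L\<close> is the inner
  product with an element, this is orthogonal projection.\<close>

lemma projection_exists:
  fixes L :: "'m \<Rightarrow> real"
  assumes C: "C \<subseteq> P" "C \<noteq> {}" "\<And>a b. a \<in> C \<Longrightarrow> b \<in> C \<Longrightarrow> add a b \<in> C" "\<And>t a. 0 \<le> t \<Longrightarrow> a \<in> C \<Longrightarrow> scl t a \<in> C"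
    and closed: "\<And>u a. (\<And>n. u n \<in> C) \<Longrightarrow> a \<in> P \<Longrightarrow> conv u a \<Longrightarrow> a \<in> C"
    and L: "\<And>a b. a \<in> C \<Longrightarrow> b \<in> C \<Longrightarrow> L (add a b) = L a + L b" "\<And>t a. 0 \<le> t \<Longrightarrow> a \<in> C \<Longrightarrow> L (scl t a) = t * L a"
    and bdd: "\<And>a. a \<in> C \<Longrightarrow> B \<le> en a a - 2 * L a"
    and cont: "\<And>u a. (\<And>n. u n \<in> C) \<Longrightarrow> a \<in> C \<Longrightarrow> conv u a \<Longrightarrow> (\<lambda>n. L (u n)) \<longlonglongrightarrow> L a"
  shows "\<exists>\<eta>\<in>C. (\<forall>\<nu>\<in>C. L \<nu> \<le> en \<eta> \<nu>) \<and> en \<eta> \<eta> = L \<eta>"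
proof -
  define J where "J a = en a a - 2 * L a" for a
  define j where "j = Inf (J ` C)"
  have bb: "bdd_below (J ` C)" using bdd by (intro bdd_belowI2[of _ B]) (auto simp: J_def)
  have jle: "j \<le> J a" if "a \<in> C" for a unfolding j_def using bb that by (intro cInf_lower) auto
  have "\<exists>a\<in>C. J a < j + 1 / Suc n" for n
  proof -
    have "j < j + 1 / Suc n" by simp
    then have "\<exists>y\<in>J ` C. y < j + 1 / Suc n"
      unfolding j_def using cInf_less_iff[of "J ` C"] bb C(2) by blast
    then show ?thesis by blast
  qed
  then obtain u where u: "\<And>n. u n \<in> C" "\<And>n. J (u n) < j + 1 / Suc n" by metis
  have uP: "u n \<in> P" for n using u(1) C(1) by auto
  have midC: "mid a b \<in> C" if "a \<in> C" "b \<in> C" for a b using that C unfolding mid_def by auto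
  have Lmid: "L (mid a b) = (L a + L b) / 2" if "a \<in> C" "b \<in> C" for a b
    using that C L unfolding mid_def by simp
  have lim1: "(\<lambda>n. 1 / real (Suc n)) \<longlonglongrightarrow> 0" using LIMSEQ_Suc[OF lim_1_over_n[where 'a=real]] by simp
  have "(\<lambda>n. j + 1 / real (Suc n)) \<longlonglongrightarrow> j + 0" by (intro tendsto_intros lim1)
  then have "(\<lambda>n. J (u n)) \<longlonglongrightarrow> j"
    by (intro tendsto_sandwich[where f="\<lambda>n. j" and g="\<lambda>n. J (u n)" and h="\<lambda>n. j + 1 / real (Suc n)"])
      (simp_all add: jle u(1) less_imp_le[OF u(2)] del: of_nat_Suc)
  then have Jlim: "(\<lambda>n. en (u n) (u n) - 2 * L (u n)) \<longlonglongrightarrow> j" unfolding J_def .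
  obtain \<eta> where \<eta>: "\<eta> \<in> P" "conv u \<eta>"
  proof -
    have "\<exists>a\<in>P. conv u a"
    proof (rule conv_exists_minimizing[where L=L and j=j and \<epsilon>="\<lambda>n. 1 / Suc n" and \<delta>="\<lambda>n. 0"])
      show "j - 0 \<le> en (mid (u m) (u n)) (mid (u m) (u n)) - 2 * L (mid (u m) (u n))" for m n
        using jle[OF midC[OF u(1) u(1)]] unfolding J_def by simp
      show "en (u n) (u n) - 2 * L (u n) \<le> j + 1 / real (Suc n)" for n
        using less_imp_le[OF u(2)] unfolding J_def .
      show "L (mid (u m) (u n)) = (L (u m) + L (u n)) / 2" for m n by (rule Lmid[OF u(1) u(1)])
    qed (use uP Jlim lim1 in \<open>auto simp: field_simps\<close>)
    then show thesis using that by blast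
  qed
  have \<eta>C: "\<eta> \<in> C" using closed[OF u(1) \<eta>] .
  have "(\<lambda>n. en (u n) (u n) - 2 * L (u n)) \<longlonglongrightarrow> en \<eta> \<eta> - 2 * L \<eta>"
    by (intro tendsto_intros conv_norm uP \<eta> cont u(1) \<eta>C)
  then have J\<eta>: "J \<eta> = j" using LIMSEQ_unique[OF _ Jlim] unfolding J_def by blast
  have ge: "L \<nu> \<le> en \<eta> \<nu>" if \<nu>: "\<nu> \<in> C" for \<nu>
  proof (rule ccontr)
    assume "\<not> L \<nu> \<le> en \<eta> \<nu>"
    define x where "x = L \<nu> - en \<eta> \<nu>"
    define A where "A = en \<nu> \<nu>"
    have x: "0 < x" using \<open>\<not> L \<nu> \<le> en \<eta> \<nu>\<close> by (simp add: x_def)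
    have A: "0 \<le> A" unfolding A_def using en_nonneg \<nu> C(1) by auto
    have P: "\<nu> \<in> P" using \<nu> C(1) by auto
    have q: "0 \<le> t\<^sup>2 * A - 2 * t * x" if t: "0 \<le> t" for t
    proof -
      have c: "scl t \<nu> \<in> C" using C(4)[OF t \<nu>] .
      have "J (add \<eta> (scl t \<nu>)) = J \<eta> + t\<^sup>2 * A - 2 * t * x"
        unfolding J_def x_def A_def using t P \<eta>(1) L(1)[OF \<eta>C c] L(2)[OF t \<nu>]
        by (simp add: en_simps en_sym[of \<nu> \<eta>] algebra_simps power2_eq_square)
      then show ?thesis using jle[OF C(3)[OF \<eta>C c]] J\<eta> by simp
    qed
    \<comment> \<open>For this \<open>t\<close> the quadratic term is smaller than
      \<open>t * x\<close>; dividing by \<open>A + 1\<close> covers the case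
      \<open>A = 0\<close>.\<close>
    have "0 \<le> (x / (A + 1))\<^sup>2 * A - 2 * (x / (A + 1)) * x" using q[of "x / (A + 1)"] x A by simp
    also have "\<dots> = (x / (A + 1)) * x * (A / (A + 1) - 2)"
      using A by (simp add: power2_eq_square algebra_simps)
    also have "\<dots> < 0" using x A by (intro mult_pos_neg mult_pos_pos) (auto simp: field_simps)
    finally show False by simp
  qed
  have "en \<eta> \<eta> \<le> L \<eta>"
  proof (rule ccontr)
    assume less: "\<not> en \<eta> \<eta> \<le> L \<eta>"
    define A where "A = en \<eta> \<eta>"
    define l where "l = L \<eta>"
    have q: "0 \<le> t * A - 2 * A + 2 * l" if t: "0 < t" "t \<le> 1" for t
    proof -
      have "J (scl (1 - t) \<eta>) = J \<eta> + t * (t * A - 2 * A + 2 * l)"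
        unfolding J_def A_def l_def using t \<eta>(1) L(2)[OF _ \<eta>C, of "1 - t"]
        by (simp add: en_simps algebra_simps)
      then have "0 \<le> t * (t * A - 2 * A + 2 * l)" using jle[OF C(4)[OF _ \<eta>C], of "1 - t"] t J\<eta> by simp
      then show ?thesis using t by (simp add: zero_le_mult_iff)
    qed
    have Al: "l < A" "0 \<le> A" using less en_nonneg[OF \<eta>(1)] by (auto simp: A_def l_def)
    show False
    proof (cases "A = 0")
      case True
      then show False using q[of 1] Al by simp
    next
      case False
      then have "0 < A" using Al by simp
      \<comment> \<open>The choice makes \<open>t * A \<le> A - l\<close>, so that \<open>q\<close>
        would yield \<open>0 \<le> l - A\<close>.\<close>
      define t where "t = min 1 ((A - l) / A)"
      have t: "0 < t" "t \<le> 1" unfolding t_def using Al \<open>0 < A\<close> by auto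
      have "t * A \<le> (A - l) / A * A" unfolding t_def using \<open>0 < A\<close> by (intro mult_right_mono) auto
      then have "t * A \<le> A - l" using \<open>0 < A\<close> by simp
      then show False using q[OF t] Al by linarith
    qed
  qed
  then show ?thesis using ge \<eta>C by (metis antisym)
qed

end

section \<open>Jordan decompositions and the pre-Hilbert space of signed measures\<close>

lemma pos_radon_pos_var: "pos_radon (pos_var \<mu>)"
  and pos_radon_neg_var: "pos_radon (neg_var \<mu>)"
  and singular_pos_neg_var: "singular_measures (pos_var \<mu>) (neg_var \<mu>)"
  using jordan_decomp[of \<mu>] unfolding pos_var_def neg_var_def by (auto simp: case_prod_beta)

lemma radon_eqI: "pos_var \<mu> = pos_var \<nu> \<Longrightarrow> neg_var \<mu> = neg_var \<nu> \<Longrightarrow> \<mu> = \<nu>"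
  using jordan_decomp_inject[of \<mu> \<nu>] by (simp add: prod_eq_iff pos_var_def neg_var_def)

lemma radon_of_pair:
  assumes "pos_radon p" "pos_radon q" "singular_measures p q"
  shows "pos_var (Abs_radon (p, q)) = p" "neg_var (Abs_radon (p, q)) = q"
  using Abs_radon_inverse[of "(p, q)"] assms unfolding pos_var_def neg_var_def by auto

lemma singular_null: "singular_measures m (null_measure borel)"
  unfolding singular_measures_def by (intro bexI[of _ "{}"]) auto

lemma pos_var_of_pos_radon [simp]: "pos_radon m \<Longrightarrow> pos_var (of_pos_radon m) = m"
  and neg_var_of_pos_radon [simp]: "pos_radon m \<Longrightarrow> neg_var (of_pos_radon m) = null_measure borel"
  unfolding of_pos_radon_def by (simp_all add: radon_of_pair singular_null)

lemma of_pos_radon_in_cone: "pos_radon m \<Longrightarrow> of_pos_radon m \<in> radon_cone"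
  by (simp add: radon_cone_def)

lemma of_pos_radon_pos_var: "\<mu> \<in> radon_cone \<Longrightarrow> of_pos_radon (pos_var \<mu>) = \<mu>"
  by (intro radon_eqI) (simp_all add: radon_cone_def pos_radon_pos_var)

lemma zero_radon_var: "pos_var 0 = null_measure borel" "neg_var 0 = null_measure borel"
  unfolding zero_radon_def by simp_all

section \<open>Differences of positive Radon measures\<close>

context lch_space
begin

text \<open>The measure \<open>r\<close> may be infinite on \<open>B\<close>; it is finite on the
  pieces cut out by a compact exhaustion, where it can be cancelled.\<close>

lemma radon_cancel:
  assumes m: "pos_radon (m :: 'a measure)" and n: "pos_radon n" and r: "pos_radon r"
    and eq: "\<And>B. B \<in> sets borel \<Longrightarrow> emeasure m B + emeasure r B = emeasure n B + emeasure r B"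
  shows "m = n"
proof -
  obtain Q where Q: "\<And>n. compact (Q n)" "\<And>n. Q n \<subseteq> interior (Q (Suc n))" "(\<Union>n. Q n) = (UNIV :: 'a set)"
    using compact_exhaustion[OF open_UNIV] by auto
  note sets = pos_radon_sets[OF m] pos_radon_sets[OF n] pos_radon_sets[OF r]
  show ?thesis
  proof (rule measure_eqI_borel)
    fix B :: "'a set" assume B: "B \<in> sets borel"
    have QB: "Q k \<inter> B \<in> sets borel" for k using B compact_borel[OF Q(1)] by auto
    have eqQ: "emeasure m (Q k \<inter> B) = emeasure n (Q k \<inter> B)" for k
    proof -
      have "emeasure r (Q k \<inter> B) \<le> emeasure r (Q k)"
        using compact_borel[OF Q(1)] sets by (intro emeasure_mono) auto
      also have "\<dots> < \<infinity>" using r Q(1) by (rule pos_radon_finite)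
      finally have "emeasure r (Q k \<inter> B) \<noteq> top" by auto
      then show ?thesis using eq[OF QB[of k]] by (simp add: ennreal_add_left_cancel add.commute[of _ "emeasure r (Q k \<inter> B)"])
    qed
    have SUP: "(SUP k. emeasure p (Q k \<inter> B)) = emeasure p B" if "sets p = sets borel" for p
    proof -
      have "incseq (\<lambda>k. Q k \<inter> B)" using exhaustion_mono[of Q, OF Q(2)] by (auto simp: incseq_def)
      then have "(SUP k. emeasure p (Q k \<inter> B)) = emeasure p (\<Union>k. Q k \<inter> B)"
        using QB that by (intro SUP_emeasure_incseq) auto
      also have "(\<Union>k. Q k \<inter> B) = B" using Q(3) by auto
      finally show ?thesis .
    qed
    show "emeasure m B = emeasure n B" using SUP[OF sets(1)] SUP[OF sets(2)] eqQ by simp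
  qed (use sets in auto)
qed

text \<open>The equation \<open>p - q = a - b\<close>, stated so that no difference of infinite values occurs.\<close>

definition diff_eq :: "'a measure \<Rightarrow> 'a measure \<Rightarrow> 'a measure \<Rightarrow> 'a measure \<Rightarrow> bool" where
  "diff_eq p q a b \<longleftrightarrow> radd p b = radd q a"

lemma diff_eq_iff:
  assumes "pos_radon p" "pos_radon q" "pos_radon a" "pos_radon b"
  shows "diff_eq p q a b \<longleftrightarrow> (\<forall>B\<in>sets borel. emeasure p B + emeasure b B = emeasure q B + emeasure a B)"
proof -
  note s = assms[THEN pos_radon_sets]
  show ?thesis
  proof
    assume "diff_eq p q a b"
    then show "\<forall>B\<in>sets borel. emeasure p B + emeasure b B = emeasure q B + emeasure a B"
      unfolding diff_eq_def using emeasure_radd[OF s(1,4)] emeasure_radd[OF s(2,3)] by metis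
  next
    assume "\<forall>B\<in>sets borel. emeasure p B + emeasure b B = emeasure q B + emeasure a B"
    then show "diff_eq p q a b"
      unfolding diff_eq_def by (intro measure_eqI_borel) (simp_all add: emeasure_radd s)
  qed
qed

text \<open>Adding the two equations crosswise and cancelling a + b leaves an equation between the
  two Jordan decompositions, to which their uniqueness applies.\<close>

lemma diff_eq_unique:
  assumes a: "pos_radon (a :: 'a measure)" "pos_radon b"
    and e: "diff_eq (pos_var \<eta>) (neg_var \<eta>) a b" "diff_eq (pos_var \<zeta>) (neg_var \<zeta>) a b"
  shows "\<eta> = \<zeta>"
proof -
  note pr = pos_radon_pos_var pos_radon_neg_var
  note ps = pos_radon_sets[OF pos_radon_pos_var] pos_radon_sets[OF pos_radon_neg_var]
    pos_radon_sets[OF a(1)] pos_radon_sets[OF a(2)]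
  let ?l = "radd (pos_var \<eta>) (neg_var \<zeta>)" and ?r = "radd (neg_var \<eta>) (pos_var \<zeta>)"
  have "?l = ?r"
  proof (rule radon_cancel[of _ _ "radd a b"])
    fix B :: "'a set" assume B: "B \<in> sets borel"
    have 1: "emeasure (pos_var \<eta>) B + emeasure b B = emeasure (neg_var \<eta>) B + emeasure a B"
      using e(1) B unfolding diff_eq_iff[OF pr a] by blast
    have 2: "emeasure (neg_var \<zeta>) B + emeasure a B = emeasure (pos_var \<zeta>) B + emeasure b B"
      using e(2) B unfolding diff_eq_iff[OF pr a] by metis
    have "emeasure ?l B + emeasure (radd a b) B = (emeasure (pos_var \<eta>) B + emeasure b B) + (emeasure (neg_var \<zeta>) B + emeasure a B)"
      by (simp add: emeasure_radd ps ac_simps)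
    also have "\<dots> = emeasure ?r B + emeasure (radd a b) B"
      unfolding 1 2 by (simp add: emeasure_radd ps ac_simps)
    finally show "emeasure ?l B + emeasure (radd a b) B = emeasure ?r B + emeasure (radd a b) B" .
  qed (intro pos_radon_radd pr a)+
  then have "emeasure (pos_var \<eta>) B + emeasure (neg_var \<zeta>) B = emeasure (neg_var \<eta>) B + emeasure (pos_var \<zeta>) B" for B
    by (metis emeasure_radd ps(1,2))
  then show ?thesis
    using jordan_unique[OF ps(1,2,1,2) singular_pos_neg_var singular_pos_neg_var] by (intro radon_eqI) auto
qed

lemma diff_eq_exists:
  assumes a: "pos_radon (a :: 'a measure)" "pos_radon b"
  shows "\<exists>\<eta>. diff_eq (pos_var \<eta>) (neg_var \<eta>) a b"
proof -
  obtain p q where pq: "pos_radon p" "pos_radon q" "singular_measures p q"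
     "\<forall>B\<in>sets borel. emeasure p B + emeasure b B = emeasure q B + emeasure a B"
    using jordan_exists[OF a] by blast
  then have "diff_eq p q a b" using diff_eq_iff[OF pq(1,2) a] by blast
  then show ?thesis using radon_of_pair[OF pq(1-3)] by metis
qed

text \<open>Existence and uniqueness justify the definite description behind the difference; its
  terms are regrouped into two positive measures.\<close>

lemma minus_radon_spec:
  fixes \<mu> \<nu> :: "'a radon"
  defines "a \<equiv> radd (pos_var \<mu>) (neg_var \<nu>)" and "b \<equiv> radd (neg_var \<mu>) (pos_var \<nu>)"
  shows "diff_eq (pos_var (\<mu> - \<nu>)) (neg_var (\<mu> - \<nu>)) a b"
proof -
  have ab: "pos_radon a" "pos_radon b"
    unfolding a_def b_def by (intro pos_radon_radd pos_radon_pos_var pos_radon_neg_var)+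
  have "(\<forall>B\<in>sets borel.
     emeasure (pos_var \<eta>) B + emeasure (neg_var \<mu>) B + emeasure (pos_var \<nu>) B =
     emeasure (neg_var \<eta>) B + emeasure (pos_var \<mu>) B + emeasure (neg_var \<nu>) B) \<longleftrightarrow>
     diff_eq (pos_var \<eta>) (neg_var \<eta>) a b" for \<eta>
    unfolding diff_eq_iff[OF pos_radon_pos_var pos_radon_neg_var ab] unfolding a_def b_def
    by (simp add: emeasure_radd pos_radon_sets pos_radon_pos_var pos_radon_neg_var add.assoc)
  then have eq: "\<mu> - \<nu> = (THE \<eta>. diff_eq (pos_var \<eta>) (neg_var \<eta>) a b)"
    unfolding minus_radon_def by simp
  have ex1: "\<exists>!\<eta>. diff_eq (pos_var \<eta>) (neg_var \<eta>) a b"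
    using diff_eq_exists[OF ab] diff_eq_unique[OF ab] by blast
  have "diff_eq (pos_var (THE \<eta>. diff_eq (pos_var \<eta>) (neg_var \<eta>) a b))
    (neg_var (THE \<eta>. diff_eq (pos_var \<eta>) (neg_var \<eta>) a b)) a b" by (rule theI'[OF ex1])
  then show ?thesis unfolding eq .
qed

lemma radd_null: "pos_radon (m :: 'a measure) \<Longrightarrow> radd m (null_measure borel) = m"
  by (intro measure_eqI_borel) (simp_all add: emeasure_radd pos_radon_sets)

lemma radd_commute: "pos_radon (m :: 'a measure) \<Longrightarrow> pos_radon n \<Longrightarrow> radd m n = radd n m"
  by (intro measure_eqI_borel) (simp_all add: emeasure_radd pos_radon_sets add.commute)

lemma minus_of_pos_radon:
  assumes "pos_radon (a :: 'a measure)" "pos_radon b"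
  shows "diff_eq (pos_var (of_pos_radon a - of_pos_radon b)) (neg_var (of_pos_radon a - of_pos_radon b)) a b"
  using minus_radon_spec[of "of_pos_radon a" "of_pos_radon b"] assms
  by (simp add: radd_null radd_commute[of "null_measure borel"])

lemma diff_eq_dominated:
  assumes "diff_eq (pos_var \<eta>) (neg_var \<eta>) a b" "pos_radon (a :: 'a measure)" "pos_radon b" "B \<in> sets borel"
  shows "emeasure (pos_var \<eta>) B \<le> emeasure a B" "emeasure (neg_var \<eta>) B \<le> emeasure b B"
proof -
  have e: "\<And>B. B \<in> sets borel \<Longrightarrow> emeasure (pos_var \<eta>) B + emeasure b B = emeasure (neg_var \<eta>) B + emeasure a B"
    using assms diff_eq_iff[OF pos_radon_pos_var pos_radon_neg_var assms(2,3)] by blast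
  have s: "sets (pos_var \<eta>) = sets borel" "sets (neg_var \<eta>) = sets borel" "sets a = sets borel" "sets b = sets borel"
    using assms pos_radon_sets pos_radon_pos_var pos_radon_neg_var by blast+
  show "emeasure (pos_var \<eta>) B \<le> emeasure a B"
    by (rule jordan_dominated[OF s(1,2,3) singular_pos_neg_var e assms(4)])
  have sg: "singular_measures (neg_var \<eta>) (pos_var \<eta>)"
    using singular_pos_neg_var[of \<eta>] unfolding singular_measures_def by (metis borel_comp double_complement)
  show "emeasure (neg_var \<eta>) B \<le> emeasure b B"
    by (rule jordan_dominated[OF s(2,1,4) sg e[symmetric] assms(4)])
qed

end

section \<open>Positive measures of finite energy\<close>

context kernel_space
begin

definition P :: "'a measure set" where
  "P = {m. pos_radon m \<and> mut m m < \<infinity>}"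

definition en :: "'a measure \<Rightarrow> 'a measure \<Rightarrow> real" where
  "en m n = enn2real (mut m n)"

lemma P_radon: "m \<in> P \<Longrightarrow> pos_radon m"
  by (simp add: P_def)

lemma energy_plus_eq: "energy_plus \<kappa> \<mu> \<nu> = mut (pos_var \<mu>) (pos_var \<nu>) + mut (neg_var \<mu>) (neg_var \<nu>)"
  unfolding energy_plus_def by (simp add: mut_eq_pair pos_radon_pos_var pos_radon_neg_var)

lemma energy_minus_eq: "energy_minus \<kappa> \<mu> \<nu> = mut (pos_var \<mu>) (neg_var \<nu>) + mut (neg_var \<mu>) (pos_var \<nu>)"
  unfolding energy_minus_def by (simp add: mut_eq_pair pos_radon_pos_var pos_radon_neg_var)

lemma mut_mono:
  assumes "pos_radon m" "pos_radon n" "pos_radon p" "pos_radon q"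
    "\<And>B. B \<in> sets borel \<Longrightarrow> emeasure m B \<le> emeasure n B" "\<And>B. B \<in> sets borel \<Longrightarrow> emeasure p B \<le> emeasure q B"
  shows "mut m p \<le> mut n q"
proof -
  have "mut m p \<le> mut n p" by (rule mut_mono_left[OF assms(1-3,5)])
  also have "\<dots> = mut p n" by (rule mut_sym[OF assms(2,3)])
  also have "\<dots> \<le> mut q n" by (rule mut_mono_left[OF assms(3,4,2,6)])
  also have "\<dots> = mut n q" by (rule mut_sym[OF assms(4,2)])
  finally show ?thesis .
qed

lemma mut_radd_right:
  "pos_radon m \<Longrightarrow> pos_radon n \<Longrightarrow> pos_radon p \<Longrightarrow> mut p (radd m n) = mut p m + mut p n"
  using mut_sym[of p "radd m n"] mut_sym[of p m] mut_sym[of p n] mut_radd_left[of m n p] pos_radon_radd[of m n] by metis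

lemma mut_rscale_right:
  "pos_radon m \<Longrightarrow> pos_radon p \<Longrightarrow> mut p (rscale t m) = ennreal t * mut p m"
  using mut_sym[of p "rscale t m"] mut_sym[of p m] mut_rscale_left[of m p t] pos_radon_rscale[of m t] by metis

lemma P_dominated:
  assumes "n \<in> P" "pos_radon m" "\<And>B. B \<in> sets borel \<Longrightarrow> emeasure m B \<le> emeasure n B"
  shows "m \<in> P"
proof -
  have "mut m m \<le> mut n n"
    by (rule mut_mono[OF assms(2) P_radon[OF assms(1)] assms(2) P_radon[OF assms(1)] assms(3,3)])
  also have "\<dots> < \<infinity>" using assms(1) unfolding P_def by simp
  finally show ?thesis using assms(2) unfolding P_def by simp
qed

lemma energy_space_iff: "\<mu> \<in> energy_space \<kappa> \<longleftrightarrow> pos_var \<mu> \<in> P \<and> neg_var \<mu> \<in> P \<and> mut (pos_var \<mu>) (neg_var \<mu>) < \<infinity>"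
proof -
  note pr = pos_radon_pos_var pos_radon_neg_var
  have fin: "energy_plus \<kappa> \<mu> \<mu> < \<infinity> \<and> energy_minus \<kappa> \<mu> \<mu> < \<infinity> \<longleftrightarrow>
      pos_var \<mu> \<in> P \<and> neg_var \<mu> \<in> P \<and> mut (pos_var \<mu>) (neg_var \<mu>) < \<infinity>"
    unfolding energy_plus_eq energy_minus_eq P_def using pr mut_sym[OF pr(1)[of \<mu>] pr(2)[of \<mu>]]
    by (auto simp: ennreal_add_less_top)
  have "\<mu> \<in> energy_space \<kappa> \<longleftrightarrow> energy_plus \<kappa> \<mu> \<mu> < \<infinity> \<and> energy_minus \<kappa> \<mu> \<mu> < \<infinity>"
    unfolding energy_space_def energy_defined_def energy_def
    by (cases "energy_plus \<kappa> \<mu> \<mu>"; cases "energy_minus \<kappa> \<mu> \<mu>") auto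
  then show ?thesis using fin by simp
qed

end

locale perfect_space = kernel_space \<kappa> for \<kappa> :: "'a::{second_countable_topology, t2_space} kernel" +
  assumes perfect: "perfect_kernel \<kappa>"
begin

lemma energy_principle: "energy_principle \<kappa>"
  using perfect unfolding perfect_kernel_def by simp

text \<open>The energy principle speaks of signed measures in their Jordan form, so it is applied to
  the Jordan parts p, q of a - b. These are dominated by \<open>a\<close> and \<open>b\<close>,
  hence the positive half of the energy is finite; an energy that is defined and nonnegative then
  has a finite negative half, which bounds I(p, q).\<close>

lemma mut_finite:
  assumes a: "a \<in> P" and b: "b \<in> P"
  shows "mut a b < \<infinity>"
proof -
  note ar = P_radon[OF a] and br = P_radon[OF b]
  define \<eta> where "\<eta> = of_pos_radon a - of_pos_radon b"
  let ?p = "pos_var \<eta>" and ?q = "neg_var \<eta>"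
  note pr = pos_radon_pos_var[of \<eta>] pos_radon_neg_var[of \<eta>]
  have d: "diff_eq ?p ?q a b" unfolding \<eta>_def by (rule minus_of_pos_radon[OF ar br])
  note dom = diff_eq_dominated[OF d ar br]
  have pP: "?p \<in> P" "?q \<in> P"
    using P_dominated[OF a pr(1) dom(1)] P_dominated[OF b pr(2) dom(2)] by auto
  have plus: "energy_plus \<kappa> \<eta> \<eta> < \<infinity>" using pP unfolding energy_plus_eq P_def by (simp add: ennreal_add_less_top)
  then have "0 \<le> energy \<kappa> \<eta> \<eta>" using energy_principle unfolding energy_principle_def energy_defined_def by blast
  then have "energy_minus \<kappa> \<eta> \<eta> < \<infinity>" using plus unfolding energy_def
    by (cases "energy_plus \<kappa> \<eta> \<eta>"; cases "energy_minus \<kappa> \<eta> \<eta>") auto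
  then have pq: "mut ?p ?q < \<infinity>" unfolding energy_minus_eq by (simp add: ennreal_add_less_top)
  have aa: "mut a a < \<infinity>" "mut b b < \<infinity>" using a b unfolding P_def by auto
  have "mut ?p a \<le> mut a a" by (rule mut_mono[OF pr(1) ar ar ar dom(1) order_refl])
  then have pa: "mut ?p a < \<infinity>" using aa(1) by (rule le_less_trans)
  \<comment> \<open>The relation p + b = q + a carries finiteness from I(p, q) over to I(p, b) and
    then to I(a, b).\<close>
  have "mut ?p b \<le> mut ?p (radd ?p b)" by (simp add: mut_radd_right pr br)
  also have "\<dots> = mut ?p ?q + mut ?p a" using d unfolding diff_eq_def by (simp add: mut_radd_right pr ar)
  also have "\<dots> < \<infinity>" using pq pa by (simp add: ennreal_add_less_top)
  finally have pb: "mut ?p b < \<infinity>" .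
  have "mut a b \<le> mut (radd ?q a) b" by (simp add: mut_radd_left pr ar br)
  also have "\<dots> = mut ?p b + mut b b" unfolding d[unfolded diff_eq_def, symmetric] by (simp add: mut_radd_left pr br)
  also have "\<dots> < \<infinity>" using pb aa(2) by (simp add: ennreal_add_less_top)
  finally show ?thesis .
qed

lemma mut_en: "a \<in> P \<Longrightarrow> b \<in> P \<Longrightarrow> mut a b = ennreal (en a b)"
  using mut_finite[of a b] by (simp add: en_def)

lemma radd_P:
  assumes "a \<in> P" "b \<in> P"
  shows "radd a b \<in> P"
proof -
  have "mut (radd a b) (radd a b) < \<infinity>"
    using assms by (simp add: P_radon pos_radon_radd mut_radd_left mut_radd_right mut_en)
  then show ?thesis using assms unfolding P_def by (simp add: pos_radon_radd)
qed

lemma rscale_P: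
  assumes "a \<in> P"
  shows "rscale t a \<in> P"
proof -
  have "mut (rscale t a) (rscale t a) < \<infinity>"
    unfolding mut_rscale_left[OF P_radon[OF assms] pos_radon_rscale[OF P_radon[OF assms]]]
      mut_rscale_right[OF P_radon[OF assms] P_radon[OF assms]] mut_en[OF assms assms] infinity_ennreal_def
    by (simp only: ennreal_mult_less_top ennreal_less_top simp_thms)
  then show ?thesis using assms unfolding P_def by (simp add: pos_radon_rscale)
qed

lemma en_nn: "0 \<le> en m n"
  by (simp add: en_def)

lemma en_radd:
  assumes "a \<in> P" "b \<in> P" "c \<in> P"
  shows "en (radd a b) c = en a c + en b c"
proof -
  have "ennreal (en (radd a b) c) = ennreal (en a c) + ennreal (en b c)"
    using assms mut_en[OF radd_P[OF assms(1,2)] assms(3)] mut_en[OF assms(1,3)] mut_en[OF assms(2,3)]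
      mut_radd_left[of a b c] P_radon by metis
  also have "\<dots> = ennreal (en a c + en b c)" by (simp add: en_nn)
  finally show ?thesis by (simp add: en_nn del: ennreal_plus)
qed

lemma en_rscale:
  assumes "0 \<le> t" "a \<in> P" "c \<in> P"
  shows "en (rscale t a) c = t * en a c"
proof -
  have "ennreal (en (rscale t a) c) = ennreal t * ennreal (en a c)"
    using mut_en[OF rscale_P[OF assms(2)] assms(3)] mut_en[OF assms(2,3)]
      mut_rscale_left[OF P_radon[OF assms(2)] P_radon[OF assms(3)]] by metis
  also have "\<dots> = ennreal (t * en a c)" using assms by (simp add: ennreal_mult en_nn)
  finally show ?thesis using assms by (simp add: en_nn)
qed

lemma en_commute: "a \<in> P \<Longrightarrow> b \<in> P \<Longrightarrow> en a b = en b a"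
  by (simp add: en_def mut_sym P_radon)

lemma energy_P:
  assumes "pos_var \<mu> \<in> P" "neg_var \<mu> \<in> P" "pos_var \<nu> \<in> P" "neg_var \<nu> \<in> P"
  shows "energy_defined \<kappa> \<mu> \<nu>"
    "energy \<kappa> \<mu> \<nu> = ereal (en (pos_var \<mu>) (pos_var \<nu>) + en (neg_var \<mu>) (neg_var \<nu>) - en (pos_var \<mu>) (neg_var \<nu>) - en (neg_var \<mu>) (pos_var \<nu>))"
proof -
  note nn = en_nn
  have plus: "energy_plus \<kappa> \<mu> \<nu> = ennreal (en (pos_var \<mu>) (pos_var \<nu>) + en (neg_var \<mu>) (neg_var \<nu>))"
    unfolding energy_plus_eq using assms by (simp add: mut_en nn)
  have minus: "energy_minus \<kappa> \<mu> \<nu> = ennreal (en (pos_var \<mu>) (neg_var \<nu>) + en (neg_var \<mu>) (pos_var \<nu>))"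
    unfolding energy_minus_eq using assms by (simp add: mut_en nn)
  show "energy_defined \<kappa> \<mu> \<nu>" unfolding energy_defined_def plus by (simp del: ennreal_plus)
  show "energy \<kappa> \<mu> \<nu> = ereal (en (pos_var \<mu>) (pos_var \<nu>) + en (neg_var \<mu>) (neg_var \<nu>) - en (pos_var \<mu>) (neg_var \<nu>) - en (neg_var \<mu>) (pos_var \<nu>))"
    unfolding energy_def plus minus using nn by (simp add: enn2ereal_ennreal del: ennreal_plus)
qed

lemma en_diff_eq:
  assumes "diff_eq p q a b" "p \<in> P" "q \<in> P" "a \<in> P" "b \<in> P" "c \<in> P"
  shows "en p c - en q c = en a c - en b c"
  using assms en_radd[of p b c] en_radd[of q a c] unfolding diff_eq_def by simp

text \<open>Energies are defined through Jordan parts; this computes them from any representation as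
  a difference in \<open>P\<close>, by moving the terms of p + b = q + a across.\<close>

lemma energy_diff_eq:
  assumes d: "diff_eq (pos_var \<eta>) (neg_var \<eta>) a b" and a: "a \<in> P" and b: "b \<in> P"
  shows "pos_var \<eta> \<in> P" "neg_var \<eta> \<in> P" "energy \<kappa> \<eta> \<eta> = ereal (en a a - 2 * en a b + en b b)"
proof -
  show P: "pos_var \<eta> \<in> P" "neg_var \<eta> \<in> P"
    using P_dominated[OF a pos_radon_pos_var diff_eq_dominated(1)[OF d P_radon[OF a] P_radon[OF b]]]
      P_dominated[OF b pos_radon_neg_var diff_eq_dominated(2)[OF d P_radon[OF a] P_radon[OF b]]] by auto
  note e = en_diff_eq[OF d P a b]
  show "energy \<kappa> \<eta> \<eta> = ereal (en a a - 2 * en a b + en b b)"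
    unfolding energy_P(2)[OF P P]
    using e[OF a] e[OF b] e[OF P(1)] e[OF P(2)] en_commute[OF a b]
      en_commute[OF a P(1)] en_commute[OF a P(2)] en_commute[OF b P(1)] en_commute[OF b P(2)] en_commute[OF P]
    by simp
qed

text \<open>Positivity for the formal difference a - b is the energy principle for the signed
  measure that represents it.\<close>

sublocale energy_form P radd rscale en
proof
  fix a b assume ab: "a \<in> P" "b \<in> P"
  obtain \<eta> where \<eta>: "diff_eq (pos_var \<eta>) (neg_var \<eta>) a b"
    using diff_eq_exists[OF P_radon P_radon] ab by blast
  note e = energy_diff_eq[OF \<eta> ab]
  have "energy_defined \<kappa> \<eta> \<eta>" using energy_P(1)[OF e(1,2,1,2)] .
  then have "0 \<le> energy \<kappa> \<eta> \<eta>" using energy_principle unfolding energy_principle_def by blast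
  then show "0 \<le> en a a - 2 * en a b + en b b" using e(3) by simp
qed (rule radd_P rscale_P en_commute en_radd en_rscale; assumption)+

lemma D_eq_0D:
  assumes ab: "a \<in> P" "b \<in> P" and D: "D a b = 0"
  shows "a = b"
proof -
  obtain \<eta> where \<eta>: "diff_eq (pos_var \<eta>) (neg_var \<eta>) a b"
    using diff_eq_exists[OF P_radon P_radon] ab by blast
  note e = energy_diff_eq[OF \<eta> ab]
  have "energy_defined \<kappa> \<eta> \<eta>" using energy_P(1)[OF e(1,2,1,2)] .
  moreover have "energy \<kappa> \<eta> \<eta> = 0" using e(3) D unfolding D_def by simp
  ultimately have "\<eta> = 0" using energy_principle unfolding energy_principle_def by blast
  then have "radd (null_measure borel) b = radd (null_measure borel) a"
    using \<eta> unfolding diff_eq_def by (simp add: zero_radon_var)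
  then show ?thesis using ab by (simp add: radd_null P_radon radd_commute[of "null_measure borel"])
qed

lemma energy_space_iff_P: "\<mu> \<in> energy_space \<kappa> \<longleftrightarrow> pos_var \<mu> \<in> P \<and> neg_var \<mu> \<in> P"
  unfolding energy_space_iff using mut_finite by blast

lemma energy_cone_iff: "\<mu> \<in> energy_cone \<kappa> \<longleftrightarrow> (\<exists>m\<in>P. \<mu> = of_pos_radon m)"
proof -
  have "null_measure borel \<in> P" by (simp add: P_def)
  then show ?thesis
    unfolding energy_cone_def Int_iff energy_space_iff_P
    by (metis P_radon neg_var_of_pos_radon of_pos_radon_in_cone of_pos_radon_pos_var pos_var_of_pos_radon)
qed

lemma of_pos_radon_energy_cone: "m \<in> P \<Longrightarrow> of_pos_radon m \<in> energy_cone \<kappa>"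
  using energy_cone_iff by blast

lemma energy_dist_D:
  assumes "\<mu> \<in> energy_space \<kappa>" "\<nu> \<in> energy_space \<kappa>"
  shows "energy_dist \<kappa> \<mu> \<nu> = sqrt (D (radd (pos_var \<mu>) (neg_var \<nu>)) (radd (neg_var \<mu>) (pos_var \<nu>)))"
proof -
  have "radd (pos_var \<mu>) (neg_var \<nu>) \<in> P" "radd (neg_var \<mu>) (pos_var \<nu>) \<in> P"
    using assms unfolding energy_space_iff_P by (auto intro: radd_P)
  from energy_diff_eq(3)[OF minus_radon_spec this] show ?thesis unfolding energy_dist_def D_def by simp
qed

lemma energy_dist_of_pos_radon:
  assumes "a \<in> P" "b \<in> P"
  shows "energy_dist \<kappa> (of_pos_radon a) (of_pos_radon b) = sqrt (D a b)"
  using energy_diff_eq(3)[OF minus_of_pos_radon[OF P_radon[OF assms(1)] P_radon[OF assms(2)]] assms]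
  unfolding energy_dist_def D_def by simp

lemma energy_dist_commute: "energy_dist \<kappa> \<mu> \<nu> = energy_dist \<kappa> \<nu> (\<mu> :: 'a radon)"
proof -
  let ?a = "radd (pos_var \<mu>) (neg_var \<nu>)" and ?b = "radd (neg_var \<mu>) (pos_var \<nu>)"
  let ?p = "pos_var (\<mu> - \<nu>)" and ?q = "neg_var (\<mu> - \<nu>)"
  note pr = pos_radon_pos_var pos_radon_neg_var
  have ab: "pos_radon ?a" "pos_radon ?b" by (intro pos_radon_radd pr)+
  have "singular_measures ?q ?p"
    using singular_pos_neg_var[of "\<mu> - \<nu>"] unfolding singular_measures_def by (metis borel_comp double_complement)
  then have sw: "pos_var (Abs_radon (?q, ?p)) = ?q" "neg_var (Abs_radon (?q, ?p)) = ?p"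
    by (simp_all add: radon_of_pair pr)
  have "diff_eq ?q ?p ?b ?a" using minus_radon_spec[of \<mu> \<nu>] unfolding diff_eq_def by simp
  moreover have "diff_eq (pos_var (\<nu> - \<mu>)) (neg_var (\<nu> - \<mu>)) ?b ?a"
    using minus_radon_spec[of \<nu> \<mu>] by (simp add: radd_commute[OF pr(1) pr(2)] )
  ultimately have "\<nu> - \<mu> = Abs_radon (?q, ?p)"
    using diff_eq_unique[OF ab(2,1)] sw by metis
  then have "pos_var (\<nu> - \<mu>) = ?q" "neg_var (\<nu> - \<mu>) = ?p" using sw by auto
  then have "energy \<kappa> (\<nu> - \<mu>) (\<nu> - \<mu>) = energy \<kappa> (\<mu> - \<nu>) (\<mu> - \<nu>)"
    unfolding energy_def energy_plus_eq energy_minus_eq by (simp add: add.commute)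
  then show ?thesis unfolding energy_dist_def by simp
qed

lemma energy_dist_nonneg: "0 \<le> energy_dist \<kappa> \<mu> (\<nu> :: 'a radon)"
proof -
  have "0 \<le> real_of_ereal (energy \<kappa> \<eta> \<eta>)" for \<eta> :: "'a radon"
  proof (cases "energy_defined \<kappa> \<eta> \<eta>")
    case True
    then have "0 \<le> energy \<kappa> \<eta> \<eta>" using energy_principle unfolding energy_principle_def by blast
    then show ?thesis by (rule real_of_ereal_pos)
  next
    case False
    then have "energy_plus \<kappa> \<eta> \<eta> = top" "energy_minus \<kappa> \<eta> \<eta> = top"
      unfolding energy_defined_def by (auto simp: top.not_eq_extremum[symmetric])
    \<comment> \<open>An undefined energy evaluates to infinity, whose real value is 0.\<close>
    then have "energy \<kappa> \<eta> \<eta> = \<infinity>" unfolding energy_def by simp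
    then show ?thesis by simp
  qed
  then show ?thesis unfolding energy_dist_def by simp
qed

lemma Metric_energy_space: "Metric_space (energy_space \<kappa>) (energy_dist \<kappa>)"
proof
  show "0 \<le> energy_dist \<kappa> \<mu> \<nu>" for \<mu> \<nu> :: "'a radon" by (rule energy_dist_nonneg)
  show "energy_dist \<kappa> \<mu> \<nu> = energy_dist \<kappa> \<nu> \<mu>" for \<mu> \<nu> :: "'a radon" by (rule energy_dist_commute)
  fix \<mu> \<nu> assume \<mu>: "\<mu> \<in> energy_space \<kappa>" and \<nu>: "\<nu> \<in> energy_space \<kappa>"
  let ?a = "radd (pos_var \<mu>) (neg_var \<nu>)" and ?b = "radd (neg_var \<mu>) (pos_var \<nu>)"
  have ab: "?a \<in> P" "?b \<in> P" using \<mu> \<nu> unfolding energy_space_iff_P by (auto intro: radd_P)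
  note pr = pos_radon_pos_var pos_radon_neg_var
  show "energy_dist \<kappa> \<mu> \<nu> = 0 \<longleftrightarrow> \<mu> = \<nu>"
  proof
    assume "energy_dist \<kappa> \<mu> \<nu> = 0"
    then have "?a = ?b" using D_eq_0D[OF ab] unfolding energy_dist_D[OF \<mu> \<nu>] by simp
    then have "emeasure (pos_var \<mu>) B + emeasure (neg_var \<nu>) B = emeasure (neg_var \<mu>) B + emeasure (pos_var \<nu>) B" for B
      by (metis emeasure_radd pos_radon_sets pr)
    then show "\<mu> = \<nu>"
      using jordan_unique[OF _ _ _ _ singular_pos_neg_var singular_pos_neg_var, of \<mu> \<nu>]
      by (intro radon_eqI) (simp_all add: pos_radon_sets pr)
  next
    assume "\<mu> = \<nu>"
    then show "energy_dist \<kappa> \<mu> \<nu> = 0"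
      unfolding energy_dist_D[OF \<mu> \<nu>] by (simp add: radd_commute[OF pr(2) pr(1)] D_self)
  qed
  fix \<omega> assume \<omega>: "\<omega> \<in> energy_space \<kappa>"
  note PP = \<mu>[unfolded energy_space_iff_P] \<nu>[unfolded energy_space_iff_P] \<omega>[unfolded energy_space_iff_P]
  \<comment> \<open>Common terms are added so that all three elements are positive and their
    differences are those of \<open>\<mu>\<close>, \<open>\<nu>\<close> and
    \<open>\<omega>\<close>.\<close>
  let ?x = "radd (radd (pos_var \<mu>) (neg_var \<nu>)) (neg_var \<omega>)" and ?y = "radd (radd (neg_var \<mu>) (pos_var \<nu>)) (neg_var \<omega>)"
    and ?z = "radd (radd (neg_var \<mu>) (neg_var \<nu>)) (pos_var \<omega>)"
  have "sqrt (D ?x ?z) \<le> sqrt (D ?x ?y) + sqrt (D ?y ?z)"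
    using PP by (intro D_triangle radd_P) auto
  moreover have "D ?x ?z = D (radd (pos_var \<mu>) (neg_var \<omega>)) (radd (neg_var \<mu>) (pos_var \<omega>))"
    "D ?x ?y = D (radd (pos_var \<mu>) (neg_var \<nu>)) (radd (neg_var \<mu>) (pos_var \<nu>))"
    "D ?y ?z = D (radd (pos_var \<nu>) (neg_var \<omega>)) (radd (neg_var \<nu>) (pos_var \<omega>))"
    using PP en_commute by (auto simp: D_def en_simps)
  ultimately show "energy_dist \<kappa> \<mu> \<omega> \<le> energy_dist \<kappa> \<mu> \<nu> + energy_dist \<kappa> \<nu> \<omega>"
    unfolding energy_dist_D[OF \<mu> \<nu>] energy_dist_D[OF \<nu> \<omega>] energy_dist_D[OF \<mu> \<omega>] by simp
qed


lemma Metric_energy_cone: "Metric_space (energy_cone \<kappa>) (energy_dist \<kappa>)"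
  by (rule Metric_space.subspace[OF Metric_energy_space]) (simp add: energy_cone_def)

lemma conv_iff_energy_dist:
  assumes u: "\<And>n. u n \<in> P" and a: "a \<in> P"
  shows "conv u a \<longleftrightarrow> (\<forall>e>0. \<exists>N. \<forall>n\<ge>N. energy_dist \<kappa> (of_pos_radon (u n)) (of_pos_radon a) < e)"
proof -
  have "conv u a \<longleftrightarrow> (\<lambda>n. sqrt (D (u n) a)) \<longlonglongrightarrow> 0"
  proof
    assume "conv u a"
    then have "(\<lambda>n. sqrt (D (u n) a)) \<longlonglongrightarrow> sqrt 0" unfolding conv_def by (intro tendsto_intros)
    then show "(\<lambda>n. sqrt (D (u n) a)) \<longlonglongrightarrow> 0" by simp
  next
    assume "(\<lambda>n. sqrt (D (u n) a)) \<longlonglongrightarrow> 0"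
    then have "(\<lambda>n. (sqrt (D (u n) a))\<^sup>2) \<longlonglongrightarrow> 0\<^sup>2" by (intro tendsto_intros)
    then show "conv u a" unfolding conv_def using D_nonneg[OF u a] by simp
  qed
  also have "\<dots> \<longleftrightarrow> (\<forall>e>0. \<exists>N. \<forall>n\<ge>N. energy_dist \<kappa> (of_pos_radon (u n)) (of_pos_radon a) < e)"
    unfolding LIMSEQ_iff energy_dist_of_pos_radon[OF u a] using D_nonneg[OF u a] by simp
  finally show ?thesis .
qed

text \<open>Strong completeness of the cone, carried over from the metric on the type
  \<open>radon\<close>.\<close>

sublocale complete_energy_form P radd rscale en
proof
  fix u :: "nat \<Rightarrow> 'a measure" assume u: "\<And>n. u n \<in> P"
    and c: "\<And>e. 0 < e \<Longrightarrow> \<exists>N. \<forall>m n. N \<le> n \<longrightarrow> n \<le> m \<longrightarrow> en (u m) (u m) - 2 * en (u m) (u n) + en (u n) (u n) < e"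
  interpret M: Metric_space "energy_cone \<kappa>" "energy_dist \<kappa>" by (rule Metric_energy_cone)
  have "M.MCauchy (\<lambda>n. of_pos_radon (u n))"
    unfolding M.MCauchy_def
  proof (intro conjI allI impI)
    show "range (\<lambda>n. of_pos_radon (u n)) \<subseteq> energy_cone \<kappa>" using of_pos_radon_energy_cone[OF u] by auto
    fix \<epsilon> :: real assume \<epsilon>: "0 < \<epsilon>"
    then obtain N where N: "\<And>m n. N \<le> n \<Longrightarrow> n \<le> m \<Longrightarrow> D (u m) (u n) < \<epsilon>\<^sup>2"
      using c[of "\<epsilon>\<^sup>2"] unfolding D_def by auto
    have "energy_dist \<kappa> (of_pos_radon (u n)) (of_pos_radon (u n')) < \<epsilon>" if "N \<le> n" "N \<le> n'" for n n'
    proof -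
      have "D (u n) (u n') < \<epsilon>\<^sup>2"
        using N[of n n'] N[of n' n] that D_sym[OF u u, of n n'] by (cases "n \<le> n'") auto
      then have "sqrt (D (u n) (u n')) < sqrt (\<epsilon>\<^sup>2)" by (rule real_sqrt_less_mono)
      then show ?thesis using \<epsilon> by (simp add: energy_dist_of_pos_radon u)
    qed
    then show "\<exists>N. \<forall>n n'. N \<le> n \<longrightarrow> N \<le> n' \<longrightarrow> energy_dist \<kappa> (of_pos_radon (u n)) (of_pos_radon (u n')) < \<epsilon>" by blast
  qed
  moreover have "M.mcomplete" using perfect unfolding perfect_kernel_def by simp
  ultimately obtain x where x: "limitin M.mtopology (\<lambda>n. of_pos_radon (u n)) x sequentially"
    unfolding M.mcomplete_def by blast
  then have "x \<in> energy_cone \<kappa>" by (simp add: M.limit_metric_sequentially)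
  then obtain a where a: "a \<in> P" "x = of_pos_radon a" unfolding energy_cone_iff by blast
  have "conv u a"
    using x unfolding conv_iff_energy_dist[OF u a(1)] a(2) M.limit_metric_sequentially by blast
  then show "\<exists>a\<in>P. (\<lambda>n. en (u n) (u n) - 2 * en (u n) a + en a a) \<longlonglongrightarrow> 0"
    using a(1) unfolding conv_def D_def by blast
qed

lemma radon_integral_of_pos_radon: "pos_radon m \<Longrightarrow> radon_integral (of_pos_radon m) \<phi> = (\<integral>x. \<phi> x \<partial>m)"
  by (simp add: radon_integral_def)

text \<open>For fixed \<open>\<phi>\<close>, the measures whose integral is close to that of
  \<open>a\<close> form a vaguely open set; perfectness makes its trace on the cone strongly
  open.\<close>

lemma conv_imp_vague_lim:
  assumes u: "\<And>n. u n \<in> P" and a: "a \<in> P" and conv: "conv u a"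
  shows "vague_lim u a"
  unfolding vague_lim_def LIMSEQ_iff
proof (intro ballI allI impI)
  fix \<phi> :: "'a \<Rightarrow> real" and e :: real assume \<phi>: "\<phi> \<in> C0" and e: "0 < e"
  interpret M: Metric_space "energy_space \<kappa>" "energy_dist \<kappa>" by (rule Metric_energy_space)
  have "continuous_map vague_topology euclideanreal ((\<lambda>f. f \<phi>) \<circ> (\<lambda>\<mu> :: 'a radon. restrict (radon_integral \<mu>) C0))"
    unfolding vague_topology_def using \<phi> by (intro continuous_map_pullback continuous_map_product_projection)
  moreover have "(\<lambda>f. f \<phi>) \<circ> (\<lambda>\<mu> :: 'a radon. restrict (radon_integral \<mu>) C0) = (\<lambda>\<mu>. radon_integral \<mu> \<phi>)"
    using \<phi> by (auto simp: fun_eq_iff)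
  ultimately have c: "continuous_map vague_topology euclideanreal (\<lambda>\<mu> :: 'a radon. radon_integral \<mu> \<phi>)" by simp
  have top: "topspace vague_topology = (UNIV :: 'a radon set)"
    unfolding vague_topology_def topspace_pullback_topology by auto
  define V where "V = {\<mu> :: 'a radon. radon_integral \<mu> \<phi> \<in> ball (radon_integral (of_pos_radon a) \<phi>) e}"
  have "openin vague_topology V"
    using openin_continuous_map_preimage[OF c, of "ball (radon_integral (of_pos_radon a) \<phi>) e"]
    unfolding V_def top by simp
  then have "openin (subtopology vague_topology (energy_cone \<kappa>)) (V \<inter> energy_cone \<kappa>)"
    by (auto simp: openin_subtopology)
  then have "openin (subtopology (strong_topology \<kappa>) (energy_cone \<kappa>)) (V \<inter> energy_cone \<kappa>)"
    using perfect unfolding perfect_kernel_def by blast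
  then obtain T where T: "openin M.mtopology T" "V \<inter> energy_cone \<kappa> = T \<inter> energy_cone \<kappa>"
    unfolding openin_subtopology strong_topology_def by blast
  have ca: "of_pos_radon a \<in> energy_cone \<kappa>" using a by (rule of_pos_radon_energy_cone)
  have "of_pos_radon a \<in> V" unfolding V_def using e by simp
  then have "of_pos_radon a \<in> T" using T(2) ca by blast
  then obtain r where r: "0 < r" "M.mball (of_pos_radon a) r \<subseteq> T" using T(1) unfolding M.openin_mtopology by blast
  obtain N where N: "\<And>n. N \<le> n \<Longrightarrow> energy_dist \<kappa> (of_pos_radon (u n)) (of_pos_radon a) < r"
    using conv r(1) unfolding conv_iff_energy_dist[OF u a] by blast
  have "norm ((\<integral>x. \<phi> x \<partial>u n) - (\<integral>x. \<phi> x \<partial>a)) < e" if n: "N \<le> n" for n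
  proof -
    have cu: "of_pos_radon (u n) \<in> energy_cone \<kappa>" using u by (rule of_pos_radon_energy_cone)
    have "of_pos_radon (u n) \<in> M.mball (of_pos_radon a) r"
      using N[OF n] ca cu M.commute[of "of_pos_radon a"] by (auto simp: M.in_mball energy_cone_def)
    then have "of_pos_radon (u n) \<in> V" using r(2) T(2) cu by blast
    then show ?thesis unfolding V_def
      by (simp add: radon_integral_of_pos_radon P_radon u a dist_real_def abs_minus_commute)
  qed
  then show "\<exists>N. \<forall>n\<ge>N. norm ((\<integral>x. \<phi> x \<partial>u n) - (\<integral>x. \<phi> x \<partial>a)) < e" by blast
qed

lemma conv_pot_liminf:
  assumes "\<And>n. s n \<in> P" "\<eta> \<in> P" "conv s \<eta>"
  shows "pot \<eta> x \<le> liminf (\<lambda>n. pot (s n) x)"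
  unfolding pot_def
  by (rule vague_lim_lsc[OF P_radon[OF assms(2)] P_radon[OF assms(1)] conv_imp_vague_lim[OF assms] kernel_section_lsc])

section \<open>Measures concentrated on a set and their strong closure\<close>

definition conc :: "'a set \<Rightarrow> 'a measure \<Rightarrow> bool" where
  "conc A m \<longleftrightarrow> (\<forall>K. compact K \<longrightarrow> (\<exists>N\<in>null_sets m. K - A \<subseteq> N))"

definition PA :: "'a set \<Rightarrow> 'a measure set" where
  "PA A = {m\<in>P. conc A m}"

definition PC :: "'a set \<Rightarrow> 'a measure set" where
  "PC A = {a\<in>P. \<exists>u. (\<forall>n. u n \<in> PA A) \<and> conv u a}"

lemma PA_P: "m \<in> PA A \<Longrightarrow> m \<in> P" by (simp add: PA_def)
lemma PC_P: "m \<in> PC A \<Longrightarrow> m \<in> P" by (simp add: PC_def)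

lemma PC_E:
  assumes "a \<in> PC A"
  shows "\<exists>u. (\<forall>n. u n \<in> PA A) \<and> conv u a"
  using assms unfolding PC_def by blast

lemma PA_subset_PC: "m \<in> PA A \<Longrightarrow> m \<in> PC A"
  unfolding PC_def conv_def using PA_P by (auto simp: D_self intro!: exI[of _ "\<lambda>_. m"])

lemma conc_mono: "conc A m \<Longrightarrow> A \<subseteq> B \<Longrightarrow> conc B m"
  unfolding conc_def by (meson Diff_mono order_refl subset_trans)

lemma PA_mono: "m \<in> PA A \<Longrightarrow> A \<subseteq> B \<Longrightarrow> m \<in> PA B"
  unfolding PA_def using conc_mono by blast

lemma PC_mono: "m \<in> PC A \<Longrightarrow> A \<subseteq> B \<Longrightarrow> m \<in> PC B"
  unfolding PC_def using PA_mono by blast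

text \<open>The strong topology is metric, so closure points are limits of sequences. This allows
  the closed cone to be handled as \<open>PC A\<close>, without the type
  \<open>radon\<close>.\<close>

lemma energy_cone_closure_iff: "\<eta> \<in> energy_cone_closure \<kappa> A \<longleftrightarrow> (\<exists>a\<in>PC A. \<eta> = of_pos_radon a)"
proof -
  interpret M: Metric_space "energy_space \<kappa>" "energy_dist \<kappa>" by (rule Metric_energy_space)
  let ?T = "subtopology (strong_topology \<kappa>) (energy_cone \<kappa>)"
  have on: "\<mu> \<in> energy_cone_on \<kappa> A \<longleftrightarrow> (\<exists>m\<in>PA A. \<mu> = of_pos_radon m)" for \<mu>
    unfolding energy_cone_on_def PA_def concentrated_on_def conc_def mem_Collect_eq energy_cone_iff
    using P_radon by auto
  have sub: "energy_cone \<kappa> \<subseteq> energy_space \<kappa>" unfolding energy_cone_def by simp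
  have top: "topspace ?T = energy_cone \<kappa>" unfolding strong_topology_def using sub by auto
  show ?thesis
  proof
    assume "\<eta> \<in> energy_cone_closure \<kappa> A"
    then have \<eta>: "\<eta> \<in> energy_cone \<kappa>" and cl: "\<And>T. \<eta> \<in> T \<Longrightarrow> openin ?T T \<Longrightarrow> \<exists>y\<in>energy_cone_on \<kappa> A. y \<in> T"
      unfolding energy_cone_closure_def in_closure_of top by blast+
    obtain a where a: "a \<in> P" "\<eta> = of_pos_radon a" using \<eta> unfolding energy_cone_iff by blast
    have "\<exists>m\<in>PA A. energy_dist \<kappa> (of_pos_radon m) \<eta> < 1 / Suc n" for n
    proof -
      have o: "openin ?T (M.mball \<eta> (1 / Suc n) \<inter> energy_cone \<kappa>)"
        unfolding openin_subtopology strong_topology_def using M.openin_mball by blast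
      have "\<eta> \<in> M.mball \<eta> (1 / Suc n) \<inter> energy_cone \<kappa>" using \<eta> sub by auto
      from cl[OF this o] obtain y where y: "y \<in> energy_cone_on \<kappa> A" "y \<in> M.mball \<eta> (1 / Suc n)" by blast
      then obtain m where "m \<in> PA A" "y = of_pos_radon m" using on by blast
      then show ?thesis using y(2) M.commute[of \<eta> y] by (auto simp: M.in_mball)
    qed
    then obtain u where u: "\<And>n. u n \<in> PA A" "\<And>n. energy_dist \<kappa> (of_pos_radon (u n)) \<eta> < 1 / Suc n" by metis
    have "conv u a"
      unfolding conv_iff_energy_dist[OF PA_P[OF u(1)] a(1)]
    proof (intro allI impI)
      fix e :: real assume "0 < e"
      then obtain N where N: "1 / Suc N < e" using nat_approx_posE by blast
      have "energy_dist \<kappa> (of_pos_radon (u n)) (of_pos_radon a) < e" if "N \<le> n" for n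
      proof -
        have "1 / real (Suc n) \<le> 1 / Suc N" using that by (simp add: frac_le)
        then show ?thesis using u(2)[of n] N unfolding a(2) by linarith
      qed
      then show "\<exists>N. \<forall>n\<ge>N. energy_dist \<kappa> (of_pos_radon (u n)) (of_pos_radon a) < e" by blast
    qed
    then have "a \<in> PC A" using u(1) a(1) unfolding PC_def by blast
    then show "\<exists>a\<in>PC A. \<eta> = of_pos_radon a" using a(2) by blast
  next
    assume "\<exists>a\<in>PC A. \<eta> = of_pos_radon a"
    then obtain a where a: "a \<in> PC A" "\<eta> = of_pos_radon a" by blast
    note aP = PC_P[OF a(1)]
    obtain u where u: "\<And>n. u n \<in> PA A" "conv u a" using PC_E[OF a(1)] by blast
    have \<eta>: "\<eta> \<in> energy_cone \<kappa>" using aP a(2) of_pos_radon_energy_cone by blast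
    have "\<exists>y\<in>energy_cone_on \<kappa> A. y \<in> T" if T: "\<eta> \<in> T" "openin ?T T" for T
    proof -
      obtain S where S: "openin M.mtopology S" "T = S \<inter> energy_cone \<kappa>"
        using T(2) unfolding openin_subtopology strong_topology_def by blast
      obtain r where r: "0 < r" "M.mball \<eta> r \<subseteq> S" using S T(1) unfolding M.openin_mtopology by blast
      obtain n where n: "energy_dist \<kappa> (of_pos_radon (u n)) \<eta> < r"
        using u(2) r(1) unfolding conv_iff_energy_dist[OF PA_P[OF u(1)] aP] a(2) by blast
      have cu: "of_pos_radon (u n) \<in> energy_cone \<kappa>" using PA_P[OF u(1)] by (rule of_pos_radon_energy_cone)
      have "of_pos_radon (u n) \<in> M.mball \<eta> r" using n cu \<eta> sub M.commute[of \<eta>] by (auto simp: M.in_mball)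
      then have "of_pos_radon (u n) \<in> T" using r(2) S(2) cu by blast
      moreover have "of_pos_radon (u n) \<in> energy_cone_on \<kappa> A" using on u(1) by blast
      ultimately show ?thesis by blast
    qed
    then show "\<eta> \<in> energy_cone_closure \<kappa> A"
      unfolding energy_cone_closure_def in_closure_of top using \<eta> by blast
  qed
qed

lemma PC_closed:
  assumes u: "\<And>n. u n \<in> PC A" and a: "a \<in> P" and conv: "conv u a"
  shows "a \<in> PC A"
proof -
  have "\<exists>v\<in>PA A. D v (u n) < 1 / Suc n" for n
  proof -
    obtain w where w: "\<And>k. w k \<in> PA A" "conv w (u n)" using PC_E[OF u[of n]] by blast
    have "eventually (\<lambda>k. D (w k) (u n) < 1 / Suc n) sequentially"
      using w(2) unfolding conv_def by (rule order_tendstoD(2)) simp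
    then show ?thesis using w(1) by (auto simp: eventually_sequentially)
  qed
  then obtain v where v: "\<And>n. v n \<in> PA A" "\<And>n. D (v n) (u n) < 1 / Suc n" by metis
  have "(\<lambda>n. D (v n) (u n)) \<longlonglongrightarrow> 0"
    by (rule tendsto_sandwich[OF _ _ tendsto_const LIMSEQ_Suc[OF lim_1_over_n]])
      (auto intro!: always_eventually D_nonneg PA_P[OF v(1)] PC_P[OF u] less_imp_le[OF v(2)] simp del: of_nat_Suc)
  then have "conv v a" by (rule conv_eqI[OF conv PC_P[OF u] PA_P[OF v(1)] a])
  then show ?thesis unfolding PC_def using v(1) a by blast
qed

text \<open>Mutual energies are strongly continuous in each argument, so inequalities tested on
  \<open>PA A\<close> survive the closure.\<close>

lemma PC_le:
  assumes a: "a \<in> P" "b \<in> P" and le: "\<And>\<nu>. \<nu> \<in> PA A \<Longrightarrow> en a \<nu> \<le> en b \<nu>" and \<nu>: "\<nu> \<in> PC A"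
  shows "en a \<nu> \<le> en b \<nu>"
proof -
  obtain u where u: "\<And>n. u n \<in> PA A" "conv u \<nu>" using PC_E[OF \<nu>] by blast
  have "(\<lambda>n. en (u n) c) \<longlonglongrightarrow> en \<nu> c" if "c \<in> P" for c
    by (rule conv_en[OF PA_P[OF u(1)] PC_P[OF \<nu>] u(2) that])
  moreover have "en (u n) a \<le> en (u n) b" for n
    using le[OF u(1)[of n]] en_commute a PA_P[OF u(1)[of n]] by simp
  ultimately have "en \<nu> a \<le> en \<nu> b" using a by (intro LIMSEQ_le[of "\<lambda>n. en (u n) a" _ "\<lambda>n. en (u n) b"]) auto
  then show ?thesis using en_commute a PC_P[OF \<nu>] by simp
qed

lemma PC_eq:
  assumes "a \<in> P" "b \<in> P" "\<And>\<nu>. \<nu> \<in> PA A \<Longrightarrow> en a \<nu> = en b \<nu>" "\<nu> \<in> PC A"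
  shows "en a \<nu> = en b \<nu>"
  using PC_le[of a b A \<nu>] PC_le[of b a A \<nu>] assms by (intro antisym) auto

text \<open>The set \<open>A\<close> may fail to be Borel; the null sets in the definition of
  concentration are measurable, and removing them from the compact sets of an exhaustion leaves a
  Borel part of \<open>A\<close>.\<close>

lemma conc_core:
  assumes m: "pos_radon m" and A: "conc A m"
  shows "\<exists>B\<in>sets borel. B \<subseteq> A \<and> emeasure m (- B) = 0"
proof -
  obtain L where L0: "\<And>n. L n \<subseteq> interior (L (Suc n))"
    and L: "\<And>n. compact (L n)" "(\<Union>n. L n) = (UNIV :: 'a set)"
    using compact_exhaustion[OF open_UNIV] by auto
  have "\<exists>N. N \<in> null_sets m \<and> L n - A \<subseteq> N" for n using A L(1) unfolding conc_def by blast
  then obtain N where N: "\<And>n. N n \<in> null_sets m" "\<And>n. L n - A \<subseteq> N n" by metis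
  have Nb: "N n \<in> sets borel" for n using N(1)[of n] pos_radon_sets[OF m] by auto
  define B where "B = (\<Union>n. L n - N n)"
  have B: "B \<in> sets borel" unfolding B_def using Nb compact_borel[OF L(1)] by auto
  have "- B \<subseteq> (\<Union>n. N n)" unfolding B_def using L(2) by blast
  moreover have "(\<Union>n. N n) \<in> null_sets m" using N(1) by auto
  ultimately have "emeasure m (- B) = 0"
    using B pos_radon_sets[OF m] null_sets_subset[of "\<Union>n. N n" m "- B"] by (auto simp: null_sets_def)
  moreover have "B \<subseteq> A" unfolding B_def using N(2) by blast
  ultimately show ?thesis using B by blast
qed

lemma conc_borel:
  assumes m: "pos_radon m" and A: "A \<in> sets borel"
  shows "conc A m \<longleftrightarrow> emeasure m (- A) = 0"
proof
  assume "conc A m"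
  then obtain B where B: "B \<in> sets borel" "B \<subseteq> A" "emeasure m (- B) = 0" using conc_core[OF m] by blast
  then show "emeasure m (- A) = 0"
    using emeasure_mono[of "- A" "- B" m] pos_radon_sets[OF m] by auto
next
  assume "emeasure m (- A) = 0"
  then have "- A \<in> null_sets m" using A pos_radon_sets[OF m] by auto
  then show "conc A m" unfolding conc_def by blast
qed

lemma rrestrict_le:
  assumes "pos_radon (m :: 'a measure)" "B \<in> sets borel" "C \<in> sets borel"
  shows "emeasure (rrestrict m B) C \<le> emeasure m C"
proof -
  have "B \<in> sets m" "C \<in> sets m" using assms pos_radon_sets by auto
  then show ?thesis by (subst emeasure_rrestrict) (auto intro!: emeasure_mono)
qed

lemma rrestrict_P: "m \<in> P \<Longrightarrow> B \<in> sets borel \<Longrightarrow> rrestrict m B \<in> P"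
  by (rule P_dominated[of m]) (auto intro: pos_radon_rrestrict rrestrict_le P_radon)

lemma rrestrict_PA: "m \<in> P \<Longrightarrow> B \<in> sets borel \<Longrightarrow> B \<subseteq> A \<Longrightarrow> rrestrict m B \<in> PA A"
proof -
  assume m: "m \<in> P" and B: "B \<in> sets borel" "B \<subseteq> A"
  have "emeasure (rrestrict m B) (- B) = 0"
    using B P_radon[OF m] by (subst emeasure_rrestrict) (auto simp: pos_radon_sets)
  then have "conc B (rrestrict m B)" using conc_borel[OF pos_radon_rrestrict[OF P_radon[OF m] B(1)] B(1)] by blast
  then show "rrestrict m B \<in> PA A" unfolding PA_def using rrestrict_P[OF m B(1)] conc_mono B(2) by blast
qed

lemma PA_radd: "m \<in> PA A \<Longrightarrow> n \<in> PA A \<Longrightarrow> radd m n \<in> PA A"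
proof -
  assume m: "m \<in> PA A" and n: "n \<in> PA A"
  note mr = P_radon[OF PA_P[OF m]] P_radon[OF PA_P[OF n]]
  have c: "conc A m" "conc A n" using m n by (auto simp: PA_def)
  obtain B where B1: "B \<in> sets borel" "B \<subseteq> A" "emeasure m (- B) = 0" using conc_core[OF mr(1) c(1)] by blast
  obtain C where C1: "C \<in> sets borel" "C \<subseteq> A" "emeasure n (- C) = 0" using conc_core[OF mr(2) c(2)] by blast
  note B = B1 C1
  have "emeasure m (- (B \<union> C)) = 0" "emeasure n (- (B \<union> C)) = 0"
    using emeasure_mono[of "- (B \<union> C)" "- B" m] emeasure_mono[of "- (B \<union> C)" "- C" n] B mr by (auto simp: pos_radon_sets)
  then have "conc (B \<union> C) (radd m n)"
    using B mr by (subst conc_borel) (auto simp: pos_radon_radd emeasure_radd pos_radon_sets)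
  then show "radd m n \<in> PA A"
    unfolding PA_def using radd_P[OF PA_P[OF m] PA_P[OF n]] conc_mono[of "B \<union> C" _ A] B by blast
qed

lemma PA_rscale: "m \<in> PA A \<Longrightarrow> rscale t m \<in> PA A"
proof -
  assume m: "m \<in> PA A"
  have "conc A (rscale t m)"
    unfolding conc_def
  proof (intro allI impI)
    fix K :: "'a set" assume K: "compact K"
    have "\<exists>N\<in>null_sets m. K - A \<subseteq> N" using m K by (simp add: PA_def conc_def)
    then obtain N where N: "N \<in> null_sets m" "K - A \<subseteq> N" by (elim bexE)
    have "N \<in> null_sets (rscale t m)" using N(1) by (simp add: null_sets_def emeasure_rscale)
    with N(2) show "\<exists>N\<in>null_sets (rscale t m). K - A \<subseteq> N" by (intro bexI)
  qed
  then show "rscale t m \<in> PA A" using rscale_P[OF PA_P[OF m]] unfolding PA_def by simp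
qed

lemma null_PA: "null_measure borel \<in> PA A"
  unfolding PA_def P_def conc_def by (auto simp: null_sets_def intro!: bexI[of _ "UNIV"])

lemma PC_null_open:
  assumes a: "a \<in> PC A" and U: "open U" "U \<inter> A = {}"
  shows "emeasure a U = 0"
proof -
  obtain u where u: "\<And>n. u n \<in> PA A" "conv u a" using PC_E[OF a] by blast
  have "emeasure (u n) U = 0" for n
  proof -
    note r = P_radon[OF PA_P[OF u(1)[of n]]]
    obtain B where B: "B \<in> sets borel" "B \<subseteq> A" "emeasure (u n) (- B) = 0"
      using conc_core[OF r] u(1)[of n] unfolding PA_def by blast
    have "U \<subseteq> - B" using B(2) U(2) by blast
    then show ?thesis using emeasure_mono[of U "- B" "u n"] B r by (auto simp: pos_radon_sets)
  qed
  moreover have "emeasure a U \<le> liminf (\<lambda>n. emeasure (u n) U)"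
    by (rule vague_lim_open[OF P_radon[OF PC_P[OF a]] P_radon[OF PA_P[OF u(1)]] conv_imp_vague_lim[OF PA_P[OF u(1)] PC_P[OF a] u(2)] U(1)])
  ultimately show ?thesis by (simp add: Liminf_const)
qed

text \<open>The complement of \<open>K\<close> is open and null along the approximating sequence,
  and masses of open sets are lower semicontinuous. Thus the cone of measures on a compact set is
  strongly closed.\<close>

lemma PC_compact: "compact K \<Longrightarrow> a \<in> PC K \<Longrightarrow> a \<in> PA K"
  using PC_null_open[of a K "- K"] conc_borel[OF P_radon compact_borel, of a K]
  by (auto simp: PA_def PC_P compact_imp_closed open_Compl)

end

section \<open>Balayage\<close>

locale balayage_space = perfect_space \<kappa> for \<kappa> :: "'a::{second_countable_topology, t2_space} kernel" +
  fixes h :: real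
  assumes domination: "domination_principle \<kappa>"
    and h: "1 \<le> h" and ugaheri: "ugaheri_principle h \<kappa>"
begin

lemma potential_of_pos_radon: "pos_radon m \<Longrightarrow> potential \<kappa> (of_pos_radon m) x = enn2ereal (pot m x)"
  unfolding potential_def pot_def by (simp add: zero_ennreal.rep_eq)

lemma dominate:
  assumes "\<eta> \<in> P" "pos_radon \<omega>" "AE x in \<eta>. pot \<eta> x \<le> pot \<omega> x"
  shows "pot \<eta> x \<le> pot \<omega> x"
proof -
  note r = P_radon[OF assms(1)]
  have "AE x in pos_var (of_pos_radon \<eta>). potential \<kappa> (of_pos_radon \<eta>) x \<le> potential \<kappa> (of_pos_radon \<omega>) x"
    using assms(3) unfolding pos_var_of_pos_radon[OF r]
    by (simp add: potential_of_pos_radon r assms(2) less_eq_ennreal.rep_eq)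
  then have "potential \<kappa> (of_pos_radon \<eta>) x \<le> potential \<kappa> (of_pos_radon \<omega>) x"
    using domination of_pos_radon_energy_cone[OF assms(1)] of_pos_radon_in_cone[OF assms(2)]
    unfolding domination_principle_def by blast
  then show ?thesis by (simp add: potential_of_pos_radon r assms(2) less_eq_ennreal.rep_eq)
qed

lemma maximum_principle:
  assumes "\<eta> \<in> P" "0 < c" "AE x in \<eta>. pot \<eta> x \<le> ennreal c"
  shows "pot \<eta> x \<le> ennreal (h * c)"
proof -
  note r = P_radon[OF assms(1)]
  have e: "enn2ereal y \<le> ereal d \<longleftrightarrow> y \<le> ennreal d" if "0 \<le> d" for y d
    using that by (simp add: less_eq_ennreal.rep_eq enn2ereal_ennreal)
  have "AE x in pos_var (of_pos_radon \<eta>). potential \<kappa> (of_pos_radon \<eta>) x \<le> ereal c"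
    using assms(2,3) unfolding pos_var_of_pos_radon[OF r] by (simp add: potential_of_pos_radon r e)
  then have "potential \<kappa> (of_pos_radon \<eta>) x \<le> ereal (h * c)"
    using ugaheri of_pos_radon_energy_cone[OF assms(1)] assms(2)
    unfolding ugaheri_principle_def by blast
  then show ?thesis using h assms(2) by (simp add: potential_of_pos_radon r e)
qed

text \<open>If the inequality failed on a set of positive mass, the restriction of
  \<open>\<nu>\<close> to a compact part of that set would reverse the comparison of energies
  strictly. Finiteness of the energy makes the strict inequality of integrals available.\<close>

lemma AE_pot_leI:
  assumes a: "pos_radon a" and b: "pos_radon b"
    and le: "\<And>K \<nu>. compact K \<Longrightarrow> K \<subseteq> A \<Longrightarrow> \<nu> \<in> PA K \<Longrightarrow> mut b \<nu> < \<infinity> \<and> mut b \<nu> \<le> mut a \<nu>"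
    and \<nu>: "\<nu> \<in> PA A"
  shows "AE x in \<nu>. pot b x \<le> pot a x"
proof (rule ccontr)
  assume nae: "\<not> (AE x in \<nu>. pot b x \<le> pot a x)"
  note r = P_radon[OF PA_P[OF \<nu>]]
  note ns = pos_radon_sets[OF r]
  have cA: "conc A \<nu>" using \<nu> by (simp add: PA_def)
  obtain B where B: "B \<in> sets borel" "B \<subseteq> A" "emeasure \<nu> (- B) = 0" using conc_core[OF r cA] by blast
  define N where "N = {x. pot a x < pot b x}"
  have Nb: "N \<in> sets borel"
    using borel_measurable_less[OF pot_borel[OF a] pot_borel[OF b]] unfolding N_def by (simp add: pred_def)
  have "emeasure \<nu> (N \<inter> B) \<noteq> 0"
  proof
    assume "emeasure \<nu> (N \<inter> B) = 0"
    then have "N \<inter> B \<in> null_sets \<nu>" "- B \<in> null_sets \<nu>" using Nb B ns by auto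
    from this[THEN AE_not_in] have "AE x in \<nu>. pot b x \<le> pot a x" by eventually_elim (auto simp: N_def not_less)
    then show False using nae by simp
  qed
  then obtain K where K: "compact K" "K \<subseteq> N \<inter> B" "emeasure \<nu> K \<noteq> 0"
    using radon_compact_subset_pos[OF r, of "N \<inter> B"] Nb B(1) by auto
  have Kb: "K \<in> sets borel" by (rule compact_borel[OF K(1)])
  define \<nu>' where "\<nu>' = rrestrict \<nu> K"
  have \<nu>': "\<nu>' \<in> PA K" unfolding \<nu>'_def by (rule rrestrict_PA[OF PA_P[OF \<nu>] Kb order_refl])
  note r' = P_radon[OF PA_P[OF \<nu>']]
  have KA: "K \<subseteq> A" using K(2) B(2) by auto
  have fin: "mut \<nu>' b < \<infinity>" "mut \<nu>' b \<le> mut \<nu>' a"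
    using le[OF K(1) KA \<nu>'] mut_sym[OF a r'] mut_sym[OF b r'] by auto
  have out: "emeasure \<nu>' (- K) = 0"
    unfolding \<nu>'_def using Kb ns by (subst emeasure_rrestrict) auto
  then have "- K \<in> null_sets \<nu>'" using Kb pos_radon_sets[OF r'] by auto
  then have aeK: "AE x in \<nu>'. x \<in> K" using AE_not_in by fastforce
  have lt: "AE x in \<nu>'. pot a x < pot b x" using aeK by eventually_elim (use K(2) N_def in auto)
  have "mut \<nu>' a < mut \<nu>' b"
    unfolding mut_def
  proof (rule nn_integral_less)
    show "pot a \<in> borel_measurable \<nu>'" "pot b \<in> borel_measurable \<nu>'"
      by (intro pot_measurable a b pos_radon_sets[OF r'])+
    show ae: "AE x in \<nu>'. pot a x \<le> pot b x" using lt by eventually_elim auto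
    have "mut \<nu>' a \<le> mut \<nu>' b" unfolding mut_def by (rule nn_integral_mono_AE[OF ae])
    then show "(\<integral>\<^sup>+x. pot a x \<partial>\<nu>') \<noteq> \<infinity>" using fin(1) unfolding mut_def by auto
    show "\<not> (AE x in \<nu>'. pot b x \<le> pot a x)"
    proof
      assume "AE x in \<nu>'. pot b x \<le> pot a x"
      then have "AE x in \<nu>'. False" using lt by eventually_elim auto
      then have "emeasure \<nu>' (space \<nu>') = 0" using AE_iff_measurable[of "space \<nu>'" \<nu>' "\<lambda>_. False"] by simp
      then have "emeasure \<nu>' K = 0" using emeasure_mono[of K "space \<nu>'" \<nu>'] pos_radon_space[OF r'] pos_radon_sets[OF r'] by auto
      moreover have "emeasure \<nu>' K = emeasure \<nu> K" unfolding \<nu>'_def using Kb ns by (subst emeasure_rrestrict) auto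
      ultimately show False using K(3) by simp
    qed
  qed
  then show False using fin(2) by simp
qed

text \<open>For measures of finite energy concentrated on \<open>A\<close>, equality almost
  everywhere amounts to equality of the potentials on \<open>A\<close> up to inner capacity zero,
  and it requires no measurability of \<open>A\<close>. The formulation also covers
  \<open>\<omega>\<close> of infinite energy.\<close>

definition bal :: "'a measure \<Rightarrow> 'a set \<Rightarrow> 'a measure \<Rightarrow> bool" where
  "bal \<omega> A \<eta> \<longleftrightarrow> \<eta> \<in> PC A \<and> (\<forall>\<nu>\<in>PA A. AE x in \<nu>. pot \<eta> x = pot \<omega> x) \<and> (\<forall>x. pot \<eta> x \<le> pot \<omega> x)"

lemma bal_PC: "bal \<omega> A \<eta> \<Longrightarrow> \<eta> \<in> PC A"
  and bal_P: "bal \<omega> A \<eta> \<Longrightarrow> \<eta> \<in> P"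
  and bal_AE: "bal \<omega> A \<eta> \<Longrightarrow> \<nu> \<in> PA A \<Longrightarrow> AE x in \<nu>. pot \<eta> x = pot \<omega> x"
  and bal_pot_le: "bal \<omega> A \<eta> \<Longrightarrow> pot \<eta> x \<le> pot \<omega> x"
  by (auto simp: bal_def PC_P)

lemma bal_mut:
  assumes b: "bal \<omega> A \<eta>" and \<omega>: "pos_radon \<omega>" and \<nu>: "\<nu> \<in> PA A"
  shows "mut \<eta> \<nu> = mut \<omega> \<nu>"
proof -
  have "mut \<nu> \<eta> = mut \<nu> \<omega>" unfolding mut_def by (rule nn_integral_cong_AE[OF bal_AE[OF b \<nu>]])
  then show ?thesis
    by (simp add: mut_sym[OF P_radon[OF bal_P[OF b]] P_radon[OF PA_P[OF \<nu>]]] mut_sym[OF \<omega> P_radon[OF PA_P[OF \<nu>]]])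
qed

lemma bal_en:
  assumes b: "bal \<sigma> A \<eta>" and \<sigma>: "\<sigma> \<in> P" and \<nu>: "\<nu> \<in> PC A"
  shows "en \<eta> \<nu> = en \<sigma> \<nu>"
proof (rule PC_eq[OF bal_P[OF b] \<sigma> _ \<nu>])
  fix \<nu> assume "\<nu> \<in> PA A"
  then show "en \<eta> \<nu> = en \<sigma> \<nu>" using bal_mut[OF b P_radon[OF \<sigma>]] by (simp add: en_def)
qed

text \<open>Equality on \<open>PA A\<close> extends to the closure, so both measures may be tested
  against themselves and each other, which gives distance zero.\<close>

lemma PC_eqI:
  assumes "\<eta> \<in> PC A" "\<zeta> \<in> PC A" "\<And>\<nu>. \<nu> \<in> PA A \<Longrightarrow> en \<eta> \<nu> = en \<zeta> \<nu>"
  shows "\<eta> = \<zeta>"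
proof (rule D_eq_0D)
  show P: "\<eta> \<in> P" "\<zeta> \<in> P" using assms PC_P by auto
  have e: "en \<eta> \<nu> = en \<zeta> \<nu>" if "\<nu> \<in> PC A" for \<nu> using PC_eq[OF P assms(3) that] by simp
  show "D \<eta> \<zeta> = 0" using e[OF assms(1)] e[OF assms(2)] en_commute[OF P] by (simp add: D_def)
qed

lemma bal_unique:
  assumes "bal \<omega> A \<eta>" "bal \<omega> A \<zeta>" and \<omega>: "pos_radon \<omega>"
  shows "\<eta> = \<zeta>"
  by (rule PC_eqI[OF bal_PC[OF assms(1)] bal_PC[OF assms(2)]])
    (simp add: en_def bal_mut[OF assms(1) \<omega>] bal_mut[OF assms(2) \<omega>])

lemma bal_compact_PA: "compact K \<Longrightarrow> bal \<omega> K \<eta> \<Longrightarrow> \<eta> \<in> PA K"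
  by (rule PC_compact[OF _ bal_PC])

text \<open>The measure swept onto a compact set is carried by that set, so the two potentials agree
  almost everywhere with respect to it and the domination principle applies.\<close>

lemma bal_pot_mono:
  assumes b: "bal \<omega> K \<eta>" "bal \<omega> A \<zeta>" and K: "compact K" "K \<subseteq> A"
  shows "pot \<eta> x \<le> pot \<zeta> x"
proof (rule dominate[OF bal_P[OF b(1)] P_radon[OF bal_P[OF b(2)]]])
  have \<eta>: "\<eta> \<in> PA K" by (rule bal_compact_PA[OF K(1) b(1)])
  from bal_AE[OF b(1) \<eta>] bal_AE[OF b(2) PA_mono[OF \<eta> K(2)]]
  show "AE x in \<eta>. pot \<eta> x \<le> pot \<zeta> x" by eventually_elim auto
qed

text \<open>Projection with \<open>L = en \<omega>\<close>. The variational inequality gives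
  \<open>pot \<omega> x \<le> pot \<eta> x\<close> almost everywhere for measures on
  \<open>K\<close>; the equality of \<open>en \<eta> \<eta>\<close> and
  \<open>en \<omega> \<eta>\<close> excludes strictness with respect to \<open>\<eta>\<close>
  itself.\<close>

lemma bal_compact_exists:
  assumes K: "compact K" and \<omega>: "pos_radon \<omega>" and fin: "\<And>\<nu>. \<nu> \<in> PA K \<Longrightarrow> mut \<omega> \<nu> < \<infinity>"
    and bdd: "\<And>\<nu>. \<nu> \<in> PA K \<Longrightarrow> B \<le> en \<nu> \<nu> - 2 * en \<omega> \<nu>"
    and cont: "\<And>u a. (\<And>n. u n \<in> PA K) \<Longrightarrow> a \<in> PA K \<Longrightarrow> conv u a \<Longrightarrow> (\<lambda>n. en \<omega> (u n)) \<longlonglongrightarrow> en \<omega> a"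
  shows "\<exists>\<eta>. bal \<omega> K \<eta>"
proof -
  have ee: "mut \<omega> \<nu> = ennreal (en \<omega> \<nu>)" if "\<nu> \<in> PA K" for \<nu> using fin[OF that] by (simp add: en_def)
  have "\<exists>\<eta>\<in>PA K. (\<forall>\<nu>\<in>PA K. en \<omega> \<nu> \<le> en \<eta> \<nu>) \<and> en \<eta> \<eta> = en \<omega> \<eta>"
  proof (rule projection_exists[where B=B])
    show "PA K \<subseteq> P" using PA_P by blast
    show "PA K \<noteq> {}" using null_PA by blast
    show "a \<in> PA K" if "\<And>n. u n \<in> PA K" "a \<in> P" "conv u a" for u a
      by (rule PC_compact[OF K PC_closed[OF PA_subset_PC[OF that(1)] that(2,3)]])
    show "en \<omega> (radd a b) = en \<omega> a + en \<omega> b" if "a \<in> PA K" "b \<in> PA K" for a b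
    proof -
      have "ennreal (en \<omega> (radd a b)) = ennreal (en \<omega> a) + ennreal (en \<omega> b)"
        using mut_radd_right[OF P_radon[OF PA_P[OF that(1)]] P_radon[OF PA_P[OF that(2)]] \<omega>]
          ee[OF PA_radd[OF that]] ee[OF that(1)] ee[OF that(2)] by metis
      also have "\<dots> = ennreal (en \<omega> a + en \<omega> b)" by (simp add: en_nn)
      finally show ?thesis by (simp add: en_nn del: ennreal_plus)
    qed
    show "en \<omega> (rscale t a) = t * en \<omega> a" if "0 \<le> t" "a \<in> PA K" for t a
    proof -
      have "ennreal (en \<omega> (rscale t a)) = ennreal t * ennreal (en \<omega> a)"
        using mut_rscale_right[OF P_radon[OF PA_P[OF that(2)]] \<omega>, of t] ee[OF PA_rscale[OF that(2)], of t] ee[OF that(2)] by metis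
      also have "\<dots> = ennreal (t * en \<omega> a)" using that by (simp add: ennreal_mult en_nn)
      finally show ?thesis using that by (simp add: en_nn)
    qed
  qed (use bdd cont in \<open>auto intro: PA_radd PA_rscale\<close>)
  then obtain \<eta> where \<eta>: "\<eta> \<in> PA K" "\<And>\<nu>. \<nu> \<in> PA K \<Longrightarrow> en \<omega> \<nu> \<le> en \<eta> \<nu>" "en \<eta> \<eta> = en \<omega> \<eta>" by blast
  note \<eta>P = PA_P[OF \<eta>(1)]
  note \<eta>r = P_radon[OF \<eta>P]
  have ae: "AE x in \<nu>. pot \<omega> x \<le> pot \<eta> x" if "\<nu> \<in> PA K" for \<nu>
  proof (rule AE_pot_leI[OF \<eta>r \<omega> _ that])
    fix L \<nu> assume "compact L" "L \<subseteq> K" "\<nu> \<in> PA L"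
    then have \<nu>: "\<nu> \<in> PA K" using PA_mono by blast
    show "mut \<omega> \<nu> < \<infinity> \<and> mut \<omega> \<nu> \<le> mut \<eta> \<nu>"
      using fin[OF \<nu>] \<eta>(2)[OF \<nu>] by (simp add: ee[OF \<nu>] mut_en[OF \<eta>P PA_P[OF \<nu>]] ennreal_leI)
  qed
  have "AE x in \<eta>. pot \<eta> x \<le> pot \<omega> x"
  proof (rule ccontr)
    assume n: "\<not> (AE x in \<eta>. pot \<eta> x \<le> pot \<omega> x)"
    have "mut \<eta> \<omega> < mut \<eta> \<eta>"
      unfolding mut_def
    proof (rule nn_integral_less[OF _ _ _ ae[OF \<eta>(1)] n])
      show "pot \<omega> \<in> borel_measurable \<eta>" "pot \<eta> \<in> borel_measurable \<eta>"
        by (intro pot_measurable \<omega> \<eta>r pos_radon_sets[OF \<eta>r])+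
      show "(\<integral>\<^sup>+x. pot \<omega> x \<partial>\<eta>) \<noteq> \<infinity>"
        using fin[OF \<eta>(1)] mut_sym[OF \<omega> \<eta>r] unfolding mut_def by auto
    qed
    then show False using mut_sym[OF \<omega> \<eta>r] ee[OF \<eta>(1)] mut_en[OF \<eta>P \<eta>P] \<eta>(3) by simp
  qed
  then have le: "pot \<eta> x \<le> pot \<omega> x" for x by (rule dominate[OF \<eta>P \<omega>])
  have "AE x in \<nu>. pot \<eta> x = pot \<omega> x" if "\<nu> \<in> PA K" for \<nu>
    using ae[OF that] by eventually_elim (use le in \<open>auto intro: antisym\<close>)
  then show ?thesis using le PA_subset_PC[OF \<eta>(1)] unfolding bal_def by blast
qed

lemma bal_compact_energy:
  assumes K: "compact K" and \<sigma>: "\<sigma> \<in> P"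
  shows "\<exists>\<eta>. bal \<sigma> K \<eta>"
proof (rule bal_compact_exists[OF K P_radon[OF \<sigma>]])
  show "mut \<sigma> \<nu> < \<infinity>" if "\<nu> \<in> PA K" for \<nu> by (rule mut_finite[OF \<sigma> PA_P[OF that]])
  \<comment> \<open>The functional is the squared distance to \<open>\<sigma>\<close> minus the
    constant \<open>en \<sigma> \<sigma>\<close>.\<close>
  show "- en \<sigma> \<sigma> \<le> en \<nu> \<nu> - 2 * en \<sigma> \<nu>" if "\<nu> \<in> PA K" for \<nu>
    using D_nonneg[OF \<sigma> PA_P[OF that]] unfolding D_def by simp
  show "(\<lambda>n. en \<sigma> (u n)) \<longlonglongrightarrow> en \<sigma> a" if "\<And>n. u n \<in> PA K" "a \<in> PA K" "conv u a" for u a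
    using conv_en[OF PA_P[OF that(1)] PA_P[OF that(2)] that(3) \<sigma>]
    by (simp add: en_commute[OF \<sigma> PA_P[OF that(1)]] en_commute[OF \<sigma> PA_P[OF that(2)]])
qed

lemma bal_energy_le:
  assumes b: "bal \<sigma> A \<eta>" and \<sigma>: "\<sigma> \<in> P"
  shows "en \<eta> \<eta> \<le> en \<sigma> \<sigma>"
proof -
  note P = bal_P[OF b]
  have "mut \<eta> \<eta> \<le> mut \<eta> \<sigma>" by (rule mut_mono_pot) (rule bal_pot_le[OF b])
  also have "\<dots> = mut \<sigma> \<eta>" by (rule mut_sym[OF P_radon[OF P] P_radon[OF \<sigma>]])
  also have "\<dots> \<le> mut \<sigma> \<sigma>" by (rule mut_mono_pot) (rule bal_pot_le[OF b])
  finally show ?thesis by (simp add: mut_en P \<sigma> en_nn)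
qed

lemma AE_PA_compact:
  assumes "compact K" "\<nu> \<in> PA K"
  shows "AE x in \<nu>. x \<in> K"
proof -
  note r = P_radon[OF PA_P[OF assms(2)]]
  have "emeasure \<nu> (- K) = 0" using assms conc_borel[OF r compact_borel[OF assms(1)]] by (simp add: PA_def)
  then have "- K \<in> null_sets \<nu>" using compact_borel[OF assms(1)] pos_radon_sets[OF r] by auto
  then show ?thesis using AE_not_in by fastforce
qed

text \<open>Compact sets have finite capacity, since measures of vanishing energy converge vaguely to zero.\<close>

lemma mass_le_energy:
  assumes K: "compact K"
  shows "\<exists>C\<ge>0. \<forall>\<nu>\<in>PA K. measure \<nu> K \<le> C * sqrt (en \<nu> \<nu>)"
proof (rule ccontr)
  assume "\<not> ?thesis"
  then have "\<exists>\<nu>\<in>PA K. real (Suc n) * sqrt (en \<nu> \<nu>) < measure \<nu> K" for n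
    by (metis not_le of_nat_0_le_iff)
  then obtain \<nu> where \<nu>: "\<And>n. \<nu> n \<in> PA K" "\<And>n. real (Suc n) * sqrt (en (\<nu> n) (\<nu> n)) < measure (\<nu> n) K" by metis
  note \<nu>P = PA_P[OF \<nu>(1)]
  define m where "m n = measure (\<nu> n) K" for n
  have e0: "0 \<le> en (\<nu> n) (\<nu> n)" for n by (rule en_nn)
  have m: "0 < m n" for n
  proof -
    have "0 \<le> real (Suc n) * sqrt (en (\<nu> n) (\<nu> n))" using e0 by (intro mult_nonneg_nonneg) auto
    then show ?thesis using \<nu>(2)[of n] unfolding m_def by linarith
  qed
  \<comment> \<open>Normalized to mass 1, the measures have norm at most 1 / (n + 1) and so tend
    vaguely to zero; a function of \<open>C0\<close> equal to 1 on \<open>K\<close> contradicts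
    this.\<close>
  define \<mu> where "\<mu> n = rscale (1 / m n) (\<nu> n)" for n
  have \<mu>: "\<mu> n \<in> PA K" for n unfolding \<mu>_def by (rule PA_rscale[OF \<nu>(1)])
  have null: "null_measure borel \<in> P" by (rule PA_P[OF null_PA])
  have D\<mu>: "D (\<mu> n) (null_measure borel) \<le> (1 / real (Suc n))\<^sup>2" for n
  proof -
    have "D (\<mu> n) (null_measure borel) = (1 / m n) * ((1 / m n) * en (\<nu> n) (\<nu> n))"
      unfolding D_def \<mu>_def using m[of n] \<nu>P[of n] by (simp add: en_simps en_def[of _ "null_measure borel"] en_def[of "null_measure borel"])
    also have "\<dots> = (sqrt (en (\<nu> n) (\<nu> n)) / m n)\<^sup>2" using e0[of n] by (simp add: power2_eq_square)
    also have "\<dots> \<le> (1 / real (Suc n))\<^sup>2"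
    proof (rule power_mono)
      show "sqrt (en (\<nu> n) (\<nu> n)) / m n \<le> 1 / real (Suc n)"
        using \<nu>(2)[of n] m[of n] unfolding m_def by (simp add: field_simps)
      show "0 \<le> sqrt (en (\<nu> n) (\<nu> n)) / m n" using e0[of n] m[of n] by simp
    qed
    finally show ?thesis .
  qed
  have "(\<lambda>n. (1 / real (Suc n))\<^sup>2) \<longlonglongrightarrow> 0\<^sup>2" by (intro tendsto_power LIMSEQ_Suc[OF lim_1_over_n])
  then have lim: "(\<lambda>n. (1 / real (Suc n))\<^sup>2) \<longlonglongrightarrow> 0" by simp
  have "conv \<mu> (null_measure borel)"
    unfolding conv_def
    by (rule tendsto_sandwich[OF _ _ tendsto_const lim])
      (auto intro!: always_eventually D_nonneg PA_P[OF \<mu>] null D\<mu> simp del: of_nat_Suc)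
  then have v: "vague_lim \<mu> (null_measure borel)" by (rule conv_imp_vague_lim[OF PA_P[OF \<mu>] null])
  obtain \<phi> where \<phi>: "\<phi> \<in> C0" "\<And>x. x \<in> K \<Longrightarrow> \<phi> x = 1"
    using C0_extension[OF K, of "\<lambda>_. 1"] continuous_on_const by metis
  have "(\<integral>x. \<phi> x \<partial>\<mu> n) = 1" for n
  proof -
    note r = P_radon[OF PA_P[OF \<mu>[of n]]]
    note rn = P_radon[OF \<nu>P[of n]]
    have aeK: "AE x in \<mu> n. x \<in> K" by (rule AE_PA_compact[OF K \<mu>])
    have Kb: "K \<in> sets (\<mu> n)" using compact_borel[OF K] pos_radon_sets[OF r] by simp
    have "(\<integral>x. \<phi> x \<partial>\<mu> n) = (\<integral>x. indicator K x \<partial>\<mu> n)"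
    proof (rule integral_cong_AE)
      show "\<phi> \<in> borel_measurable (\<mu> n)" using C0_integrable[OF r \<phi>(1)] by (rule borel_measurable_integrable)
      show "AE x in \<mu> n. \<phi> x = indicator K x" using aeK by eventually_elim (simp add: \<phi>(2))
    qed (use Kb in simp)
    also have "\<dots> = measure (\<mu> n) K" using Kb pos_radon_space[OF r] by simp
    also have "\<dots> = 1"
      using m[of n] unfolding \<mu>_def measure_def emeasure_rscale m_def by (simp add: enn2real_mult)
    finally show ?thesis .
  qed
  then have "(\<lambda>n. 1 :: real) \<longlonglongrightarrow> 0" using v \<phi>(1) unfolding vague_lim_def by fastforce
  then show False by (simp add: LIMSEQ_const_iff)
qed

text \<open>The energy of \<open>\<omega>\<close> may be infinite, so Cauchy-Schwarz says nothing
  about \<open>en \<omega>\<close>. On \<open>K\<close>, however, the potential extends to a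
  function of \<open>C0\<close>, and integrating it is vaguely, hence strongly, continuous.\<close>

lemma bal_compact_continuous:
  assumes K: "compact K" and \<omega>: "pos_radon \<omega>" and f: "continuous_on K f" "\<And>x. x \<in> K \<Longrightarrow> pot \<omega> x = ennreal (f x)" "\<And>x. x \<in> K \<Longrightarrow> 0 \<le> f x"
  shows "\<exists>\<eta>. bal \<omega> K \<eta>"
proof -
  obtain \<phi> where \<phi>: "\<phi> \<in> C0" "\<And>x. x \<in> K \<Longrightarrow> \<phi> x = f x" using C0_extension[OF K f(1)] by metis
  have "bounded (f ` K)" by (intro compact_imp_bounded compact_continuous_image f K)
  then obtain b where b: "\<And>x. x \<in> K \<Longrightarrow> norm (f x) \<le> b" unfolding bounded_iff by auto
  define c where "c = max 0 b"
  have c: "0 \<le> c" "f x \<le> c" if "x \<in> K" for x using b[OF that] unfolding c_def by auto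
  have c0: "0 \<le> c" unfolding c_def by simp
  obtain C where C: "0 \<le> C" "\<And>\<nu>. \<nu> \<in> PA K \<Longrightarrow> measure \<nu> K \<le> C * sqrt (en \<nu> \<nu>)" using mass_le_energy[OF K] by blast
  have mutphi: "mut \<omega> \<nu> = ennreal (\<integral>x. \<phi> x \<partial>\<nu>) \<and> 0 \<le> (\<integral>x. \<phi> x \<partial>\<nu>) \<and> (\<integral>x. \<phi> x \<partial>\<nu>) \<le> c * measure \<nu> K" if \<nu>: "\<nu> \<in> PA K" for \<nu>
  proof -
    note r = P_radon[OF PA_P[OF \<nu>]]
    have aeK: "AE x in \<nu>. x \<in> K" by (rule AE_PA_compact[OF K \<nu>])
    have Kb: "K \<in> sets \<nu>" using compact_borel[OF K] pos_radon_sets[OF r] by simp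
    have ae: "AE x in \<nu>. pot \<omega> x = ennreal (\<phi> x)" using aeK by eventually_elim (simp add: f \<phi>)
    have ae0: "AE x in \<nu>. 0 \<le> \<phi> x" using aeK by eventually_elim (simp add: f \<phi>)
    have "mut \<omega> \<nu> = mut \<nu> \<omega>" by (rule mut_sym[OF \<omega> r])
    also have "\<dots> = (\<integral>\<^sup>+x. ennreal (\<phi> x) \<partial>\<nu>)" unfolding mut_def by (rule nn_integral_cong_AE[OF ae])
    also have "\<dots> = ennreal (\<integral>x. \<phi> x \<partial>\<nu>)" by (rule nn_integral_eq_integral[OF C0_integrable[OF r \<phi>(1)] ae0])
    finally have 1: "mut \<omega> \<nu> = ennreal (\<integral>x. \<phi> x \<partial>\<nu>)" .
    have 2: "0 \<le> (\<integral>x. \<phi> x \<partial>\<nu>)" by (rule integral_nonneg_AE[OF ae0])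
    have i: "integrable \<nu> (\<lambda>x. c * indicator K x)"
      using Kb pos_radon_finite[OF r K] by (intro integrable_mult_right) (simp add: integrable_indicator_iff)
    have "(\<integral>x. \<phi> x \<partial>\<nu>) \<le> (\<integral>x. c * indicator K x \<partial>\<nu>)"
      by (rule integral_mono_AE[OF C0_integrable[OF r \<phi>(1)] i]) (use aeK in eventually_elim, use c \<phi> in auto)
    also have "\<dots> = c * measure \<nu> K" using Kb pos_radon_space[OF r] by simp
    finally show ?thesis using 1 2 by simp
  qed
  have en: "en \<omega> \<nu> = (\<integral>x. \<phi> x \<partial>\<nu>)" if "\<nu> \<in> PA K" for \<nu> using mutphi[OF that] by (simp add: en_def)
  show ?thesis
  proof (rule bal_compact_exists[OF K \<omega>])
    show "mut \<omega> \<nu> < \<infinity>" if "\<nu> \<in> PA K" for \<nu> using mutphi[OF that] by simp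
    \<comment> \<open>The linear term is at most \<open>c * C\<close> times the norm by
      \<open>mass_le_energy\<close>; completing the square gives the bound.\<close>
    show "- (c * C)\<^sup>2 \<le> en \<nu> \<nu> - 2 * en \<omega> \<nu>" if \<nu>: "\<nu> \<in> PA K" for \<nu>
    proof -
      define s where "s = sqrt (en \<nu> \<nu>)"
      have s: "s\<^sup>2 = en \<nu> \<nu>" unfolding s_def by (simp add: en_nn)
      have "en \<omega> \<nu> \<le> c * measure \<nu> K" using mutphi[OF \<nu>] en[OF \<nu>] by simp
      also have "\<dots> \<le> c * (C * s)" using C(2)[OF \<nu>] c0 unfolding s_def by (intro mult_left_mono)
      finally have "en \<omega> \<nu> \<le> (c * C) * s" by (simp add: mult.assoc)
      moreover have "0 \<le> (s - c * C)\<^sup>2" by simp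
      ultimately show ?thesis unfolding s[symmetric] by (simp add: power2_diff algebra_simps)
    qed
    show "(\<lambda>n. en \<omega> (u n)) \<longlonglongrightarrow> en \<omega> a" if u: "\<And>n. u n \<in> PA K" "a \<in> PA K" "conv u a" for u a
      using conv_imp_vague_lim[OF PA_P[OF u(1)] PA_P[OF u(2)] u(3)] \<phi>(1)
      unfolding en[OF u(1)] en[OF u(2)] vague_lim_def by blast
  qed
qed

text \<open>Pythagoras: since \<open>\<eta>\<close> lives on \<open>K\<close>, both swept measures
  have the same mutual energy with it.\<close>

lemma bal_D:
  assumes b: "bal \<omega> K \<eta>" "bal \<omega> K' \<eta>'" and K: "compact K" "K \<subseteq> K'" and \<omega>: "pos_radon \<omega>"
  shows "D \<eta>' \<eta> = en \<eta>' \<eta>' - en \<eta> \<eta>"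
proof -
  have \<eta>: "\<eta> \<in> PA K" by (rule bal_compact_PA[OF K(1) b(1)])
  have "mut \<eta>' \<eta> = mut \<eta> \<eta>"
    using bal_mut[OF b(1) \<omega> \<eta>] bal_mut[OF b(2) \<omega> PA_mono[OF \<eta> K(2)]] by simp
  then show ?thesis unfolding D_def by (simp add: en_def)
qed

text \<open>An arbitrary set need not be exhausted by a sequence of compact subsets. The sequence is
  chosen instead so that the swept energies approach their supremum, which by Pythagoras makes the
  swept measures a Cauchy sequence.\<close>

lemma bal_limit:
  assumes \<omega>: "pos_radon \<omega>" and ex: "\<And>K. compact K \<Longrightarrow> K \<subseteq> A \<Longrightarrow> \<exists>\<eta>. bal \<omega> K \<eta> \<and> en \<eta> \<eta> \<le> M"
  shows "\<exists>\<eta> Ks \<eta>s. bal \<omega> A \<eta> \<and> (\<forall>n. compact (Ks n) \<and> Ks n \<subseteq> A \<and> bal \<omega> (Ks n) (\<eta>s n)) \<and> conv \<eta>s \<eta>"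
proof -
  define \<K> where "\<K> = {K. compact K \<and> K \<subseteq> A}"
  obtain H where H: "\<And>K. K \<in> \<K> \<Longrightarrow> bal \<omega> K (H K) \<and> en (H K) (H K) \<le> M"
    using ex unfolding \<K>_def by (metis mem_Collect_eq)
  have HP: "H K \<in> P" if "K \<in> \<K>" for K using H[OF that] bal_P by blast
  have HA: "H K \<in> PA A" if "K \<in> \<K>" for K
    using bal_compact_PA[of K \<omega> "H K"] H[OF that] that PA_mono unfolding \<K>_def by blast
  have HD: "D (H K') (H K) = en (H K') (H K') - en (H K) (H K)" if "K \<in> \<K>" "K' \<in> \<K>" "K \<subseteq> K'" for K K'
    using bal_D[of \<omega> K "H K" K' "H K'"] H that \<omega> unfolding \<K>_def by blast
  define E where "E K = en (H K) (H K)" for K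
  have Emono: "E K \<le> E K'" if "K \<in> \<K>" "K' \<in> \<K>" "K \<subseteq> K'" for K K'
    using HD[OF that] D_nonneg[OF HP[OF that(2)] HP[OF that(1)]] unfolding E_def by simp
  define S where "S = Sup (E ` \<K>)"
  have ne: "{} \<in> \<K>" unfolding \<K>_def by simp
  have bdd: "bdd_above (E ` \<K>)" using H unfolding E_def by (intro bdd_aboveI2[of _ _ M]) blast
  have ES: "E K \<le> S" if "K \<in> \<K>" for K unfolding S_def using bdd that by (intro cSup_upper) auto
  have "\<exists>K\<in>\<K>. S - 1 / Suc n < E K" for n
  proof -
    have "S - 1 / Suc n < S" by simp
    then show ?thesis unfolding S_def using less_cSup_iff[of "E ` \<K>"] bdd ne by blast
  qed
  then obtain K0 where K0: "\<And>n. K0 n \<in> \<K>" "\<And>n. S - 1 / Suc n < E (K0 n)" by metis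
  define Ks where "Ks n = (\<Union>i\<le>n. K0 i)" for n
  have Ks: "Ks n \<in> \<K>" for n using K0(1) unfolding Ks_def \<K>_def by (auto intro!: compact_UN)
  have KE: "S - 1 / Suc n < E (Ks n)" for n
    using K0(2)[of n] Emono[OF K0(1)[of n] Ks[of n]] unfolding Ks_def by fastforce
  have Kmono: "Ks n \<subseteq> Ks m" if "n \<le> m" for m n unfolding Ks_def using that by (intro UN_mono) auto
  have lim0: "(\<lambda>n. 1 / real (Suc n)) \<longlonglongrightarrow> 0" by (rule LIMSEQ_Suc[OF lim_1_over_n])
  have "\<exists>\<eta>\<in>P. conv (\<lambda>n. H (Ks n)) \<eta>"
  proof (rule conv_exists[OF HP[OF Ks] lim0])
    fix m n :: nat assume "n \<le> m"
    then show "D (H (Ks m)) (H (Ks n)) \<le> 1 / real (Suc n)"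
      using HD[OF Ks Ks Kmono] ES[OF Ks[of m]] KE[of n] unfolding E_def by fastforce
  qed
  then obtain \<eta> where \<eta>: "\<eta> \<in> P" "conv (\<lambda>n. H (Ks n)) \<eta>" by blast
  have \<eta>C: "\<eta> \<in> PC A" by (rule PC_closed[OF PA_subset_PC[OF HA[OF Ks]] \<eta>])
  have eq: "mut \<eta> \<nu> = mut \<omega> \<nu> \<and> mut \<omega> \<nu> < \<infinity>" if K: "compact K" "K \<subseteq> A" and \<nu>: "\<nu> \<in> PA K" for K \<nu>
  proof -
    have UK: "Ks n \<union> K \<in> \<K>" for n using Ks[of n] K unfolding \<K>_def by auto
    \<comment> \<open>Joining \<open>K\<close> to \<open>Ks n\<close> raises the energy by less than
      1 / (n + 1), so the limit is still \<open>\<eta>\<close>, while the relation to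
      \<open>\<omega>\<close> on \<open>K\<close> now holds at every stage.\<close>
    have "norm (D (H (Ks n \<union> K)) (H (Ks n))) \<le> 1 / real (Suc n)" for n
      using HD[OF Ks UK, of n n] ES[OF UK[of n]] KE[of n] D_nonneg[OF HP[OF UK[of n]] HP[OF Ks[of n]]] unfolding E_def by fastforce
    then have "(\<lambda>n. D (H (Ks n \<union> K)) (H (Ks n))) \<longlonglongrightarrow> 0"
      by (intro Lim_null_comparison[OF _ lim0] always_eventually) auto
    then have "conv (\<lambda>n. H (Ks n \<union> K)) \<eta>" by (rule conv_eqI[OF \<eta>(2) HP[OF Ks] HP[OF UK] \<eta>(1)])
    then have l: "(\<lambda>n. en (H (Ks n \<union> K)) \<nu>) \<longlonglongrightarrow> en \<eta> \<nu>" by (rule conv_en[OF HP[OF UK] \<eta>(1) _ PA_P[OF \<nu>]])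
    have c: "mut (H (Ks n \<union> K)) \<nu> = mut \<omega> \<nu>" for n
      using bal_mut[of \<omega> "Ks n \<union> K" "H (Ks n \<union> K)" \<nu>] H[OF UK[of n]] \<omega> PA_mono[OF \<nu>, of "Ks n \<union> K"] by auto
    have "en (H (Ks n \<union> K)) \<nu> = en \<omega> \<nu>" for n unfolding en_def c ..
    then have e: "en \<eta> \<nu> = en \<omega> \<nu>" using l by (simp add: LIMSEQ_const_iff)
    have f: "mut \<omega> \<nu> < \<infinity>" using c[of 0] mut_finite[OF HP[OF UK[of 0]] PA_P[OF \<nu>]] by simp
    have "mut \<eta> \<nu> = ennreal (en \<eta> \<nu>)" by (rule mut_en[OF \<eta>(1) PA_P[OF \<nu>]])
    also have "\<dots> = mut \<omega> \<nu>" using e f by (simp add: en_def)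
    finally show ?thesis using f by simp
  qed
  have ae: "AE x in \<nu>. pot \<eta> x = pot \<omega> x" if \<nu>: "\<nu> \<in> PA A" for \<nu>
  proof -
    have "AE x in \<nu>. pot \<eta> x \<le> pot \<omega> x"
      by (rule AE_pot_leI[OF \<omega> P_radon[OF \<eta>(1)] _ \<nu>]) (drule (2) eq, simp)
    moreover have "AE x in \<nu>. pot \<omega> x \<le> pot \<eta> x"
      by (rule AE_pot_leI[OF P_radon[OF \<eta>(1)] \<omega> _ \<nu>]) (drule (2) eq, simp)
    ultimately show ?thesis by eventually_elim auto
  qed
  have "pot \<eta> x \<le> pot \<omega> x" for x
  proof -
    have "pot \<eta> x \<le> liminf (\<lambda>n. pot (H (Ks n)) x)"
      by (rule conv_pot_liminf[OF HP[OF Ks] \<eta>])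
    also have "\<dots> \<le> liminf (\<lambda>n :: nat. pot \<omega> x)"
      using H[OF Ks] bal_pot_le by (intro Liminf_mono always_eventually allI) blast
    finally show ?thesis by (simp add: Liminf_const)
  qed
  then have "bal \<omega> A \<eta>" using \<eta>C ae unfolding bal_def by blast
  then show ?thesis using Ks H \<eta>(2) unfolding \<K>_def by (intro exI[of _ \<eta>] exI[of _ Ks] exI[of _ "\<lambda>n. H (Ks n)"]) auto
qed

lemma bal_limit_energy:
  assumes \<sigma>: "\<sigma> \<in> P"
  shows "\<exists>\<eta> Ks \<eta>s. bal \<sigma> A \<eta> \<and> (\<forall>n. compact (Ks n) \<and> Ks n \<subseteq> A \<and> bal \<sigma> (Ks n) (\<eta>s n)) \<and> conv \<eta>s \<eta>"
  using bal_limit[OF P_radon[OF \<sigma>], of A "en \<sigma> \<sigma>"] bal_compact_energy[OF _ \<sigma>] bal_energy_le[OF _ \<sigma>] by blast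

lemma bal_bounded_exists:
  assumes \<omega>: "pos_radon \<omega>" "emeasure \<omega> UNIV < \<infinity>" and c: "0 < c" "\<And>x. x \<in> A \<Longrightarrow> pot \<omega> x \<le> ennreal c"
    and cont: "\<And>K. compact K \<Longrightarrow> K \<subseteq> A \<Longrightarrow> continuous_on K (\<lambda>x. enn2real (pot \<omega> x))"
  shows "\<exists>\<eta>. bal \<omega> A \<eta>"
proof -
  \<comment> \<open>On \<open>K\<close> the potential of the swept measure is at most
    \<open>c\<close>, hence at most \<open>h * c\<close> everywhere; integrating this against
    \<open>\<omega>\<close> bounds the energy.\<close>
  define M where "M = h * c * measure \<omega> UNIV"
  have "\<exists>\<eta>. bal \<omega> K \<eta> \<and> en \<eta> \<eta> \<le> M" if K: "compact K" "K \<subseteq> A" for K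
  proof -
    have "pot \<omega> x = ennreal (enn2real (pot \<omega> x))" if "x \<in> K" for x
      using c(2)[of x] K(2) that by (intro ennreal_enn2real[symmetric]) (auto simp: le_less_trans[OF _ ennreal_less_top])
    then obtain \<eta> where \<eta>: "bal \<omega> K \<eta>"
      using bal_compact_continuous[OF K(1) \<omega>(1) cont[OF K]] by auto
    note \<eta>P = bal_P[OF \<eta>]
    have "AE x in \<eta>. pot \<eta> x \<le> ennreal c"
      using AE_PA_compact[OF K(1) bal_compact_PA[OF K(1) \<eta>]]
    proof eventually_elim
      case (elim x)
      then show ?case using bal_pot_le[OF \<eta>, of x] c(2)[of x] K(2) by (meson order_trans subsetD)
    qed
    then have hc: "pot \<eta> x \<le> ennreal (h * c)" for x by (rule maximum_principle[OF \<eta>P c(1)])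
    have "mut \<eta> \<eta> \<le> mut \<eta> \<omega>" by (rule mut_mono_pot) (rule bal_pot_le[OF \<eta>])
    also have "\<dots> = mut \<omega> \<eta>" by (rule mut_sym[OF P_radon[OF \<eta>P] \<omega>(1)])
    also have "\<dots> \<le> (\<integral>\<^sup>+x. ennreal (h * c) \<partial>\<omega>)" unfolding mut_def by (intro nn_integral_mono hc)
    also have "\<dots> = ennreal (h * c) * emeasure \<omega> UNIV" by (simp add: pos_radon_space[OF \<omega>(1)])
    also have "\<dots> = ennreal (h * c) * ennreal (measure \<omega> UNIV)" using \<omega>(2) by (simp add: emeasure_eq_ennreal_measure)
    also have "\<dots> = ennreal M" unfolding M_def using h c(1) by (simp add: ennreal_mult)
    finally have "en \<eta> \<eta> \<le> M" using h c(1) by (simp add: mut_en[OF \<eta>P \<eta>P] M_def)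
    then show ?thesis using \<eta> by blast
  qed
  then show ?thesis using bal_limit[OF \<omega>(1), of A M] by blast
qed

text \<open>The measure \<open>\<sigma>'\<close> is approximated by measures on compact subsets of
  \<open>A\<close>, for which the relation between \<open>\<eta>\<close> and \<open>\<omega>\<close>
  applies. Lower semicontinuity bounds \<open>mut \<omega> \<sigma>'\<close> from above,
  monotonicity of the swept potentials bounds it from below.\<close>

lemma bal_reciprocity:
  assumes \<omega>: "pos_radon \<omega>" and \<eta>: "bal \<omega> A \<eta>" and \<sigma>: "\<sigma> \<in> P" and \<sigma>': "bal \<sigma> A \<sigma>'"
  shows "mut \<sigma>' \<omega> = mut \<eta> \<sigma>"
proof -
  obtain \<tau> Ks s where \<tau>: "bal \<sigma> A \<tau>" and s: "\<And>n. compact (Ks n)" "\<And>n. Ks n \<subseteq> A" "\<And>n. bal \<sigma> (Ks n) (s n)" "conv s \<tau>"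
    using bal_limit_energy[OF \<sigma>, of A] by metis
  have eq: "\<tau> = \<sigma>'" by (rule bal_unique[OF \<tau> \<sigma>' P_radon[OF \<sigma>]])
  note \<eta>P = bal_P[OF \<eta>] and \<sigma>'P = bal_P[OF \<sigma>']
  note sP = bal_P[OF s(3)]
  have sA: "s n \<in> PA A" for n using PA_mono[OF bal_compact_PA[OF s(1) s(3)] s(2)] .
  have cv: "conv s \<sigma>'" using s(4) eq by simp
  have "(\<lambda>n. en (s n) \<eta>) \<longlonglongrightarrow> en \<sigma>' \<eta>" by (rule conv_en[OF sP \<sigma>'P cv \<eta>P])
  moreover have "mut \<omega> (s n) = ennreal (en (s n) \<eta>)" for n
    using bal_mut[OF \<eta> \<omega> sA[of n]] mut_en[OF \<eta>P sP[of n]] en_commute[OF \<eta>P sP[of n]] by simp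
  ultimately have lim: "(\<lambda>n. mut \<omega> (s n)) \<longlonglongrightarrow> ennreal (en \<sigma>' \<eta>)" by (simp add: tendsto_ennrealI)
  have "mut \<omega> \<sigma>' \<le> (\<integral>\<^sup>+x. liminf (\<lambda>n. pot (s n) x) \<partial>\<omega>)"
    unfolding mut_def
    by (rule nn_integral_mono) (rule conv_pot_liminf[OF sP \<sigma>'P cv])
  also have "\<dots> \<le> liminf (\<lambda>n. mut \<omega> (s n))"
    unfolding mut_def by (intro nn_integral_liminf pot_measurable P_radon[OF sP] pos_radon_sets[OF \<omega>])
  also have "\<dots> = ennreal (en \<sigma>' \<eta>)" using lim by (intro lim_imp_Liminf) auto
  finally have 1: "mut \<omega> \<sigma>' \<le> ennreal (en \<sigma>' \<eta>)" .
  have "mut \<omega> (s n) \<le> mut \<omega> \<sigma>'" for n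
    by (rule mut_mono_pot) (rule bal_pot_mono[OF s(3) \<sigma>' s(1,2)])
  then have 2: "ennreal (en \<sigma>' \<eta>) \<le> mut \<omega> \<sigma>'" using lim by (intro LIMSEQ_le_const2) auto
  have "en \<sigma>' \<eta> = en \<sigma> \<eta>" by (rule bal_en[OF \<sigma>' \<sigma> bal_PC[OF \<eta>]])
  then have "mut \<omega> \<sigma>' = ennreal (en \<eta> \<sigma>)" using 1 2 en_commute[OF \<sigma> \<eta>P] by simp
  then show ?thesis using mut_sym[OF \<omega> P_radon[OF \<sigma>'P]] mut_en[OF \<eta>P \<sigma>] by simp
qed

section \<open>Capacity and exceptional sets\<close>

lemma PA_compact_mass:
  assumes "compact K" "\<nu> \<in> PA K"
  shows "emeasure \<nu> UNIV = emeasure \<nu> K" "emeasure \<nu> UNIV < \<infinity>"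
proof -
  note r = P_radon[OF PA_P[OF assms(2)]]
  have Kb: "K \<in> sets \<nu>" "UNIV \<in> sets \<nu>" using compact_borel[OF assms(1)] pos_radon_sets[OF r] by auto
  show e: "emeasure \<nu> UNIV = emeasure \<nu> K"
    by (rule emeasure_eq_AE) (use AE_PA_compact[OF assms] Kb in auto)
  show "emeasure \<nu> UNIV < \<infinity>" unfolding e by (rule pos_radon_finite[OF r assms(1)])
qed

lemma PA_normalize:
  assumes K: "compact K" and \<nu>: "\<nu> \<in> PA K" "emeasure \<nu> UNIV \<noteq> 0"
  shows "\<exists>\<mu>\<in>PA K. emeasure \<mu> UNIV = 1"
proof -
  define m where "m = enn2real (emeasure \<nu> UNIV)"
  have em: "emeasure \<nu> UNIV = ennreal m" unfolding m_def using PA_compact_mass(2)[OF K \<nu>(1)] by simp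
  have m: "0 < m" using \<nu>(2) unfolding em by (simp add: ennreal_eq_0_iff)
  have "emeasure (rscale (1 / m) \<nu>) UNIV = 1"
    unfolding emeasure_rscale em using m by (simp flip: ennreal_mult)
  then show ?thesis using PA_rscale[OF \<nu>(1)] by blast
qed

text \<open>By Lindelof, the union of all open null sets is null.\<close>

lemma measure_support_subset_iff:
  assumes K: "compact (K :: 'a set)" and m: "pos_radon m"
  shows "measure_support m \<subseteq> K \<longleftrightarrow> emeasure m (- K) = 0"
proof
  assume s: "measure_support m \<subseteq> K"
  define \<F> where "\<F> = {U :: 'a set. open U \<and> emeasure m U = 0}"
  obtain \<F>' where \<F>': "\<F>' \<subseteq> \<F>" "countable \<F>'" "\<Union>\<F>' = \<Union>\<F>"
    using Lindelof[of \<F>] unfolding \<F>_def by blast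
  have "- K \<subseteq> \<Union>\<F>"
  proof
    fix x assume "x \<in> - K"
    then have "x \<notin> measure_support m" using s by auto
    then show "x \<in> \<Union>\<F>" unfolding measure_support_def \<F>_def by auto
  qed
  moreover have "\<Union>\<F>' \<in> null_sets m"
  proof -
    have "(\<Union>U\<in>\<F>'. U) \<in> null_sets m"
      by (rule null_sets_UN'[OF \<F>'(2)]) (use \<F>'(1) pos_radon_sets[OF m] in \<open>auto simp: \<F>_def null_sets_def\<close>)
    then show ?thesis by simp
  qed
  ultimately show "emeasure m (- K) = 0"
    using null_sets_subset[of "\<Union>\<F>'" m "- K"] \<F>'(3) compact_borel[OF K] pos_radon_sets[OF m] by auto
next
  assume e: "emeasure m (- K) = 0"
  show "measure_support m \<subseteq> K"
  proof
    fix x assume x: "x \<in> measure_support m"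
    show "x \<in> K"
    proof (rule ccontr)
      assume "x \<notin> K"
      moreover have "open (- K)" using K by (simp add: compact_imp_closed open_Compl)
      ultimately show False using x e unfolding measure_support_def by auto
    qed
  qed
qed

lemma energy_of_pos_radon:
  "pos_radon a \<Longrightarrow> pos_radon b \<Longrightarrow> energy \<kappa> (of_pos_radon a) (of_pos_radon b) = enn2ereal (mut a b)"
  unfolding energy_def energy_plus_eq energy_minus_eq by (simp add: zero_ennreal.rep_eq)

definition cap_measures :: "'a set \<Rightarrow> 'a radon set" where
  "cap_measures K = {\<mu>\<in>radon_cone. measure_support (pos_var \<mu>) \<subseteq> K \<and> emeasure (pos_var \<mu>) UNIV = 1}"

lemma compact_cap_eq: "compact_cap \<kappa> K = 1 / (INF \<mu>\<in>cap_measures K. energy \<kappa> \<mu> \<mu>)"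
  unfolding compact_cap_def cap_measures_def ..

lemma cap_measures_iff:
  assumes K: "compact K"
  shows "\<mu> \<in> cap_measures K \<longleftrightarrow> (\<exists>m. pos_radon m \<and> \<mu> = of_pos_radon m \<and> conc K m \<and> emeasure m UNIV = 1)"
proof
  assume "\<mu> \<in> cap_measures K"
  then have \<mu>: "\<mu> \<in> radon_cone" "measure_support (pos_var \<mu>) \<subseteq> K" "emeasure (pos_var \<mu>) UNIV = 1"
    unfolding cap_measures_def by auto
  note r = pos_radon_pos_var[of \<mu>]
  have "conc K (pos_var \<mu>)"
    using \<mu>(2) measure_support_subset_iff[OF K r] conc_borel[OF r compact_borel[OF K]] by blast
  then show "\<exists>m. pos_radon m \<and> \<mu> = of_pos_radon m \<and> conc K m \<and> emeasure m UNIV = 1"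
    using \<mu> r of_pos_radon_pos_var[OF \<mu>(1)] by metis
next
  assume "\<exists>m. pos_radon m \<and> \<mu> = of_pos_radon m \<and> conc K m \<and> emeasure m UNIV = 1"
  then obtain m where m: "pos_radon m" "\<mu> = of_pos_radon m" "conc K m" "emeasure m UNIV = 1" by blast
  then show "\<mu> \<in> cap_measures K"
    unfolding cap_measures_def
    using measure_support_subset_iff[OF K m(1)] conc_borel[OF m(1) compact_borel[OF K]] of_pos_radon_in_cone[OF m(1)] by simp
qed

lemma cap_energy_nonneg: "\<mu> \<in> cap_measures K \<Longrightarrow> 0 \<le> energy \<kappa> \<mu> \<mu>"
proof -
  assume "\<mu> \<in> cap_measures K"
  then have "\<mu> = of_pos_radon (pos_var \<mu>)" unfolding cap_measures_def by (simp add: of_pos_radon_pos_var)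
  then have "energy \<kappa> \<mu> \<mu> = enn2ereal (mut (pos_var \<mu>) (pos_var \<mu>))"
    using energy_of_pos_radon[OF pos_radon_pos_var pos_radon_pos_var, of \<mu> \<mu>] by simp
  then show ?thesis by (simp add: enn2ereal_nonneg)
qed

lemma compact_cap_nonneg: "0 \<le> compact_cap \<kappa> K"
proof -
  have "0 \<le> (INF \<mu>\<in>cap_measures K. energy \<kappa> \<mu> \<mu>)" using cap_energy_nonneg by (intro INF_greatest)
  then show ?thesis unfolding compact_cap_eq by (simp add: divide_ereal_def ereal_inverse_nonneg_iff)
qed

lemma compact_cap_le:
  assumes K: "compact K" and r: "0 < r" and le: "\<And>\<nu>. \<nu> \<in> PA K \<Longrightarrow> emeasure \<nu> UNIV = 1 \<Longrightarrow> r \<le> en \<nu> \<nu>"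
  shows "compact_cap \<kappa> K \<le> ereal (1 / r)"
proof -
  have "ereal r \<le> (INF \<mu>\<in>cap_measures K. energy \<kappa> \<mu> \<mu>)"
  proof (rule INF_greatest)
    fix \<mu> assume "\<mu> \<in> cap_measures K"
    then obtain m where m: "pos_radon m" "\<mu> = of_pos_radon m" "conc K m" "emeasure m UNIV = 1"
      unfolding cap_measures_iff[OF K] by blast
    show "ereal r \<le> energy \<kappa> \<mu> \<mu>"
    proof (cases "mut m m < \<infinity>")
      case True
      then have P: "m \<in> PA K" using m unfolding PA_def P_def by simp
      then have "ereal r \<le> enn2ereal (mut m m)"
        using le[OF P m(4)] mut_en[OF PA_P[OF P] PA_P[OF P]] en_nn[of m m] by (simp add: enn2ereal_ennreal)
      then show ?thesis by (simp add: m energy_of_pos_radon)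
    next
      case False
      then have "mut m m = top" by (simp add: less_top[symmetric])
      then show ?thesis by (simp add: m energy_of_pos_radon)
    qed
  qed
  then have "inverse (INF \<mu>\<in>cap_measures K. energy \<kappa> \<mu> \<mu>) \<le> inverse (ereal r)"
    using r by (intro ereal_inverse_antimono) auto
  then show ?thesis unfolding compact_cap_eq divide_ereal_def using r by (simp add: inverse_eq_divide)
qed

text \<open>Capacity zero means an infinite infimum of energies over unit measures; a nonzero
  measure of finite energy on \<open>K\<close> could be normalized and would make it finite.\<close>

lemma compact_cap_eq_0_iff:
  assumes K: "compact K"
  shows "compact_cap \<kappa> K = 0 \<longleftrightarrow> (\<forall>\<nu>\<in>PA K. emeasure \<nu> UNIV = 0)"
proof
  assume 0: "compact_cap \<kappa> K = 0"
  show "\<forall>\<nu>\<in>PA K. emeasure \<nu> UNIV = 0"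
  proof (rule ballI, rule ccontr)
    fix \<nu> assume \<nu>: "\<nu> \<in> PA K" "emeasure \<nu> UNIV \<noteq> 0"
    obtain \<mu> where \<mu>: "\<mu> \<in> PA K" "emeasure \<mu> UNIV = 1" using PA_normalize[OF K \<nu>] by blast
    note r = P_radon[OF PA_P[OF \<mu>(1)]]
    have "of_pos_radon \<mu> \<in> cap_measures K"
      unfolding cap_measures_iff[OF K] using \<mu> r unfolding PA_def by blast
    then have "(INF \<mu>\<in>cap_measures K. energy \<kappa> \<mu> \<mu>) \<le> energy \<kappa> (of_pos_radon \<mu>) (of_pos_radon \<mu>)" by (rule INF_lower)
    also have "\<dots> = ereal (en \<mu> \<mu>)"
      by (simp add: energy_of_pos_radon r mut_en PA_P[OF \<mu>(1)] enn2ereal_ennreal en_nn)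
    finally have "(INF \<mu>\<in>cap_measures K. energy \<kappa> \<mu> \<mu>) \<noteq> \<infinity>" by auto
    moreover have "0 \<le> (INF \<mu>\<in>cap_measures K. energy \<kappa> \<mu> \<mu>)" using cap_energy_nonneg by (intro INF_greatest)
    ultimately have "inverse (INF \<mu>\<in>cap_measures K. energy \<kappa> \<mu> \<mu>) \<noteq> 0" by (cases "INF \<mu>\<in>cap_measures K. energy \<kappa> \<mu> \<mu>") auto
    then show False using 0 unfolding compact_cap_eq divide_ereal_def by simp
  qed
next
  assume z: "\<forall>\<nu>\<in>PA K. emeasure \<nu> UNIV = 0"
  \<comment> \<open>No measure of finite energy on \<open>K\<close> has mass 1, so the lower bound
    on energies holds vacuously for every constant.\<close>
  have le: "compact_cap \<kappa> K \<le> ereal e" if "0 < e" for e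
    using compact_cap_le[OF K, of "1 / e"] z that by fastforce
  have "compact_cap \<kappa> K \<le> 0"
    by (rule ereal_le_epsilon2) (use le in auto)
  then show "compact_cap \<kappa> K = 0" using compact_cap_nonneg by (intro antisym)
qed

lemma inner_cap_nonneg: "0 \<le> inner_cap \<kappa> A"
  unfolding inner_cap_def by (rule SUP_upper2[of "{}"]) (auto simp: compact_cap_nonneg)

lemma inner_cap_mono: "A \<subseteq> B \<Longrightarrow> inner_cap \<kappa> A \<le> inner_cap \<kappa> B"
  unfolding inner_cap_def by (rule SUP_subset_mono) auto

lemma inner_cap_eq_0_iff:
  "inner_cap \<kappa> N = 0 \<longleftrightarrow> (\<forall>K \<nu>. compact K \<longrightarrow> K \<subseteq> N \<longrightarrow> \<nu> \<in> PA K \<longrightarrow> emeasure \<nu> UNIV = 0)"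
proof -
  have "inner_cap \<kappa> N = 0 \<longleftrightarrow> (\<forall>K. compact K \<longrightarrow> K \<subseteq> N \<longrightarrow> compact_cap \<kappa> K = 0)"
  proof
    assume 0: "inner_cap \<kappa> N = 0"
    have "compact_cap \<kappa> K \<le> 0" if "compact K" "K \<subseteq> N" for K
      unfolding 0[symmetric] inner_cap_def using that by (intro SUP_upper) auto
    then show "\<forall>K. compact K \<longrightarrow> K \<subseteq> N \<longrightarrow> compact_cap \<kappa> K = 0"
      using compact_cap_nonneg antisym by blast
  next
    assume a: "\<forall>K. compact K \<longrightarrow> K \<subseteq> N \<longrightarrow> compact_cap \<kappa> K = 0"
    have "inner_cap \<kappa> N \<le> 0" unfolding inner_cap_def using a by (intro SUP_least) auto
    then show "inner_cap \<kappa> N = 0" using inner_cap_nonneg by (intro antisym)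
  qed
  then show ?thesis using compact_cap_eq_0_iff by blast
qed

lemma bal_exceptional_inner_cap:
  assumes b: "bal \<sigma> A \<eta>"
  shows "inner_cap \<kappa> {x\<in>A. pot \<eta> x \<noteq> pot \<sigma> x} = 0"
  unfolding inner_cap_eq_0_iff
proof (intro allI impI)
  fix K \<nu> assume K: "compact K" "K \<subseteq> {x\<in>A. pot \<eta> x \<noteq> pot \<sigma> x}" and \<nu>: "\<nu> \<in> PA K"
  have KA: "K \<subseteq> A" using K(2) by auto
  from AE_PA_compact[OF K(1) \<nu>] bal_AE[OF b PA_mono[OF \<nu> KA]]
  have "AE x in \<nu>. False" by eventually_elim (use K(2) in auto)
  then show "emeasure \<nu> UNIV = 0"
    using AE_iff_measurable[of "space \<nu>" \<nu> "\<lambda>_. False"] pos_radon_space[OF P_radon[OF PA_P[OF \<nu>]]] sets.top[of \<nu>] by simp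
qed

text \<open>A measure of finite energy that charges a Borel set has a nonzero restriction to some
  compact part of it, which then has positive capacity. As \<open>A\<close> need not be Borel, this
  is applied inside a Borel core of \<open>A\<close>.\<close>

lemma AE_of_inner_cap:
  assumes a: "pos_radon a" "pos_radon b" and 0: "inner_cap \<kappa> {x\<in>A. pot a x \<noteq> pot b x} = 0" and \<nu>: "\<nu> \<in> PA A"
  shows "AE x in \<nu>. pot a x = pot b x"
proof -
  note r = P_radon[OF PA_P[OF \<nu>]]
  note ns = pos_radon_sets[OF r]
  have cA: "conc A \<nu>" using \<nu> by (simp add: PA_def)
  obtain B where B: "B \<in> sets borel" "B \<subseteq> A" "emeasure \<nu> (- B) = 0" using conc_core[OF r cA] by blast
  define N where "N = {x. pot a x \<noteq> pot b x}"
  have Nb: "N \<in> sets borel"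
    using borel_measurable_neq[OF pot_borel[OF a(1)] pot_borel[OF a(2)]] unfolding N_def by (simp add: pred_def)
  have "emeasure \<nu> (N \<inter> B) = 0"
  proof (rule ccontr)
    assume "emeasure \<nu> (N \<inter> B) \<noteq> 0"
    then obtain K where K: "compact K" "K \<subseteq> N \<inter> B" "emeasure \<nu> K \<noteq> 0"
      using radon_compact_subset_pos[OF r, of "N \<inter> B"] Nb B(1) by auto
    have Kb: "K \<in> sets borel" by (rule compact_borel[OF K(1)])
    have "rrestrict \<nu> K \<in> PA K" by (rule rrestrict_PA[OF PA_P[OF \<nu>] Kb order_refl])
    moreover have "K \<subseteq> {x\<in>A. pot a x \<noteq> pot b x}" using K(2) B(2) unfolding N_def by auto
    ultimately have "emeasure (rrestrict \<nu> K) UNIV = 0" using 0 K(1) unfolding inner_cap_eq_0_iff by blast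
    then show False using K(3) Kb ns by (subst (asm) emeasure_rrestrict) auto
  qed
  then have "N \<inter> B \<in> null_sets \<nu>" "- B \<in> null_sets \<nu>" using Nb B ns by auto
  from this[THEN AE_not_in] show ?thesis by eventually_elim (auto simp: N_def)
qed

text \<open>Treats both balayages at once: existence needs the exceptional set of
  \<open>\<eta>\<close> to be \<open>cap\<close>-null, uniqueness needs \<open>cap\<close>-null sets
  to be of inner capacity zero.\<close>

lemma swept_energy_eq:
  assumes \<sigma>: "\<sigma> \<in> P" and b: "bal \<sigma> A \<eta>"
    and cap: "cap {x\<in>A. pot \<eta> x \<noteq> pot \<sigma> x} = 0" "\<And>N. cap N = 0 \<Longrightarrow> inner_cap \<kappa> N = 0"
  shows "swept_energy cap \<kappa> A (of_pos_radon \<sigma>) = of_pos_radon \<eta>"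
  unfolding swept_energy_def
proof (rule the_equality)
  note \<sigma>r = P_radon[OF \<sigma>]
  have set: "{x\<in>A. potential \<kappa> (of_pos_radon z) x \<noteq> potential \<kappa> (of_pos_radon \<sigma>) x} = {x\<in>A. pot z x \<noteq> pot \<sigma> x}"
    if "pos_radon z" for z
    using that by (simp add: potential_of_pos_radon \<sigma>r enn2ereal_inject)
  show "of_pos_radon \<eta> \<in> energy_cone_closure \<kappa> A \<and>
    cap {x\<in>A. potential \<kappa> (of_pos_radon \<eta>) x \<noteq> potential \<kappa> (of_pos_radon \<sigma>) x} = 0"
    unfolding set[OF P_radon[OF bal_P[OF b]]] energy_cone_closure_iff using bal_PC[OF b] cap(1) by blast
  fix \<zeta> assume z: "\<zeta> \<in> energy_cone_closure \<kappa> A \<and> cap {x\<in>A. potential \<kappa> \<zeta> x \<noteq> potential \<kappa> (of_pos_radon \<sigma>) x} = 0"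
  then obtain z where z': "z \<in> PC A" "\<zeta> = of_pos_radon z" unfolding energy_cone_closure_iff by blast
  note zr = P_radon[OF PC_P[OF z'(1)]]
  have 0: "inner_cap \<kappa> {x\<in>A. pot z x \<noteq> pot \<sigma> x} = 0"
    using z unfolding z'(2) set[OF zr] by (intro cap(2)) simp
  have "z = \<eta>"
  proof (rule PC_eqI[OF z'(1) bal_PC[OF b]])
    fix \<nu> assume \<nu>: "\<nu> \<in> PA A"
    have "mut \<nu> z = mut \<nu> \<sigma>" unfolding mut_def by (rule nn_integral_cong_AE[OF AE_of_inner_cap[OF zr \<sigma>r 0 \<nu>]])
    then have "mut z \<nu> = mut \<eta> \<nu>"
      using bal_mut[OF b \<sigma>r \<nu>] mut_sym[OF zr P_radon[OF PA_P[OF \<nu>]]] mut_sym[OF \<sigma>r P_radon[OF PA_P[OF \<nu>]]] by simp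
    then show "en z \<nu> = en \<eta> \<nu>" by (simp add: en_def)
  qed
  then show "\<zeta> = of_pos_radon \<eta>" using z'(2) by simp
qed

text \<open>Reciprocity supplies the defining relation; testing it with measures of
  \<open>PA A\<close> gives uniqueness within the closed cone.\<close>

lemma swept_pos_eq:
  assumes \<omega>: "pos_radon \<omega>" and b: "bal \<omega> A \<eta>"
    and swept: "\<And>\<sigma> \<sigma>'. \<sigma> \<in> P \<Longrightarrow> bal \<sigma> A \<sigma>' \<Longrightarrow> swept_energy cap \<kappa> A (of_pos_radon \<sigma>) = of_pos_radon \<sigma>'"
  shows "swept_pos cap \<kappa> A (of_pos_radon \<omega>) = of_pos_radon \<eta>"
  unfolding swept_pos_def
proof (rule the_equality)
  have rec: "energy \<kappa> (swept_energy cap \<kappa> A (of_pos_radon \<sigma>)) (of_pos_radon \<omega>) = enn2ereal (mut \<eta> \<sigma>)" if \<sigma>: "\<sigma> \<in> P" for \<sigma>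
  proof -
    obtain \<sigma>' where \<sigma>': "bal \<sigma> A \<sigma>'" using bal_limit_energy[OF \<sigma>, of A] by blast
    show ?thesis
      unfolding swept[OF \<sigma> \<sigma>'] energy_of_pos_radon[OF P_radon[OF bal_P[OF \<sigma>']] \<omega>] bal_reciprocity[OF \<omega> b \<sigma> \<sigma>'] ..
  qed
  show "of_pos_radon \<eta> \<in> energy_cone_closure \<kappa> A \<and>
    (\<forall>\<sigma>\<in>energy_cone \<kappa>. energy \<kappa> (of_pos_radon \<eta>) \<sigma> = energy \<kappa> (swept_energy cap \<kappa> A \<sigma>) (of_pos_radon \<omega>))"
    unfolding energy_cone_closure_iff using bal_PC[OF b] rec
    by (auto simp: energy_cone_iff energy_of_pos_radon P_radon bal_P[OF b])
  fix \<zeta> assume z: "\<zeta> \<in> energy_cone_closure \<kappa> A \<and>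
    (\<forall>\<sigma>\<in>energy_cone \<kappa>. energy \<kappa> \<zeta> \<sigma> = energy \<kappa> (swept_energy cap \<kappa> A \<sigma>) (of_pos_radon \<omega>))"
  then obtain z where z': "z \<in> PC A" "\<zeta> = of_pos_radon z" unfolding energy_cone_closure_iff by blast
  have "z = \<eta>"
  proof (rule PC_eqI[OF z'(1) bal_PC[OF b]])
    fix \<nu> assume "\<nu> \<in> PA A"
    then have \<nu>: "\<nu> \<in> P" by (rule PA_P)
    have "energy \<kappa> \<zeta> (of_pos_radon \<nu>) = enn2ereal (mut \<eta> \<nu>)"
      using z rec[OF \<nu>] of_pos_radon_energy_cone[OF \<nu>] by simp
    then have "mut z \<nu> = mut \<eta> \<nu>"
      unfolding z'(2) energy_of_pos_radon[OF P_radon[OF PC_P[OF z'(1)]] P_radon[OF \<nu>]] by (simp add: enn2ereal_inject)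
    then show "en z \<nu> = en \<eta> \<nu>" by (simp add: en_def)
  qed
  then show "\<zeta> = of_pos_radon \<eta>" using z'(2) by simp
qed

end

section \<open>Choquet's capacitability theorem\<close>

text \<open>Since \<open>P k\<close> looks only at the first \<open>k\<close> entries, prefixes
  chosen one entry at a time fit together to a single sequence.\<close>

lemma prefix_choice:
  fixes P :: "nat \<Rightarrow> (nat \<Rightarrow> nat) \<Rightarrow> bool"
  assumes prefix: "\<And>k p q. (\<And>i. i < k \<Longrightarrow> p i = q i) \<Longrightarrow> P k p \<Longrightarrow> P k q"
    and base: "P 0 p" and step: "\<And>k p. P k p \<Longrightarrow> \<exists>v. P (Suc k) (p(k := v))"
  shows "\<exists>s. \<forall>k. P k s"
proof -
  have "\<exists>f. \<forall>k. P k (f k) \<and> (\<exists>v. f (Suc k) = (f k)(k := v))"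
  proof (rule dependent_nat_choice)
    show "\<exists>p. P 0 p" using base by blast
    show "\<exists>q. P (Suc k) q \<and> (\<exists>v. q = p(k := v))" if "P k p" for p k
      using step[OF that] by blast
  qed
  then obtain f where f: "\<And>k. P k (f k)" "\<And>k. \<exists>v. f (Suc k) = (f k)(k := v)" by blast
  define s where "s i = f (Suc i) i" for i
  have "f k i = s i" if "i < k" for k i
    using that
  proof (induction k)
    case (Suc k)
    obtain v where v: "f (Suc k) = (f k)(k := v)" using f(2) by blast
    show ?case
    proof (cases "i = k")
      case True
      then show ?thesis by (simp add: s_def)
    next
      case False
      then show ?thesis using Suc v by simp
    qed
  qed simp
  then have "P k s" for k using prefix[of k "f k" s] f(1) by blast
  then show ?thesis by blast
qed

text \<open>Suslin's operation on closed sets. Finite sequences are coded by total ones, of which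
  \<open>F n s\<close> sees the first \<open>n\<close> entries.\<close>

definition suslin_scheme :: "(nat \<Rightarrow> (nat \<Rightarrow> nat) \<Rightarrow> 'a::topological_space set) \<Rightarrow> 'a set \<Rightarrow> bool" where
  "suslin_scheme F A \<longleftrightarrow> (\<forall>n s. closed (F n s)) \<and>
     (\<forall>n s t. (\<forall>i<n. s i = t i) \<longrightarrow> F n s = F n t) \<and> A = {x. \<exists>s. \<forall>n. x \<in> F n s}"

definition suslin :: "'a::topological_space set \<Rightarrow> bool" where
  "suslin A \<longleftrightarrow> (\<exists>F. suslin_scheme F A)"

lemma suslin_closed: "closed A \<Longrightarrow> suslin A"
  unfolding suslin_def suslin_scheme_def by (intro exI[of _ "\<lambda>_ _. A"]) auto

lemma suslin_UN:
  assumes "\<And>i :: nat. suslin (A i)"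
  shows "suslin (\<Union>i. A i)"
proof -
  have "\<forall>i. \<exists>F. suslin_scheme F (A i)" using assms unfolding suslin_def by blast
  from choice[OF this] obtain F where "\<forall>i. suslin_scheme (F i) (A i)" by blast
  then have F: "\<forall>i. (\<forall>n s. closed (F i n s)) \<and>
     (\<forall>n s t. (\<forall>j<n. s j = t j) \<longrightarrow> F i n s = F i n t) \<and> A i = {x. \<exists>s. \<forall>n. x \<in> F i n s}"
    unfolding suslin_scheme_def .
  \<comment> \<open>The entry \<open>s 0\<close> selects the set \<open>A i\<close> and the shifted
    sequence drives its scheme; level 0, where no entry may be read, is the whole space.\<close>
  define G where "G n s = (case n of 0 \<Rightarrow> UNIV | Suc m \<Rightarrow> F (s 0) m (\<lambda>k. s (Suc k)))" for n and s :: "nat \<Rightarrow> nat"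
  show ?thesis
    unfolding suslin_def suslin_scheme_def
  proof (intro exI[of _ G] conjI allI impI)
    fix n and s t :: "nat \<Rightarrow> nat"
    show "closed (G n s)" unfolding G_def using F by (cases n) auto
    assume st: "\<forall>i<n. s i = t i"
    show "G n s = G n t"
    proof (cases n)
      case (Suc m)
      then have e: "s 0 = t 0" "\<forall>k<m. s (Suc k) = t (Suc k)" using st by auto
      have "\<forall>n u v. (\<forall>j<n. u j = v j) \<longrightarrow> F (t 0) n u = F (t 0) n v" using F by blast
      from this[rule_format, of m "\<lambda>k. s (Suc k)" "\<lambda>k. t (Suc k)"]
      have "F (t 0) m (\<lambda>k. s (Suc k)) = F (t 0) m (\<lambda>k. t (Suc k))" using e(2) by simp
      then show ?thesis unfolding G_def Suc using e(1) by simp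
    qed (simp add: G_def)
  next
    show "(\<Union>i. A i) = {x. \<exists>s. \<forall>n. x \<in> G n s}"
    proof (intro set_eqI iffI)
      fix x assume "x \<in> (\<Union>i. A i)"
      then obtain i where "x \<in> A i" by blast
      moreover have "A i = {x. \<exists>s. \<forall>n. x \<in> F i n s}" using F by blast
      ultimately obtain s where s: "\<forall>n. x \<in> F i n s" by blast
      have "x \<in> G n (case_nat i s)" for n unfolding G_def using s by (cases n) auto
      then show "x \<in> {x. \<exists>s. \<forall>n. x \<in> G n s}" by blast
    next
      fix x assume "x \<in> {x. \<exists>s. \<forall>n. x \<in> G n s}"
      then obtain s where s: "\<And>n. x \<in> G n s" by blast
      have "x \<in> F (s 0) n (\<lambda>k. s (Suc k))" for n using s[of "Suc n"] unfolding G_def by simp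
      then have "x \<in> A (s 0)" using F by blast
      then show "x \<in> (\<Union>i. A i)" by blast
    qed
  qed
qed

text \<open>Ensures that the first \<open>m\<close> entries of a sequence, where \<open>m\<close>
  codes (i, n), contain the first n entries of its i-th subsequence.\<close>

lemma prod_encode_less: "k < n \<Longrightarrow> prod_encode (i, k) < prod_encode (i, n)"
proof -
  have "triangle m < triangle (Suc m)" for m by simp
  then have "strict_mono triangle" by (simp add: strict_mono_Suc_iff)
  then show "k < n \<Longrightarrow> prod_encode (i, k) < prod_encode (i, n)"
    by (simp add: prod_encode_def strict_mono_less)
qed

lemma suslin_INT:
  assumes "\<And>i :: nat. suslin (A i)"
  shows "suslin (\<Inter>i. A i)"
proof -
  have "\<forall>i. \<exists>F. suslin_scheme F (A i)" using assms unfolding suslin_def by blast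
  from choice[OF this] obtain F where "\<forall>i. suslin_scheme (F i) (A i)" by blast
  then have F: "\<forall>i. (\<forall>n s. closed (F i n s)) \<and>
     (\<forall>n s t. (\<forall>j<n. s j = t j) \<longrightarrow> F i n s = F i n t) \<and> A i = {x. \<exists>s. \<forall>n. x \<in> F i n s}"
    unfolding suslin_scheme_def .
  \<comment> \<open>One sequence encodes countably many along the pairing function; the level coding
    (i, n) imposes level n of the i-th scheme.\<close>
  define G where "G m s = F (fst (prod_decode m)) (snd (prod_decode m)) (\<lambda>k. s (prod_encode (fst (prod_decode m), k)))"
    for m and s :: "nat \<Rightarrow> nat"
  have Ge: "G (prod_encode (i, n)) s = F i n (\<lambda>k. s (prod_encode (i, k)))" for i n s
    unfolding G_def by simp
  show ?thesis
    unfolding suslin_def suslin_scheme_def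
  proof (intro exI[of _ G] conjI allI impI)
    fix m and s t :: "nat \<Rightarrow> nat"
    show "closed (G m s)" unfolding G_def using F by auto
    assume st: "\<forall>i<m. s i = t i"
    obtain i n where m: "m = prod_encode (i, n)" by (metis prod_decode_inverse surj_pair)
    have e: "s (prod_encode (i, k)) = t (prod_encode (i, k))" if "k < n" for k
      using st prod_encode_less[OF that] unfolding m by blast
    have F': "(\<forall>j<n. u j = v j) \<longrightarrow> F i n u = F i n v" for u v using F by blast
    show "G m s = G m t" unfolding m Ge by (rule F'[rule_format]) (rule e)
  next
    show "(\<Inter>i. A i) = {x. \<exists>s. \<forall>n. x \<in> G n s}"
    proof (intro set_eqI iffI)
      fix x assume x: "x \<in> (\<Inter>i. A i)"
      have "\<exists>s. \<forall>n. x \<in> F i n s" for i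
      proof -
        have "x \<in> A i" using x by blast
        moreover have "A i = {x. \<exists>s. \<forall>n. x \<in> F i n s}" using F by blast
        ultimately show ?thesis by blast
      qed
      then obtain S where S: "\<And>i n. x \<in> F i n (S i)" by metis
      define s where "s j = S (fst (prod_decode j)) (snd (prod_decode j))" for j
      have "x \<in> G m s" for m
      proof -
        have "(\<lambda>k. s (prod_encode (i, k))) = S i" for i unfolding s_def by simp
        then show ?thesis unfolding G_def using S by simp
      qed
      then show "x \<in> {x. \<exists>s. \<forall>n. x \<in> G n s}" by blast
    next
      fix x assume "x \<in> {x. \<exists>s. \<forall>n. x \<in> G n s}"
      then obtain s where s: "\<And>n. x \<in> G n s" by blast
      have "x \<in> A i" for i
      proof -
        have "x \<in> F i n (\<lambda>k. s (prod_encode (i, k)))" for n using s[of "prod_encode (i, n)"] unfolding Ge .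
        moreover have "A i = {x. \<exists>s. \<forall>n. x \<in> F i n s}" using F by blast
        ultimately show ?thesis by blast
      qed
      then show "x \<in> (\<Inter>i. A i)" by blast
    qed
  qed
qed

section \<open>Capacitability of Borel sets\<close>

context lch_space
begin

lemma suslin_open: "open (U :: 'a set) \<Longrightarrow> suslin U"
proof -
  assume "open U"
  from compact_exhaustion[OF this] obtain Q :: "nat \<Rightarrow> 'a set" where Q: "\<forall>n. compact (Q n)" "(\<Union>n. Q n) = U" by blast
  have "suslin (\<Union>n. Q n)" using Q(1) by (intro suslin_UN suslin_closed compact_imp_closed) blast
  then show "suslin U" using Q(2) by simp
qed

text \<open>Complements of Suslin sets need not be Suslin, so the induction runs over sets that are
  Suslin together with their complement.\<close>

lemma borel_suslin:
  assumes "A \<in> sets (borel :: 'a measure)"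
  shows "suslin A"
proof -
  have "A \<in> sigma_sets UNIV {S. open S}" using assms by (simp add: borel_def)
  then have "suslin A \<and> suslin (- A)"
  proof induction
    case (Basic a)
    then have "open a" by simp
    then show ?case using suslin_open[of a] suslin_closed[OF closed_Compl] by blast
  next
    case Empty
    show ?case using suslin_closed[of "{} :: 'a set"] suslin_closed[of "UNIV :: 'a set"] by simp
  next
    case (Compl a)
    then show ?case by (simp flip: Compl_eq_Diff_UNIV)
  next
    case (Union a)
    then have "suslin (\<Union>i. a i)" "suslin (\<Inter>i. - a i)" by (intro suslin_UN suslin_INT; blast)+
    then show ?case by simp
  qed
  then show ?thesis by simp
qed

text \<open>The entries of the Suslin sequences are bounded one at a time; continuity from below
  keeps the value above \<open>t\<close>. Bounded sequences have finitely many prefixes of each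
  length, so the sets \<open>K k\<close> are compact, and Konig's lemma puts their intersection
  inside \<open>A\<close>.\<close>

theorem capacitability:
  fixes c :: "'a set \<Rightarrow> real"
  assumes mono: "\<And>A B. A \<subseteq> B \<Longrightarrow> c A \<le> c B"
    and inc: "\<And>A t. incseq A \<Longrightarrow> t < c (\<Union>n :: nat. A n) \<Longrightarrow> \<exists>n. t < c (A n)"
    and dec: "\<And>K t. decseq K \<Longrightarrow> (\<And>n :: nat. compact (K n)) \<Longrightarrow> (\<And>n. t \<le> c (K n)) \<Longrightarrow> t \<le> c (\<Inter>n. K n)"
    and A: "A \<in> sets borel" and t: "t < c A"
  shows "\<exists>K. compact K \<and> K \<subseteq> A \<and> t \<le> c K"
proof -
  obtain F where F: "\<And>n s. closed (F n s)" "\<And>n s t. (\<And>i. i < n \<Longrightarrow> s i = t i) \<Longrightarrow> F n s = F n t"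
    and AF: "A = {x. \<exists>s :: nat \<Rightarrow> nat. \<forall>n. x \<in> F n s}"
    using borel_suslin[OF A] unfolding suslin_def suslin_scheme_def by (elim exE conjE) blast
  obtain L :: "nat \<Rightarrow> 'a set" where L: "\<forall>n. compact (L n)" "\<forall>n. L n \<subseteq> interior (L (Suc n))" "(\<Union>n. L n) = (UNIV :: 'a set)"
    using compact_exhaustion[OF open_UNIV] by blast
  have "incseq L" by (rule exhaustion_mono) (use L(2) in blast)
  then have "incseq (\<lambda>m. A \<inter> L m)" by (auto simp: incseq_def)
  moreover have "(\<Union>m. A \<inter> L m) = A" using L(3) by blast
  ultimately obtain m where m: "t < c (A \<inter> L m)" using inc[of "\<lambda>m. A \<inter> L m" t] t by auto
  define W where "W k b = {x\<in>L m. \<exists>s. (\<forall>i<k. s i \<le> b i) \<and> (\<forall>n. x \<in> F n s)}" for k and b :: "nat \<Rightarrow> nat"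
  have "\<exists>b. \<forall>k. t < c (W k b)"
  proof (rule prefix_choice)
    show "t < c (W k q)" if "\<And>i. i < k \<Longrightarrow> p i = q i" "t < c (W k p)" for k p q
    proof -
      have "W k p = W k q" unfolding W_def using that(1) by auto
      then show ?thesis using that(2) by simp
    qed
    have "W 0 (\<lambda>_. 0) = A \<inter> L m" unfolding W_def AF by auto
    then show "t < c (W 0 (\<lambda>_. 0))" using m by simp
    show "\<exists>v. t < c (W (Suc k) (b(k := v)))" if "t < c (W k b)" for k b
    proof -
      have "W k b = (\<Union>v. W (Suc k) (b(k := v)))"
      proof (intro set_eqI iffI)
        fix x assume "x \<in> W k b"
        then obtain s where s: "x \<in> L m" "\<forall>i<k. s i \<le> b i" "\<forall>n. x \<in> F n s" unfolding W_def by blast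
        then have "x \<in> W (Suc k) (b(k := s k))" unfolding W_def by (auto simp: less_Suc_eq intro!: exI[of _ s])
        then show "x \<in> (\<Union>v. W (Suc k) (b(k := v)))" by blast
      next
        fix x assume "x \<in> (\<Union>v. W (Suc k) (b(k := v)))"
        then obtain v s where s: "x \<in> L m" "\<forall>i<Suc k. s i \<le> (b(k := v)) i" "\<forall>n. x \<in> F n s" unfolding W_def by blast
        have "\<forall>i<k. s i \<le> b i"
        proof (intro allI impI)
          fix i assume "i < k"
          then show "s i \<le> b i" using s(2)[rule_format, of i] by simp
        qed
        then show "x \<in> W k b" unfolding W_def using s by blast
      qed
      moreover have "incseq (\<lambda>v. W (Suc k) (b(k := v)))"
      proof (rule incseq_SucI, rule subsetI)
        fix v x assume "x \<in> W (Suc k) (b(k := v))"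
        then obtain s where s: "x \<in> L m" "\<forall>i<Suc k. s i \<le> (b(k := v)) i" "\<forall>n. x \<in> F n s" unfolding W_def by blast
        have "s i \<le> (b(k := Suc v)) i" if "i < Suc k" for i
          using s(2)[rule_format, OF that] by (cases "i = k") auto
        then show "x \<in> W (Suc k) (b(k := Suc v))" unfolding W_def using s by blast
      qed
      ultimately show ?thesis using inc[of "\<lambda>v. W (Suc k) (b(k := v))" t] that by metis
    qed
  qed
  then obtain b where b: "\<And>k. t < c (W k b)" by blast
  \<comment> \<open>Padding with zeros beyond \<open>k\<close> makes the set finite and leaves
    \<open>F n s\<close> unchanged for n at most \<open>k\<close>.\<close>
  define S where "S k = {s. \<forall>i. (i \<in> {..<k} \<longrightarrow> s i \<in> {..b i}) \<and> (i \<notin> {..<k} \<longrightarrow> s i = 0)}" for k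
  have finS: "finite (S k)" for k
  proof -
    have "S k \<subseteq> {s. \<forall>i. (i \<in> {..<k} \<longrightarrow> s i \<in> {..(\<Sum>j<k. b j)}) \<and> (i \<notin> {..<k} \<longrightarrow> s i = 0)}"
    proof
      fix s assume s: "s \<in> S k"
      have "s i \<le> (\<Sum>j<k. b j)" if "i < k" for i
      proof -
        have "s i \<le> b i" using s that unfolding S_def by simp
        also have "\<dots> \<le> (\<Sum>j<k. b j)" using that by (intro member_le_sum) auto
        finally show ?thesis .
      qed
      then show "s \<in> {s. \<forall>i. (i \<in> {..<k} \<longrightarrow> s i \<in> {..(\<Sum>j<k. b j)}) \<and> (i \<notin> {..<k} \<longrightarrow> s i = 0)}"
        using s unfolding S_def by simp
    qed
    then show ?thesis by (rule finite_subset) (rule finite_set_of_finite_funs; simp)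
  qed
  define K where "K k = (\<Union>s\<in>S k. L m \<inter> (\<Inter>n\<in>{..k}. F n s))" for k
  have Kiff: "x \<in> K k \<longleftrightarrow> x \<in> L m \<and> (\<exists>s. (\<forall>i<k. s i \<le> b i) \<and> (\<forall>n\<le>k. x \<in> F n s))" for x k
  proof
    assume "x \<in> K k"
    then show "x \<in> L m \<and> (\<exists>s. (\<forall>i<k. s i \<le> b i) \<and> (\<forall>n\<le>k. x \<in> F n s))" unfolding K_def S_def by auto
  next
    assume "x \<in> L m \<and> (\<exists>s. (\<forall>i<k. s i \<le> b i) \<and> (\<forall>n\<le>k. x \<in> F n s))"
    then obtain s where s: "x \<in> L m" "\<forall>i<k. s i \<le> b i" "\<forall>n\<le>k. x \<in> F n s" by blast
    define s' where "s' i = (if i < k then s i else 0)" for i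
    have "s' \<in> S k" unfolding S_def s'_def using s(2) by simp
    moreover have "x \<in> F n s'" if "n \<le> k" for n
    proof -
      have "F n s' = F n s" by (rule F(2)) (use that in \<open>simp add: s'_def\<close>)
      then show ?thesis using s(3) that by simp
    qed
    ultimately show "x \<in> K k" unfolding K_def using s(1) by auto
  qed
  have cK: "compact (K k)" for k
    unfolding K_def using L(1) F(1) finS by (intro compact_UN compact_Int_closed closed_INT ballI) auto
  have dK: "decseq K"
  proof (rule decseq_SucI, rule subsetI)
    fix k x assume "x \<in> K (Suc k)"
    then show "x \<in> K k" unfolding Kiff by (meson le_SucI less_SucI)
  qed
  have "t \<le> c (K k)" for k
  proof -
    have "W k b \<subseteq> K k" unfolding W_def subset_iff Kiff by blast
    then show ?thesis using mono[of "W k b" "K k"] b[of k] by linarith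
  qed
  then have tK: "t \<le> c (\<Inter>k. K k)" by (rule dec[OF dK cK])
  have "compact (\<Inter>k. K k)"
  proof -
    have "compact (K 0 \<inter> (\<Inter>k. K k))" using cK compact_imp_closed by (intro compact_Int_closed closed_INT ballI) auto
    moreover have "K 0 \<inter> (\<Inter>k. K k) = (\<Inter>k. K k)" by blast
    ultimately show ?thesis by simp
  qed
  moreover have "(\<Inter>k. K k) \<subseteq> A"
  proof
    fix x assume x: "x \<in> (\<Inter>k. K k)"
    \<comment> \<open>Konig's lemma: a branch is built among the prefixes that can be continued to
      every finite depth \<open>j\<close>.\<close>
    define V where "V p k j \<longleftrightarrow> (\<exists>s. (\<forall>i<k. s i = p i) \<and> (\<forall>i<j. s i \<le> b i) \<and> (\<forall>n\<le>j. x \<in> F n s))" for p k j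
    have Vmono: "V p k j'" if "V p k j" "j' \<le> j" for p k j j'
      using that unfolding V_def by (meson le_trans less_le_trans)
    have "\<exists>s. \<forall>k. \<forall>j. V s k j"
    proof (rule prefix_choice)
      show "\<forall>j. V q k j" if "\<And>i. i < k \<Longrightarrow> p i = q i" "\<forall>j. V p k j" for k p q
        using that unfolding V_def by metis
      show "\<forall>j. V (\<lambda>_. 0) 0 j" using x unfolding V_def INT_iff Kiff by simp
      show "\<exists>v. \<forall>j. V (p(k := v)) (Suc k) j" if p: "\<forall>j. V p k j" for k p
      proof (rule ccontr)
        assume "\<nexists>v. \<forall>j. V (p(k := v)) (Suc k) j"
        then obtain j where j: "\<And>v. \<not> V (p(k := v)) (Suc k) (j v)" by metis
        \<comment> \<open>This depth is beyond the failure of each of the finitely many admissible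
          entries, and beyond \<open>k\<close>, so that the entry at \<open>k\<close> obeys its
          bound.\<close>
        define J where "J = Suc k + (\<Sum>v\<le>b k. j v)"
        obtain s where s: "\<forall>i<k. s i = p i" "\<forall>i<J. s i \<le> b i" "\<forall>n\<le>J. x \<in> F n s" using p unfolding V_def by blast
        have "s k \<le> b k" using s(2) unfolding J_def by simp
        then have "j (s k) \<le> (\<Sum>v\<le>b k. j v)" by (intro member_le_sum) auto
        then have "j (s k) \<le> J" unfolding J_def by simp
        moreover have "V (p(k := s k)) (Suc k) J" unfolding V_def using s by (intro exI[of _ s]) (auto simp: less_Suc_eq)
        ultimately show False using Vmono j by blast
      qed
    qed
    then obtain s where s: "\<And>k j. V s k j" by blast
    have "x \<in> F n s" for n
    proof -
      obtain s' where s': "\<forall>i<n. s' i = s i" "\<forall>k\<le>n. x \<in> F k s'" using s[of n n] unfolding V_def by blast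
      have "F n s' = F n s" by (rule F(2)) (use s'(1) in blast)
      then show ?thesis using s'(2) by blast
    qed
    then show "x \<in> A" unfolding AF by blast
  qed
  ultimately show ?thesis using tK by blast
qed

end

section \<open>Outer balayage\<close>

context balayage_space
begin

definition sw :: "'a measure \<Rightarrow> 'a set \<Rightarrow> 'a measure" where
  "sw \<sigma> A = (SOME \<eta>. bal \<sigma> A \<eta>)"

definition wcap :: "'a measure \<Rightarrow> 'a set \<Rightarrow> real" where
  "wcap \<sigma> A = en (sw \<sigma> A) (sw \<sigma> A)"

lemma sw_bal:
  assumes "\<sigma> \<in> P"
  shows "bal \<sigma> A (sw \<sigma> A)"
proof -
  obtain \<eta> where "bal \<sigma> A \<eta>" using bal_limit_energy[OF assms, of A] by blast
  then show ?thesis unfolding sw_def by (rule someI)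
qed

lemma sw_P: "\<sigma> \<in> P \<Longrightarrow> sw \<sigma> A \<in> P"
  using bal_P[OF sw_bal] .

lemma sw_PC: "\<sigma> \<in> P \<Longrightarrow> sw \<sigma> A \<in> PC A"
  using bal_PC[OF sw_bal] .

lemma sw_eq: "\<sigma> \<in> P \<Longrightarrow> bal \<sigma> A \<eta> \<Longrightarrow> sw \<sigma> A = \<eta>"
  by (rule bal_unique[OF sw_bal _ P_radon])

lemma en_sw: "\<sigma> \<in> P \<Longrightarrow> \<nu> \<in> PC A \<Longrightarrow> en (sw \<sigma> A) \<nu> = en \<sigma> \<nu>"
  by (rule bal_en[OF sw_bal])

lemma wcap_nonneg: "0 \<le> wcap \<sigma> A"
  unfolding wcap_def by (rule en_nn)

text \<open>Pythagoras for arbitrary nested sets: the measure swept onto \<open>A\<close> lies in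
  \<open>PC B\<close>, where the measure swept onto \<open>B\<close> and \<open>\<sigma>\<close>
  have equal mutual energies.\<close>

lemma sw_D:
  assumes \<sigma>: "\<sigma> \<in> P" and AB: "A \<subseteq> B"
  shows "D (sw \<sigma> B) (sw \<sigma> A) = wcap \<sigma> B - wcap \<sigma> A"
proof -
  have "en (sw \<sigma> B) (sw \<sigma> A) = en \<sigma> (sw \<sigma> A)" by (rule en_sw[OF \<sigma> PC_mono[OF sw_PC[OF \<sigma>] AB]])
  also have "\<dots> = en (sw \<sigma> A) (sw \<sigma> A)" by (rule en_sw[OF \<sigma> sw_PC[OF \<sigma>], symmetric])
  finally show ?thesis unfolding D_def wcap_def by simp
qed

lemma wcap_mono: "\<sigma> \<in> P \<Longrightarrow> A \<subseteq> B \<Longrightarrow> wcap \<sigma> A \<le> wcap \<sigma> B"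
  using sw_D[of \<sigma> A B] D_nonneg[OF sw_P sw_P, of \<sigma> \<sigma> B A] by simp

lemma wcap_compact_approx:
  assumes \<sigma>: "\<sigma> \<in> P" and t: "t < wcap \<sigma> A"
  shows "\<exists>K. compact K \<and> K \<subseteq> A \<and> t < wcap \<sigma> K"
proof -
  obtain \<eta> Ks \<eta>s where \<eta>: "bal \<sigma> A \<eta>" and Ks: "\<forall>n. compact (Ks n) \<and> Ks n \<subseteq> A \<and> bal \<sigma> (Ks n) (\<eta>s n)" and cv: "conv \<eta>s \<eta>"
    using bal_limit_energy[OF \<sigma>, of A] by blast
  have s: "sw \<sigma> (Ks n) = \<eta>s n" "sw \<sigma> A = \<eta>" for n using sw_eq[OF \<sigma>] Ks \<eta> by auto
  have "(\<lambda>n. en (\<eta>s n) (\<eta>s n)) \<longlonglongrightarrow> en \<eta> \<eta>"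
    by (rule conv_norm[OF bal_P bal_P[OF \<eta>] cv]) (use Ks in blast)
  then have "(\<lambda>n. wcap \<sigma> (Ks n)) \<longlonglongrightarrow> wcap \<sigma> A" unfolding wcap_def s .
  then have "eventually (\<lambda>n. t < wcap \<sigma> (Ks n)) sequentially" using t by (rule order_tendstoD(1))
  then obtain n where "t < wcap \<sigma> (Ks n)" by (auto simp: eventually_sequentially)
  then show ?thesis using Ks by blast
qed

text \<open>The value is approximated by that of a compact subset, which is already covered by one
  of the sets.\<close>

lemma wcap_open_incseq:
  assumes \<sigma>: "\<sigma> \<in> P" and U: "incseq U" "\<And>n :: nat. open (U n)" and t: "t < wcap \<sigma> (\<Union>n. U n)"
  shows "\<exists>n. t < wcap \<sigma> (U n)"
proof -
  obtain K where K: "compact K" "K \<subseteq> (\<Union>n. U n)" "t < wcap \<sigma> K" using wcap_compact_approx[OF \<sigma> t] by blast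
  obtain F where F: "finite F" "K \<subseteq> (\<Union>n\<in>F. U n)"
    using compactE_image[OF K(1), of UNIV U] U(2) K(2) by auto
  have "U n \<subseteq> U (Max (insert 0 F))" if "n \<in> F" for n
    using U(1) F(1) that by (auto simp: incseq_def)
  then have "K \<subseteq> U (Max (insert 0 F))" using F(2) by blast
  then show ?thesis using wcap_mono[OF \<sigma>] K(3) by (meson less_le_trans)
qed

text \<open>In general the swept measure is only a strong limit of measures concentrated on
  \<open>A\<close>, so domination is applied to its compact approximations and semicontinuity passes
  to the limit.\<close>

lemma sw_pot_mono:
  assumes \<sigma>: "\<sigma> \<in> P" and AB: "A \<subseteq> B"
  shows "pot (sw \<sigma> A) x \<le> pot (sw \<sigma> B) x"
proof -
  obtain \<eta> Ks \<eta>s where \<eta>: "bal \<sigma> A \<eta>" and Ks: "\<forall>n. compact (Ks n) \<and> Ks n \<subseteq> A \<and> bal \<sigma> (Ks n) (\<eta>s n)" and cv: "conv \<eta>s \<eta>"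
    using bal_limit_energy[OF \<sigma>, of A] by blast
  have \<eta>sP: "\<eta>s n \<in> P" for n using Ks bal_P by blast
  have le: "pot (\<eta>s n) x \<le> pot (sw \<sigma> B) x" for n
    using bal_pot_mono[of \<sigma> "Ks n" "\<eta>s n" B "sw \<sigma> B" x] Ks sw_bal[OF \<sigma>] AB by (meson subset_trans)
  have "pot \<eta> x \<le> liminf (\<lambda>n. pot (\<eta>s n) x)"
    by (rule conv_pot_liminf[OF \<eta>sP bal_P[OF \<eta>] cv])
  also have "\<dots> \<le> liminf (\<lambda>n :: nat. pot (sw \<sigma> B) x)"
    using le by (intro Liminf_mono always_eventually allI)
  finally show ?thesis unfolding sw_eq[OF \<sigma> \<eta>] by (simp add: Liminf_const)
qed

lemma en_mono_pot:
  assumes "a \<in> P" "b \<in> P" "\<nu> \<in> P" "\<And>x. pot a x \<le> pot b x"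
  shows "en a \<nu> \<le> en b \<nu>"
proof -
  have "mut \<nu> a \<le> mut \<nu> b" by (rule mut_mono_pot) (rule assms(4))
  then show ?thesis using assms(1-3) by (simp add: mut_en en_commute[of _ \<nu>] en_nn)
qed

text \<open>
  On \<open>A\<close> the potentials swept onto \<open>A\<close> and onto \<open>A \<union> B\<close> agree, while the one swept onto
  \<open>A \<inter> B\<close> is at most the one swept onto \<open>B\<close>.
\<close>

lemma wcap_strongly_subadditive:
  assumes \<sigma>: "\<sigma> \<in> P" and A: "A \<in> sets borel" and B: "B \<in> sets borel"
  shows "wcap \<sigma> (A \<union> B) + wcap \<sigma> (A \<inter> B) \<le> wcap \<sigma> A + wcap \<sigma> B"
proof -
  let ?u = "sw \<sigma> (A \<union> B)" and ?i = "sw \<sigma> (A \<inter> B)" and ?a = "sw \<sigma> A" and ?b = "sw \<sigma> B"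
  have half: "en ?u \<nu> + en ?i \<nu> \<le> en (sw \<sigma> C) \<nu> + en (sw \<sigma> C') \<nu>"
    if \<nu>: "\<nu> \<in> PA C" and C: "C \<subseteq> A \<union> B" "A \<inter> B \<subseteq> C'" for \<nu> C C'
  proof -
    have "en ?u \<nu> = en \<sigma> \<nu>" by (rule en_sw[OF \<sigma> PC_mono[OF PA_subset_PC[OF \<nu>] C(1)]])
    moreover have "en (sw \<sigma> C) \<nu> = en \<sigma> \<nu>" by (rule en_sw[OF \<sigma> PA_subset_PC[OF \<nu>]])
    moreover have "en ?i \<nu> \<le> en (sw \<sigma> C') \<nu>"
      by (rule en_mono_pot[OF sw_P[OF \<sigma>] sw_P[OF \<sigma>] PA_P[OF \<nu>]]) (rule sw_pot_mono[OF \<sigma> C(2)])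
    ultimately show ?thesis by simp
  qed
  have le: "en (radd ?u ?i) \<nu> \<le> en (radd ?a ?b) \<nu>" if \<nu>: "\<nu> \<in> PA (A \<union> B)" for \<nu>
  proof -
    note \<nu>P = PA_P[OF \<nu>]
    note r = P_radon[OF \<nu>P]
    note s = pos_radon_sets[OF r]
    \<comment> \<open>The measure is split along \<open>A\<close> and \<open>B - A\<close>;
      \<open>half\<close> is applied to the two parts with the roles of \<open>A\<close> and
      \<open>B\<close> exchanged.\<close>
    let ?x = "rrestrict \<nu> A" and ?y = "rrestrict \<nu> (B - A)"
    have x: "?x \<in> PA A" by (rule rrestrict_PA[OF \<nu>P A order_refl])
    have BA: "B - A \<in> sets borel" using A B by auto
    have y: "?y \<in> PA B" by (rule rrestrict_PA[OF \<nu>P BA]) auto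
    have AB: "A \<union> B \<in> sets borel" using A B by auto
    have out: "emeasure \<nu> (- (A \<union> B)) = 0" using \<nu> conc_borel[OF r AB] by (simp add: PA_def)
    have z: "emeasure \<nu> (C - (A \<union> B)) = 0" for C
    proof -
      have "emeasure \<nu> (C - (A \<union> B)) \<le> emeasure \<nu> (- (A \<union> B))"
      proof (rule emeasure_mono)
        show "C - (A \<union> B) \<subseteq> - (A \<union> B)" by blast
        show "- (A \<union> B) \<in> sets \<nu>" using AB unfolding s by (rule borel_comp)
      qed
      then show ?thesis using out by simp
    qed
    have "\<nu> = radd ?x ?y"
    proof (rule measure_eqI_borel[OF s sets_radd])
      fix C :: "'a set" assume C: "C \<in> sets borel"
      have "emeasure \<nu> C = emeasure \<nu> (A \<inter> C) + emeasure \<nu> (C - A)"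
        using A C s by (subst plus_emeasure) (auto intro!: arg_cong[where f="emeasure \<nu>"])
      also have "emeasure \<nu> (C - A) = emeasure \<nu> ((B - A) \<inter> C) + emeasure \<nu> (C - (A \<union> B))"
        using A B C s by (subst plus_emeasure) (auto intro!: arg_cong[where f="emeasure \<nu>"])
      also have "\<dots> = emeasure \<nu> ((B - A) \<inter> C)" using z by simp
      finally show "emeasure \<nu> C = emeasure (radd ?x ?y) C"
        using A BA C s by (simp add: emeasure_radd emeasure_rrestrict)
    qed
    then have "en c \<nu> = en c ?x + en c ?y" if "c \<in> P" for c
      using en_add_right[OF PA_P[OF x] PA_P[OF y] that] by simp
    moreover have "en ?u ?x + en ?i ?x \<le> en ?a ?x + en ?b ?x" by (rule half[OF x]) auto
    moreover have "en ?u ?y + en ?i ?y \<le> en ?b ?y + en ?a ?y" by (rule half[OF y]) auto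
    ultimately show ?thesis using sw_P[OF \<sigma>] \<nu>P by (simp add: en_add_left)
  qed
  have uP: "radd ?u ?i \<in> P" "radd ?a ?b \<in> P" using sw_P[OF \<sigma>] by (auto intro: radd_P)
  \<comment> \<open>Testing with \<open>?u\<close> itself turns the four mutual energies into the
    four values of \<open>wcap\<close>.\<close>
  have main: "en (radd ?u ?i) ?u \<le> en (radd ?a ?b) ?u" by (rule PC_le[OF uP le sw_PC[OF \<sigma>]])
  have e: "en (sw \<sigma> C) ?u = wcap \<sigma> C" if "C \<subseteq> A \<union> B" for C
  proof -
    have "en (sw \<sigma> C) ?u = en ?u (sw \<sigma> C)" by (rule en_commute[OF sw_P[OF \<sigma>] sw_P[OF \<sigma>]])
    also have "\<dots> = en \<sigma> (sw \<sigma> C)" by (rule en_sw[OF \<sigma> PC_mono[OF sw_PC[OF \<sigma>] that]])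
    also have "\<dots> = wcap \<sigma> C" unfolding wcap_def by (rule en_sw[OF \<sigma> sw_PC[OF \<sigma>], symmetric])
    finally show ?thesis .
  qed
  have "A \<inter> B \<subseteq> A \<union> B" by auto
  from main e[OF order_refl] e[OF this] e[of A] e[of B] show ?thesis
    using sw_P[OF \<sigma>] by (simp add: en_add_left)
qed

section \<open>The outer extension of the swept energy\<close>

definition outer_wcap :: "'a measure \<Rightarrow> 'a set \<Rightarrow> real" where
  "outer_wcap \<sigma> A = Inf (wcap \<sigma> ` {U. open U \<and> A \<subseteq> U})"

lemma outer_wcap_le: "open U \<Longrightarrow> A \<subseteq> U \<Longrightarrow> outer_wcap \<sigma> A \<le> wcap \<sigma> U"
  unfolding outer_wcap_def by (intro cInf_lower bdd_belowI2[of _ 0]) (auto simp: wcap_nonneg)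

lemma outer_wcap_ge: "(\<And>U. open U \<Longrightarrow> A \<subseteq> U \<Longrightarrow> t \<le> wcap \<sigma> U) \<Longrightarrow> t \<le> outer_wcap \<sigma> A"
  unfolding outer_wcap_def by (intro cInf_greatest) auto

lemma outer_wcap_less: "outer_wcap \<sigma> A < t \<Longrightarrow> \<exists>U. open U \<and> A \<subseteq> U \<and> wcap \<sigma> U < t"
  using outer_wcap_ge[of A t \<sigma>] by (meson not_le)

lemma outer_wcap_nonneg: "0 \<le> outer_wcap \<sigma> A"
  by (rule outer_wcap_ge) (rule wcap_nonneg)

lemma outer_wcap_mono: "A \<subseteq> B \<Longrightarrow> outer_wcap \<sigma> A \<le> outer_wcap \<sigma> B"
  by (rule outer_wcap_ge, rule outer_wcap_le) auto

text \<open>Plain subadditivity would add up the values of all \<open>A n\<close>; the strong form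
  subtracts the value of an intersection, an open set containing \<open>A n\<close>, so that only
  the geometric errors accumulate.\<close>

lemma outer_wcap_incseq:
  assumes \<sigma>: "\<sigma> \<in> P" and A: "incseq A" and t: "t < outer_wcap \<sigma> (\<Union>n :: nat. A n)"
  shows "\<exists>n. t < outer_wcap \<sigma> (A n)"
proof (rule ccontr)
  assume "\<nexists>n. t < outer_wcap \<sigma> (A n)"
  then have le: "outer_wcap \<sigma> (A n) \<le> t" for n by (simp add: not_less)
  \<comment> \<open>Half of the gap: the errors sum to at most \<open>e\<close> and cannot close
    it.\<close>
  define e where "e = (outer_wcap \<sigma> (\<Union>n. A n) - t) / 2"
  have e: "0 < e" using t unfolding e_def by simp
  have "\<exists>U. open U \<and> A n \<subseteq> U \<and> wcap \<sigma> U < outer_wcap \<sigma> (A n) + e * (1/2) ^ Suc n" for n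
    using e by (intro outer_wcap_less) simp
  then obtain U where U: "\<And>n. open (U n)" "\<And>n. A n \<subseteq> U n" "\<And>n. wcap \<sigma> (U n) < outer_wcap \<sigma> (A n) + e * (1/2) ^ Suc n" by metis
  define G where "G n = (\<Union>i\<le>n. U i)" for n
  have G: "open (G n)" for n unfolding G_def using U(1) by auto
  have Gb: "wcap \<sigma> (G n) \<le> outer_wcap \<sigma> (A n) + e * (1 - (1/2) ^ Suc n)" for n
  proof (induction n)
    case 0
    then show ?case using U(3)[of 0] by (simp add: G_def)
  next
    case (Suc n)
    have "G (Suc n) = G n \<union> U (Suc n)" unfolding G_def by (auto simp: atMost_Suc)
    then have "wcap \<sigma> (G (Suc n)) + wcap \<sigma> (G n \<inter> U (Suc n)) \<le> wcap \<sigma> (G n) + wcap \<sigma> (U (Suc n))"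
      using wcap_strongly_subadditive[OF \<sigma>, of "G n" "U (Suc n)"] G U(1) by simp
    moreover have "outer_wcap \<sigma> (A n) \<le> wcap \<sigma> (G n \<inter> U (Suc n))"
    proof (rule outer_wcap_le)
      show "open (G n \<inter> U (Suc n))" using G U(1) by auto
      have "A n \<subseteq> A (Suc n)" using A by (rule incseq_SucD)
      then show "A n \<subseteq> G n \<inter> U (Suc n)" using U(2)[of n] U(2)[of "Suc n"] unfolding G_def by blast
    qed
    ultimately have "wcap \<sigma> (G (Suc n)) \<le> outer_wcap \<sigma> (A (Suc n)) + e * (1 - (1/2) ^ Suc n) + e * (1/2) ^ Suc (Suc n)"
      using Suc U(3)[of "Suc n"] by linarith
    then show ?case by (simp add: algebra_simps)
  qed
  have "wcap \<sigma> (\<Union>n. G n) \<le> t + e"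
  proof (rule ccontr)
    assume "\<not> wcap \<sigma> (\<Union>n. G n) \<le> t + e"
    moreover have "incseq G" unfolding G_def incseq_def by (auto intro: order_trans)
    ultimately obtain n where "t + e < wcap \<sigma> (G n)" using wcap_open_incseq[OF \<sigma> _ G] by (meson not_le)
    moreover have "e * (1 - (1/2) ^ Suc n) \<le> e" using e by (simp add: mult_le_cancel_left1)
    ultimately show False using Gb[of n] le[of n] by linarith
  qed
  moreover have "outer_wcap \<sigma> (\<Union>n. A n) \<le> wcap \<sigma> (\<Union>n. G n)"
  proof (rule outer_wcap_le)
    show "open (\<Union>n. G n)" using G by auto
    have "A n \<subseteq> G n" for n using U(2)[of n] unfolding G_def by blast
    then show "(\<Union>n. A n) \<subseteq> (\<Union>n. G n)" by (intro UN_mono) auto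
  qed
  ultimately show False using e unfolding e_def by (simp add: field_simps)
qed

text \<open>An open set containing the intersection of decreasing compact sets contains one of
  them.\<close>

lemma outer_wcap_decseq:
  assumes K: "decseq K" "\<And>n :: nat. compact (K n)" and t: "\<And>n. t \<le> outer_wcap \<sigma> (K n)"
  shows "t \<le> outer_wcap \<sigma> (\<Inter>n. K n)"
proof (rule outer_wcap_ge)
  fix U assume U: "open U" "(\<Inter>n. K n) \<subseteq> U"
  have o: "open (- K n)" for n using K(2) by (simp add: compact_imp_closed open_Compl)
  have "K 0 \<subseteq> U \<union> (\<Union>n. - K n)" using U(2) by blast
  then have "K 0 - U \<subseteq> (\<Union>n. - K n)" by blast
  moreover have "compact (K 0 - U)" using K(2) U(1) by (simp add: compact_diff)
  ultimately obtain F where F: "finite F" "K 0 - U \<subseteq> (\<Union>n\<in>F. - K n)"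
    using compactE_image[of "K 0 - U" UNIV "\<lambda>n. - K n"] o by auto
  define N where "N = Max (insert 0 F)"
  have N: "K N \<subseteq> K n" if "n \<in> insert 0 F" for n
    using K(1) F(1) that unfolding N_def decseq_def by (auto intro: Max_ge)
  have "K N \<subseteq> U"
  proof
    fix x assume x: "x \<in> K N"
    show "x \<in> U"
    proof (rule ccontr)
      assume "x \<notin> U"
      moreover have "x \<in> K 0" using N x by blast
      ultimately obtain n where "n \<in> F" "x \<notin> K n" using F(2) by blast
      then show False using N x by blast
    qed
  qed
  then show "t \<le> wcap \<sigma> U" using t[of N] outer_wcap_le[OF U(1), of "K N" \<sigma>] by linarith
qed

text \<open>The complements of an exhaustion of \<open>- K\<close> are open neighbourhoods shrinking
  to \<open>K\<close>. By Pythagoras the measures swept onto them converge strongly; the limit is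
  carried by \<open>K\<close> and must vanish, so the energies tend to 0.\<close>

lemma outer_wcap_compact_null:
  assumes \<sigma>: "\<sigma> \<in> P" and K: "compact K" and null: "\<And>\<nu>. \<nu> \<in> PA K \<Longrightarrow> emeasure \<nu> UNIV = 0"
  shows "outer_wcap \<sigma> K = 0"
proof (rule ccontr)
  assume n0: "outer_wcap \<sigma> K \<noteq> 0"
  have oK: "open (- K)" using K by (simp add: compact_imp_closed open_Compl)
  obtain Q :: "nat \<Rightarrow> 'a set" where Q: "\<forall>n. compact (Q n)" "\<forall>n. Q n \<subseteq> interior (Q (Suc n))" "(\<Union>n. Q n) = - K"
    using compact_exhaustion[OF oK] by blast
  have Qm: "incseq Q" by (rule exhaustion_mono) (use Q(2) in blast)
  define U where "U n = - Q n" for n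
  have U: "open (U n)" "K \<subseteq> U n" for n
    using Q(1,3) unfolding U_def by (auto simp: compact_imp_closed open_Compl)
  have Um: "U m \<subseteq> U n" if "n \<le> m" for m n using Qm that unfolding U_def incseq_def by auto
  define w where "w n = wcap \<sigma> (U n)" for n
  have wdec: "decseq w" unfolding w_def decseq_def using wcap_mono[OF \<sigma> Um] by blast
  have wb: "0 \<le> w n" for n unfolding w_def by (rule wcap_nonneg)
  have wb': "\<forall>i. 0 \<le> w i" using wb by blast
  obtain L where L0: "w \<longlonglongrightarrow> L" "\<forall>n. L \<le> w n"
    by (rule decseq_convergent[OF wdec wb'])
  then have L: "w \<longlonglongrightarrow> L" "\<And>n. L \<le> w n" by auto
  have "\<exists>\<tau>\<in>P. conv (\<lambda>n. sw \<sigma> (U n)) \<tau>"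
  proof (rule conv_exists[OF sw_P[OF \<sigma>]])
    have "(\<lambda>n. w n - L) \<longlonglongrightarrow> L - L" by (intro tendsto_intros L)
    then show "(\<lambda>n. w n - L) \<longlonglongrightarrow> 0" by simp
    fix m n :: nat assume nm: "n \<le> m"
    have "D (sw \<sigma> (U m)) (sw \<sigma> (U n)) = D (sw \<sigma> (U n)) (sw \<sigma> (U m))" by (rule D_sym[OF sw_P[OF \<sigma>] sw_P[OF \<sigma>]])
    also have "\<dots> = w n - w m" unfolding w_def by (rule sw_D[OF \<sigma> Um[OF nm]])
    finally show "D (sw \<sigma> (U m)) (sw \<sigma> (U n)) \<le> w n - L" using L(2)[of m] by simp
  qed
  then obtain \<tau> where \<tau>: "\<tau> \<in> P" "conv (\<lambda>n. sw \<sigma> (U n)) \<tau>" by blast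
  note \<tau>r = P_radon[OF \<tau>(1)]
  \<comment> \<open>From stage \<open>k\<close> on, the swept measures give no mass to the interior
    of \<open>Q k\<close>, which is disjoint from \<open>U n\<close>.\<close>
  have z: "emeasure \<tau> (interior (Q k)) = 0" for k
  proof -
    have "emeasure (sw \<sigma> (U n)) (interior (Q k)) = 0" if "k \<le> n" for n
    proof (rule PC_null_open[OF sw_PC[OF \<sigma>] open_interior])
      have "Q k \<subseteq> Q n" using Qm that unfolding incseq_def by blast
      then show "interior (Q k) \<inter> U n = {}" unfolding U_def using interior_subset[of "Q k"] by blast
    qed
    then have ev: "eventually (\<lambda>n. emeasure (sw \<sigma> (U n)) (interior (Q k)) = 0) sequentially"
      unfolding eventually_sequentially by blast
    have "emeasure \<tau> (interior (Q k)) \<le> liminf (\<lambda>n. emeasure (sw \<sigma> (U n)) (interior (Q k)))"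
      by (rule vague_lim_open[OF \<tau>r P_radon[OF sw_P[OF \<sigma>]] conv_imp_vague_lim[OF sw_P[OF \<sigma>] \<tau>] open_interior])
    also have "\<dots> = liminf (\<lambda>n :: nat. 0)" using ev by (rule Liminf_eq)
    finally show ?thesis by (simp add: Liminf_const)
  qed
  have "(\<Union>k. interior (Q k)) = - K"
  proof
    show "(\<Union>k. interior (Q k)) \<subseteq> - K" unfolding Q(3)[symmetric] using interior_subset by blast
    show "- K \<subseteq> (\<Union>k. interior (Q k))" unfolding Q(3)[symmetric] using Q(2) by blast
  qed
  moreover have "emeasure \<tau> (\<Union>k. interior (Q k)) = 0"
    using z pos_radon_sets[OF \<tau>r] by (intro emeasure_UN_eq_0) auto
  ultimately have "conc K \<tau>" using conc_borel[OF \<tau>r compact_borel[OF K]] by simp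
  then have "\<tau> \<in> PA K" using \<tau>(1) unfolding PA_def by simp
  then have "emeasure \<tau> UNIV = 0" by (rule null)
  then have "UNIV \<in> null_sets \<tau>" using pos_radon_sets[OF \<tau>r] by auto
  from AE_not_in[OF this] have "AE x in \<tau>. pot \<tau> x = 0" by eventually_elim simp
  then have "mut \<tau> \<tau> = 0" unfolding mut_def using nn_integral_cong_AE[of "pot \<tau>" "\<lambda>_. 0" \<tau>] by simp
  then have e0: "en \<tau> \<tau> = 0" by (simp add: en_def)
  have "(\<lambda>n. en (sw \<sigma> (U n)) (sw \<sigma> (U n))) \<longlonglongrightarrow> en \<tau> \<tau>" by (rule conv_norm[OF sw_P[OF \<sigma>] \<tau>])
  then have "w \<longlonglongrightarrow> 0" unfolding w_def wcap_def e0 .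
  then have "outer_wcap \<sigma> K \<le> 0"
    by (rule LIMSEQ_le_const) (use outer_wcap_le[OF U] in \<open>auto simp: w_def\<close>)
  then show False using n0 outer_wcap_nonneg[of \<sigma> K] by simp
qed

lemma outer_wcap_null:
  assumes \<sigma>: "\<sigma> \<in> P" and N: "N \<in> sets borel" and 0: "inner_cap \<kappa> N = 0"
  shows "outer_wcap \<sigma> N = 0"
proof (rule ccontr)
  assume "outer_wcap \<sigma> N \<noteq> 0"
  then have pos: "0 < outer_wcap \<sigma> N" using outer_wcap_nonneg[of \<sigma> N] by simp
  then obtain t where t: "0 < t" "t < outer_wcap \<sigma> N" using dense by blast
  have "\<exists>K. compact K \<and> K \<subseteq> N \<and> t \<le> outer_wcap \<sigma> K"
    by (rule capacitability[where c="outer_wcap \<sigma>"])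
      (fact outer_wcap_mono outer_wcap_incseq[OF \<sigma>] outer_wcap_decseq N t(2))+
  then obtain K where K: "compact K" "K \<subseteq> N" "t \<le> outer_wcap \<sigma> K" by blast
  have "outer_wcap \<sigma> K = 0"
    by (rule outer_wcap_compact_null[OF \<sigma> K(1)]) (use 0 K in \<open>auto simp: inner_cap_eq_0_iff\<close>)
  then show False using K(3) t(1) by simp
qed

text \<open>A Chebyshev estimate: on \<open>V\<close> the potential of \<open>\<sigma>\<close> is at
  least 1 / k. For a measure on \<open>V\<close>, sweeping \<open>\<sigma>\<close> onto
  \<open>U\<close> preserves the mutual energy, to which Cauchy-Schwarz is applied.\<close>

lemma mass_le_wcap:
  assumes \<sigma>: "\<sigma> \<in> P" and \<nu>: "\<nu> \<in> P" and V: "V \<in> sets borel" "V \<subseteq> U" and k: "0 < k" "\<And>x. x \<in> V \<Longrightarrow> 1 \<le> ennreal k * pot \<sigma> x"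
  shows "emeasure \<nu> V \<le> ennreal (k * (sqrt (wcap \<sigma> U) * sqrt (en \<nu> \<nu>)))"
proof -
  let ?r = "rrestrict \<nu> V"
  have r: "?r \<in> PA U" by (rule rrestrict_PA[OF \<nu> V])
  note rP = PA_P[OF r]
  note s = pos_radon_sets[OF P_radon[OF \<nu>]]
  have Vs: "V \<in> sets \<nu>" using V s by simp
  have pm: "pot \<sigma> \<in> borel_measurable \<nu>" by (rule pot_measurable[OF P_radon[OF \<sigma>] s])
  have "emeasure \<nu> V = (\<integral>\<^sup>+x. indicator V x \<partial>\<nu>)" using Vs by simp
  also have "\<dots> \<le> (\<integral>\<^sup>+x. ennreal k * (indicator V x * pot \<sigma> x) \<partial>\<nu>)"
    using k(2) by (intro nn_integral_mono) (auto split: split_indicator)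
  also have "\<dots> = ennreal k * (\<integral>\<^sup>+x. indicator V x * pot \<sigma> x \<partial>\<nu>)"
    using Vs pm by (intro nn_integral_cmult) auto
  also have "(\<integral>\<^sup>+x. indicator V x * pot \<sigma> x \<partial>\<nu>) = mut ?r \<sigma>"
    unfolding mut_def by (rule nn_integral_rrestrict[OF Vs pm, symmetric])
  also have "mut ?r \<sigma> = ennreal (en (sw \<sigma> U) ?r)"
    unfolding en_sw[OF \<sigma> PA_subset_PC[OF r]] by (simp add: mut_en[OF rP \<sigma>] en_commute[OF rP \<sigma>])
  also have "ennreal k * \<dots> = ennreal (k * en (sw \<sigma> U) ?r)" using k(1) by (simp add: ennreal_mult en_nn)
  also have "\<dots> \<le> ennreal (k * (sqrt (wcap \<sigma> U) * sqrt (en \<nu> \<nu>)))"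
  proof (intro ennreal_leI mult_left_mono)
    have "en (sw \<sigma> U) ?r \<le> sqrt (wcap \<sigma> U) * sqrt (en ?r ?r)"
      unfolding wcap_def by (rule cauchy_schwarz[OF sw_P[OF \<sigma>] rP])
    also have "\<dots> \<le> sqrt (wcap \<sigma> U) * sqrt (en \<nu> \<nu>)"
    proof (intro mult_left_mono real_sqrt_le_mono)
      have "mut ?r ?r \<le> mut \<nu> \<nu>"
        by (rule mut_mono; (intro P_radon rP \<nu> rrestrict_le V; assumption)?)
      then show "en ?r ?r \<le> en \<nu> \<nu>" by (simp add: mut_en rP \<nu> en_nn)
    qed (simp add: wcap_nonneg)
    finally show "en (sw \<sigma> U) ?r \<le> sqrt (wcap \<sigma> U) * sqrt (en \<nu> \<nu>)" .
  qed (use k in simp)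
  finally show ?thesis .
qed

lemma outer_cap_nonneg: "0 \<le> outer_cap \<kappa> A"
  unfolding outer_cap_def by (intro INF_greatest inner_cap_nonneg)

lemma outer_cap_0_imp_inner_cap_0: "outer_cap \<kappa> N = 0 \<Longrightarrow> inner_cap \<kappa> N = 0"
proof -
  assume 0: "outer_cap \<kappa> N = 0"
  have "inner_cap \<kappa> N \<le> outer_cap \<kappa> N" unfolding outer_cap_def by (intro INF_greatest inner_cap_mono) auto
  then show "inner_cap \<kappa> N = 0" using 0 inner_cap_nonneg[of N] by simp
qed

text \<open>As the potential is positive on \<open>N\<close>, the sets where it exceeds 1 / (j + 1),
  each intersected with a neighbourhood of \<open>N\<close> of small \<open>wcap\<close>, cover
  \<open>N\<close>. A unit measure on their union must have large energy.\<close>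

lemma outer_cap_0I:
  assumes \<sigma>: "\<sigma> \<in> P" and N: "outer_wcap \<sigma> N = 0" "\<And>x. x \<in> N \<Longrightarrow> 0 < pot \<sigma> x"
  shows "outer_cap \<kappa> N = 0"
proof -
  have small: "outer_cap \<kappa> N \<le> ereal (e\<^sup>2)" if e: "0 < e" for e :: real
  proof -
    define k where "k j = real (Suc j)" for j
    \<comment> \<open>The choice compensates the factor \<open>k j\<close> lost on
      \<open>V j\<close> and makes the masses of all \<open>V j\<close> sum to at most
      \<open>e\<close> times the norm of the measure.\<close>
    define \<delta> where "\<delta> j = (e * (1/2) ^ Suc j / k j)\<^sup>2" for j
    have kpos: "0 < k j" for j unfolding k_def by simp
    have \<delta>: "0 < \<delta> j" for j unfolding \<delta>_def using e kpos[of j] by simp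
    have "\<exists>U. open U \<and> N \<subseteq> U \<and> wcap \<sigma> U < \<delta> j" for j using outer_wcap_less N(1) \<delta> by simp
    then obtain U where U: "\<And>j. open (U j)" "\<And>j. N \<subseteq> U j" "\<And>j. wcap \<sigma> (U j) < \<delta> j" by metis
    define V where "V j = U j \<inter> {x. ennreal (1 / k j) < pot \<sigma> x}" for j
    have V: "open (V j)" "V j \<subseteq> U j" for j
      unfolding V_def using U(1) pot_lsc[OF P_radon[OF \<sigma>]] by auto
    have NV: "N \<subseteq> (\<Union>j. V j)"
    proof
      fix x assume x: "x \<in> N"
      then have "0 < pot \<sigma> x" by (rule N(2))
      then obtain r where r: "0 < r" "ennreal r < pot \<sigma> x"
        by (metis dense ennreal_cases ennreal_less_zero_iff less_top top.not_eq_extremum order.strict_trans)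
      then obtain j where "1 / k j < r" unfolding k_def using nat_approx_posE by blast
      then have "ennreal (1 / k j) \<le> ennreal r" by (intro ennreal_leI) simp
      then have "ennreal (1 / k j) < pot \<sigma> x" using r(2) by (rule le_less_trans)
      then show "x \<in> (\<Union>j. V j)" unfolding V_def using x U(2) by blast
    qed
    have "inner_cap \<kappa> (\<Union>j. V j) \<le> ereal (e\<^sup>2)"
      unfolding inner_cap_def
    proof (rule SUP_least)
      fix K assume "K \<in> {K. compact K \<and> K \<subseteq> (\<Union>j. V j)}"
      then have K: "compact K" "K \<subseteq> (\<Union>j. V j)" by auto
      have "compact_cap \<kappa> K \<le> ereal (1 / (1 / e\<^sup>2))"
      proof (rule compact_cap_le[OF K(1)])
        show "0 < 1 / e\<^sup>2" using e by simp
        fix \<nu> assume \<nu>: "\<nu> \<in> PA K" "emeasure \<nu> UNIV = 1"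
        note \<nu>P = PA_P[OF \<nu>(1)]
        define s where "s = sqrt (en \<nu> \<nu>)"
        have s: "0 \<le> s" unfolding s_def by (simp add: en_nn)
        note ns = pos_radon_sets[OF P_radon[OF \<nu>P]]
        have b: "emeasure \<nu> (V j) \<le> ennreal (e * s * (1/2) ^ Suc j)" for j
        proof -
          have "emeasure \<nu> (V j) \<le> ennreal (k j * (sqrt (wcap \<sigma> (U j)) * s))"
            unfolding s_def
          proof (rule mass_le_wcap[OF \<sigma> \<nu>P _ V(2) kpos])
            show "V j \<in> sets borel" using V(1) by auto
            fix x assume "x \<in> V j"
            then have "ennreal (1 / k j) \<le> pot \<sigma> x" unfolding V_def by auto
            then have "ennreal (k j) * ennreal (1 / k j) \<le> ennreal (k j) * pot \<sigma> x" by (rule mult_left_mono) simp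
            then show "1 \<le> ennreal (k j) * pot \<sigma> x" using kpos[of j] by (simp flip: ennreal_mult)
          qed
          also have "\<dots> \<le> ennreal (k j * ((e * (1/2) ^ Suc j / k j) * s))"
          proof (intro ennreal_leI mult_left_mono mult_right_mono)
            have "sqrt (wcap \<sigma> (U j)) \<le> sqrt (\<delta> j)" using U(3)[of j] by (intro real_sqrt_le_mono) simp
            also have "\<dots> = e * (1/2) ^ Suc j / k j" unfolding \<delta>_def using e kpos[of j] by simp
            finally show "sqrt (wcap \<sigma> (U j)) \<le> e * (1/2) ^ Suc j / k j" .
          qed (use kpos[of j] s in auto)
          also have "k j * ((e * (1/2) ^ Suc j / k j) * s) = e * s * (1/2) ^ Suc j" using kpos[of j] by simp
          finally show ?thesis .
        qed
        have "1 = emeasure \<nu> K" using PA_compact_mass(1)[OF K(1) \<nu>(1)] \<nu>(2) by simp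
        also have "\<dots> \<le> emeasure \<nu> (\<Union>j. V j)" using K(2) V(1) ns by (intro emeasure_mono) auto
        also have "\<dots> \<le> (\<Sum>j. emeasure \<nu> (V j))"
          using V(1) ns by (intro emeasure_subadditive_countably) auto
        also have "\<dots> \<le> (\<Sum>j. ennreal (e * s * (1/2) ^ Suc j))" by (intro suminf_le b) auto
        also have "\<dots> = ennreal (\<Sum>j. e * s * (1/2) ^ Suc j)"
          using e s sums_mult[OF power_half_series, of "e * s"]
          by (intro suminf_ennreal2) (auto simp: sums_iff)
        also have "(\<Sum>j. e * s * (1/2) ^ Suc j) = e * s"
          using sums_mult[OF power_half_series, of "e * s"] by (simp add: sums_iff)
        finally have "1 \<le> e * s" using e s by simp
        then have "1 / e \<le> s" using e by (simp add: field_simps)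
        then have "(1 / e)\<^sup>2 \<le> s\<^sup>2" using e by (intro power_mono) auto
        also have "s\<^sup>2 = en \<nu> \<nu>" unfolding s_def by (simp add: en_nn)
        finally show "1 / e\<^sup>2 \<le> en \<nu> \<nu>" by (simp add: power_one_over)
      qed
      then show "compact_cap \<kappa> K \<le> ereal (e\<^sup>2)" by simp
    qed
    moreover have "outer_cap \<kappa> N \<le> inner_cap \<kappa> (\<Union>j. V j)"
      unfolding outer_cap_def using V(1) NV by (intro INF_lower) auto
    ultimately show ?thesis by (rule order_trans[rotated])
  qed
  have le: "outer_cap \<kappa> N \<le> ereal e" if "0 < e" for e
    using small[of "sqrt e"] that by simp
  have "outer_cap \<kappa> N \<le> 0"
    by (rule ereal_le_epsilon2) (use le in auto)
  then show ?thesis using outer_cap_nonneg[of N] by simp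
qed

lemma bal_exceptional_outer_cap:
  assumes \<sigma>: "\<sigma> \<in> P" and b: "bal \<sigma> A \<eta>" and A: "A \<in> sets borel"
  shows "outer_cap \<kappa> {x\<in>A. pot \<eta> x \<noteq> pot \<sigma> x} = 0"
proof (rule outer_cap_0I[OF \<sigma>])
  let ?N = "{x\<in>A. pot \<eta> x \<noteq> pot \<sigma> x}"
  have "{x. pot \<eta> x \<noteq> pot \<sigma> x} \<in> sets borel"
    using borel_measurable_neq[OF pot_borel[OF P_radon[OF bal_P[OF b]]] pot_borel[OF P_radon[OF \<sigma>]]] by (simp add: pred_def)
  then have "A \<inter> {x. pot \<eta> x \<noteq> pot \<sigma> x} \<in> sets borel" using A by auto
  moreover have "?N = A \<inter> {x. pot \<eta> x \<noteq> pot \<sigma> x}" by auto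
  ultimately have "?N \<in> sets borel" by simp
  then show "outer_wcap \<sigma> ?N = 0" by (rule outer_wcap_null[OF \<sigma> _ bal_exceptional_inner_cap[OF b]])
  \<comment> \<open>A minorant of \<open>pot \<sigma>\<close> that differs from it at
    \<open>x\<close> lies strictly below it, so \<open>pot \<sigma> x\<close> is positive.\<close>
  fix x assume "x \<in> ?N"
  then show "0 < pot \<sigma> x" using bal_pot_le[OF b, of x] by (auto simp: zero_less_iff_neq_zero)
qed

end

section \<open>A countable total set of measures of finite energy\<close>

context perfect_space
begin

lemma integral_eq_nn_integral_C0:
  assumes "pos_radon (m :: 'a measure)" "\<phi> \<in> C0" "\<And>x. 0 \<le> \<phi> x"
  shows "ennreal (\<integral>x. \<phi> x \<partial>m) = (\<integral>\<^sup>+x. ennreal (\<phi> x) \<partial>m)"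
  using C0_integrable[OF assms(1,2)] assms(3) by (intro nn_integral_eq_integral[symmetric]) auto

lemma C0_borel: "(\<phi> :: 'a \<Rightarrow> real) \<in> C0 \<Longrightarrow> (\<lambda>x. ennreal (\<phi> x)) \<in> borel_measurable borel"
  unfolding C0_def by (intro measurable_compose[OF borel_measurable_continuous_onI measurable_ennreal]) simp

lemma integral_mid:
  assumes p: "p \<in> P" and q: "q \<in> P" and \<phi>: "\<phi> \<in> C0" "\<And>x. 0 \<le> \<phi> x"
  shows "(\<integral>x. \<phi> x \<partial>mid p q) = ((\<integral>x. \<phi> x \<partial>p) + (\<integral>x. \<phi> x \<partial>q)) / 2"
proof -
  note pr = P_radon[OF p] and qr = P_radon[OF q]
  have nn: "0 \<le> (\<integral>x. \<phi> x \<partial>r)" for r by (rule integral_nonneg_AE) (simp add: \<phi>(2))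
  have mr: "pos_radon (mid p q)" unfolding mid_def by (intro pos_radon_rscale pos_radon_radd pr qr)
  have "ennreal (\<integral>x. \<phi> x \<partial>mid p q) = (\<integral>\<^sup>+x. ennreal (\<phi> x) \<partial>mid p q)"
    by (rule integral_eq_nn_integral_C0[OF mr \<phi>])
  also have "\<dots> = ennreal (1/2) * (\<integral>\<^sup>+x. ennreal (\<phi> x) \<partial>radd p q)"
    unfolding mid_def
    by (rule nn_integral_rscale) (use C0_borel[OF \<phi>(1)] measurable_cong_sets[OF sets_radd[of p q] refl] in blast)
  also have "(\<integral>\<^sup>+x. ennreal (\<phi> x) \<partial>radd p q) = (\<integral>\<^sup>+x. ennreal (\<phi> x) \<partial>p) + (\<integral>\<^sup>+x. ennreal (\<phi> x) \<partial>q)"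
    by (rule nn_integral_radd[OF pos_radon_sets[OF pr] pos_radon_sets[OF qr] C0_borel[OF \<phi>(1)]])
  also have "\<dots> = ennreal (\<integral>x. \<phi> x \<partial>p) + ennreal (\<integral>x. \<phi> x \<partial>q)"
    by (simp only: integral_eq_nn_integral_C0[OF pr \<phi>] integral_eq_nn_integral_C0[OF qr \<phi>])
  also have "\<dots> = ennreal ((\<integral>x. \<phi> x \<partial>p) + (\<integral>x. \<phi> x \<partial>q))" using nn by (simp add: ennreal_plus)
  also have "ennreal (1/2) * \<dots> = ennreal (1/2 * ((\<integral>x. \<phi> x \<partial>p) + (\<integral>x. \<phi> x \<partial>q)))"
    by (rule ennreal_mult[symmetric]) (use nn in auto)
  finally have "(\<integral>x. \<phi> x \<partial>mid p q) = 1/2 * ((\<integral>x. \<phi> x \<partial>p) + (\<integral>x. \<phi> x \<partial>q))"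
    using nn[of p] nn[of q] nn[of "mid p q"] by (subst (asm) ennreal_inj) auto
  then show ?thesis by simp
qed

text \<open>
  Every bounded part of the cone contains a countable vaguely dense subset. A measure \<open>\<mu>\<close> is thus a
  vague limit of a bounded sequence from a countable set; nearly norm-minimal elements of the
  convex sets \<open>C n\<close> of measures vaguely close to \<open>\<mu>\<close> form a strongly convergent sequence, whose
  limit must be \<open>\<mu>\<close>. No sequence is extracted: the elements of \<open>C n\<close> need only satisfy the linear
  relation to be transferred to \<open>\<mu>\<close>.
\<close>

lemma countable_total_set:
  "\<exists>E. countable E \<and> E \<subseteq> P \<and> (\<forall>a\<in>P. \<forall>b\<in>P. (\<forall>\<theta>\<in>E. en a \<theta> = en b \<theta>) \<longrightarrow> a = b)"
proof -
  obtain \<Phi> :: "('a \<Rightarrow> real) set" where \<Phi>: "countable \<Phi>" "\<Phi> \<subseteq> C0" "\<forall>\<phi>\<in>\<Phi>. \<forall>x. 0 \<le> \<phi> x"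
    and sep: "\<forall>p q. pos_radon p \<and> pos_radon q \<and> (\<forall>\<phi>\<in>\<Phi>. (\<integral>x. \<phi> x \<partial>p) = (\<integral>x. \<phi> x \<partial>q)) \<longrightarrow> p = q"
    using countable_separating_C0 by blast
  define \<phi> where "\<phi> = from_nat_into (insert (\<lambda>_. 0) \<Phi>)"
  have r\<phi>: "range \<phi> = insert (\<lambda>_. 0) \<Phi>" unfolding \<phi>_def using \<Phi>(1) by (intro range_from_nat_into) auto
  have \<phi>: "\<phi> k \<in> C0" "0 \<le> \<phi> k x" for k x
  proof -
    have "\<phi> k \<in> insert (\<lambda>_. 0) \<Phi>" using r\<phi> by blast
    moreover have "(\<lambda>_. 0) \<in> C0" unfolding C0_def by simp
    ultimately show "\<phi> k \<in> C0" "0 \<le> \<phi> k x" using \<Phi>(2,3) by auto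
  qed
  define \<iota> where "\<iota> m k = (\<integral>x. \<phi> k x \<partial>m)" for m k
  \<comment> \<open>Rational boxes for the first \<open>n\<close> integrals, with an integer bound
    on the energy, form a countable family; one measure is picked from each nonempty class.\<close>
  define cls where "cls r n q = {m\<in>P. en m m \<le> real r \<and> (\<forall>k<n. \<bar>\<iota> m k - of_rat (q ! k)\<bar> < 1 / Suc n)}"
    for r n :: nat and q :: "rat list"
  define pick where "pick = (\<lambda>(r, n, q). SOME m. m \<in> cls r n q)"
  define E where "E = pick ` {(r, n, q). cls r n q \<noteq> {}}"
  have pick: "pick (r, n, q) \<in> cls r n q" if "cls r n q \<noteq> {}" for r n q
    unfolding pick_def using that by (simp add: some_in_eq)
  have "countable E" unfolding E_def by (intro countable_image countableI_type)
  moreover have "E \<subseteq> P" unfolding E_def using pick by (auto simp: cls_def)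
  moreover have "a = b" if a: "a \<in> P" and b: "b \<in> P" and ab: "\<forall>\<theta>\<in>E. en a \<theta> = en b \<theta>" for a b
  proof -
    have eq: "en a \<mu> = en b \<mu>" if \<mu>: "\<mu> \<in> P" for \<mu>
    proof -
      obtain r :: nat where r: "en \<mu> \<mu> \<le> real r" using real_arch_simple by blast
      define C where "C n = {\<nu>\<in>P. (\<forall>k<n. \<bar>\<iota> \<nu> k - \<iota> \<mu> k\<bar> \<le> 2 / Suc n) \<and> en a \<nu> = en b \<nu>}" for n :: nat
      have CP: "\<nu> \<in> P" if "\<nu> \<in> C n" for \<nu> n using that unfolding C_def by simp
      have ne: "\<exists>\<nu>\<in>C n. en \<nu> \<nu> \<le> real r" for n
      proof -
        have "\<exists>q. \<bar>\<iota> \<mu> k - of_rat q\<bar> < 1 / Suc n" for k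
        proof -
          obtain q where "\<iota> \<mu> k - 1 / Suc n < of_rat q" "of_rat q < \<iota> \<mu> k"
            using of_rat_dense[of "\<iota> \<mu> k - 1 / Suc n" "\<iota> \<mu> k"] by auto
          then show ?thesis by (intro exI[of _ q]) linarith
        qed
        then obtain q where q: "\<And>k. \<bar>\<iota> \<mu> k - of_rat (q k)\<bar> < 1 / Suc n" by metis
        let ?q = "map q [0..<n]"
        have "\<mu> \<in> cls r n ?q" unfolding cls_def using \<mu> r q by simp
        then have "cls r n ?q \<noteq> {}" by blast
        then have p: "pick (r, n, ?q) \<in> cls r n ?q" "pick (r, n, ?q) \<in> E" using pick unfolding E_def by auto
        have "\<bar>\<iota> (pick (r, n, ?q)) k - \<iota> \<mu> k\<bar> \<le> 2 / Suc n" if "k < n" for k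
        proof -
          have "\<bar>\<iota> (pick (r, n, ?q)) k - of_rat (q k)\<bar> < 1 / Suc n" using p(1) that unfolding cls_def by auto
          moreover have "2 / real (Suc n) = 1 / Suc n + 1 / Suc n" by simp
          ultimately show ?thesis using q[of k] by linarith
        qed
        then have "pick (r, n, ?q) \<in> C n" unfolding C_def using p ab by (auto simp: cls_def)
        then show ?thesis using p(1) by (auto simp: cls_def)
      qed
      have Cdec: "C m \<subseteq> C n" if "n \<le> m" for m n
      proof
        fix \<nu> assume \<nu>: "\<nu> \<in> C m"
        have "2 / real (Suc m) \<le> 2 / Suc n" using that by (simp add: frac_le)
        moreover have "\<bar>\<iota> \<nu> k - \<iota> \<mu> k\<bar> \<le> 2 / real (Suc m)" if "k < n" for k
          using \<nu> that \<open>n \<le> m\<close> unfolding C_def by simp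
        ultimately have "\<bar>\<iota> \<nu> k - \<iota> \<mu> k\<bar> \<le> 2 / real (Suc n)" if "k < n" for k
          using that by (meson order_trans)
        then show "\<nu> \<in> C n" using \<nu> unfolding C_def by simp
      qed
      have midC: "mid \<nu> \<rho> \<in> C n" if "\<nu> \<in> C n" "\<rho> \<in> C n" for \<nu> \<rho> n
      proof -
        note P = CP[OF that(1)] CP[OF that(2)]
        have \<iota>: "\<iota> (mid \<nu> \<rho>) k = (\<iota> \<nu> k + \<iota> \<rho> k) / 2" for k unfolding \<iota>_def by (rule integral_mid[OF P \<phi>])
        have "\<bar>\<iota> (mid \<nu> \<rho>) k - \<iota> \<mu> k\<bar> \<le> 2 / Suc n" if "k < n" for k
        proof -
          have "\<bar>\<iota> \<nu> k - \<iota> \<mu> k\<bar> \<le> 2 / Suc n" "\<bar>\<iota> \<rho> k - \<iota> \<mu> k\<bar> \<le> 2 / Suc n"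
            using \<open>\<nu> \<in> C n\<close> \<open>\<rho> \<in> C n\<close> that unfolding C_def by auto
          then show ?thesis unfolding \<iota> by (auto simp: abs_le_iff field_simps)
        qed
        moreover have "en a (mid \<nu> \<rho>) = en b (mid \<nu> \<rho>)"
          using that P a b unfolding C_def mid_def by (simp add: en_simps)
        moreover have "mid \<nu> \<rho> \<in> P" unfolding mid_def using P by (intro rscale_P radd_P)
        ultimately show ?thesis unfolding C_def by blast
      qed
      \<comment> \<open>The sets \<open>C n\<close> shrink and each has an element of energy at most
        \<open>r\<close>, so the infima increase to a finite limit \<open>j\<close>; the difference
        \<open>j - I n\<close> is the error allowed at midpoints.\<close>
      define I where "I n = Inf ((\<lambda>\<nu>. en \<nu> \<nu>) ` C n)" for n
      have bb: "bdd_below ((\<lambda>\<nu>. en \<nu> \<nu>) ` C n)" for n by (intro bdd_belowI2[of _ 0]) (simp add: en_nn)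
      have Ile: "I n \<le> en \<nu> \<nu>" if "\<nu> \<in> C n" for n \<nu> unfolding I_def using bb that by (intro cInf_lower) auto
      have Cne: "C n \<noteq> {}" for n using ne by blast
      have "incseq I"
        unfolding incseq_def I_def
      proof (intro allI impI cInf_superset_mono)
        fix m n :: nat assume mn: "m \<le> n"
        show "(\<lambda>\<nu>. en \<nu> \<nu>) ` C n \<noteq> {}" using Cne by blast
        show "bdd_below ((\<lambda>\<nu>. en \<nu> \<nu>) ` C m)" by (rule bb)
        show "(\<lambda>\<nu>. en \<nu> \<nu>) ` C n \<subseteq> (\<lambda>\<nu>. en \<nu> \<nu>) ` C m" using Cdec[OF mn] by (rule image_mono)
      qed
      moreover have "I n \<le> real r" for n using ne[of n] Ile by (meson order_trans)
      then have "\<forall>n. I n \<le> real r" by blast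
      ultimately obtain j where j: "I \<longlonglongrightarrow> j" "\<forall>n. I n \<le> j" by (rule incseq_convergent)
      have "\<exists>\<nu>\<in>C n. en \<nu> \<nu> < I n + 1 / Suc n" for n
      proof -
        have "I n < I n + 1 / Suc n" by simp
        then have "\<exists>y\<in>(\<lambda>\<nu>. en \<nu> \<nu>) ` C n. y < I n + 1 / Suc n"
          using cInf_less_iff[of "(\<lambda>\<nu>. en \<nu> \<nu>) ` C n"] bb[of n] Cne[of n] unfolding I_def by blast
        then show ?thesis by blast
      qed
      then obtain u where u: "\<And>n. u n \<in> C n" "\<And>n. en (u n) (u n) < I n + 1 / Suc n" by metis
      note uP = CP[OF u(1)]
      have lim1: "(\<lambda>n. 1 / real (Suc n)) \<longlonglongrightarrow> 0" by (rule LIMSEQ_Suc[OF lim_1_over_n])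
      have up: "en (u n) (u n) \<le> j + 1 / Suc n" for n using u(2)[of n] j(2)[rule_format, of n] by linarith
      have upl: "(\<lambda>n. j + 1 / real (Suc n)) \<longlonglongrightarrow> j + 0" by (intro tendsto_intros lim1)
      have elim: "(\<lambda>n. en (u n) (u n)) \<longlonglongrightarrow> j"
        by (rule tendsto_sandwich[OF _ _ j(1)]) (use upl up Ile[OF u(1)] in auto)
      have dl: "(\<lambda>n. j - I n) \<longlonglongrightarrow> 0" using tendsto_diff[OF tendsto_const[of j] j(1)] by simp
      have "\<exists>c\<in>P. conv u c"
      proof (rule conv_exists_minimizing[where L="\<lambda>_. 0" and j=j and \<epsilon>="\<lambda>n. 1 / real (Suc n)" and \<delta>="\<lambda>n. j - I n"])
        fix m n :: nat assume nm: "n \<le> m"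
        have "u m \<in> C n" using Cdec[OF nm] u(1) by blast
        then have "I n \<le> en (mid (u m) (u n)) (mid (u m) (u n))" by (intro Ile midC u(1))
        then show "j - (j - I n) \<le> en (mid (u m) (u n)) (mid (u m) (u n)) - 2 * 0" by simp
        show "1 / real (Suc m) \<le> 1 / real (Suc n)" using nm by (simp add: frac_le)
      qed (use uP elim up lim1 dl in \<open>auto simp del: of_nat_Suc\<close>)
      then obtain c where c: "c \<in> P" "conv u c" by blast
      have "\<iota> c k = \<iota> \<mu> k" for k
      proof (rule LIMSEQ_unique)
        show "(\<lambda>n. \<iota> (u n) k) \<longlonglongrightarrow> \<iota> c k"
          using conv_imp_vague_lim[OF uP c] \<phi>(1) unfolding vague_lim_def \<iota>_def by blast
        have l2: "(\<lambda>n. 2 * (1 / real (Suc n))) \<longlonglongrightarrow> 0" using tendsto_mult_right_zero[OF lim1, of 2] by simp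
        have "eventually (\<lambda>n. norm (\<iota> (u n) k - \<iota> \<mu> k) \<le> 2 * (1 / real (Suc n))) sequentially"
          using eventually_gt_at_top[of k]
        proof eventually_elim
          case (elim n)
          then show ?case using u(1)[of n] unfolding C_def by auto
        qed
        then have "(\<lambda>n. \<iota> (u n) k - \<iota> \<mu> k) \<longlonglongrightarrow> 0" by (rule Lim_null_comparison[OF _ l2])
        then show "(\<lambda>n. \<iota> (u n) k) \<longlonglongrightarrow> \<iota> \<mu> k" by (simp add: LIM_zero_iff)
      qed
      moreover have "\<exists>k. f = \<phi> k" if "f \<in> \<Phi>" for f using r\<phi> that by (metis insertCI rangeE)
      ultimately have "\<forall>f\<in>\<Phi>. (\<integral>x. f x \<partial>c) = (\<integral>x. f x \<partial>\<mu>)" unfolding \<iota>_def by blast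
      then have c\<mu>: "c = \<mu>" using sep P_radon[OF c(1)] P_radon[OF \<mu>] by blast
      have "en (u n) a = en (u n) b" for n
        using u(1)[of n] en_commute[OF a uP[of n]] en_commute[OF b uP[of n]] unfolding C_def by simp
      then have "en c a = en c b"
        using conv_en[OF uP c a] conv_en[OF uP c b] LIMSEQ_unique by simp
      then show ?thesis unfolding c\<mu> using en_commute a b \<mu> by simp
    qed
    \<comment> \<open>The relation for \<open>\<mu> = a\<close> and for \<open>\<mu> = b\<close>
      makes the squared distance of \<open>a\<close> and \<open>b\<close> vanish.\<close>
    show "a = b" using eq[OF a] eq[OF b] en_commute[OF a b] by (intro D_eq_0D[OF a b]) (simp add: D_def)
  qed
  ultimately show ?thesis by blast
qed

text \<open>Here \<open>\<xi>\<close> may have infinite energy: finiteness of its mutual energies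
  with \<open>a\<close> and \<open>b\<close> suffices, because these dominate the Jordan parts of
  the difference.\<close>

lemma energy_diff_mutual:
  assumes d: "diff_eq (pos_var \<eta>) (neg_var \<eta>) a b" and ab: "pos_radon a" "pos_radon b"
    and fin: "mut a (pos_var \<xi>) < \<infinity>" "mut a (neg_var \<xi>) < \<infinity>" "mut b (pos_var \<xi>) < \<infinity>" "mut b (neg_var \<xi>) < \<infinity>"
  shows "energy_defined \<kappa> \<eta> \<xi>"
    and "energy \<kappa> \<eta> \<xi> = ereal ((en a (pos_var \<xi>) - en b (pos_var \<xi>)) - (en a (neg_var \<xi>) - en b (neg_var \<xi>)))"
proof -
  let ?p = "pos_var \<eta>" and ?q = "neg_var \<eta>"
  note pr = pos_radon_pos_var[of \<eta>] pos_radon_neg_var[of \<eta>]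
  have main: "mut ?p m < \<infinity> \<and> mut ?q m < \<infinity> \<and> en ?p m - en ?q m = en a m - en b m"
    if m: "pos_radon m" and f: "mut a m < \<infinity>" "mut b m < \<infinity>" for m
  proof -
    have "mut ?p m \<le> mut a m" by (rule mut_mono_left[OF pr(1) ab(1) m diff_eq_dominated(1)[OF d ab]])
    then have fp: "mut ?p m < \<infinity>" using f(1) by (rule le_less_trans)
    have "mut ?q m \<le> mut b m" by (rule mut_mono_left[OF pr(2) ab(2) m diff_eq_dominated(2)[OF d ab]])
    then have fq: "mut ?q m < \<infinity>" using f(2) by (rule le_less_trans)
    have "mut ?p m + mut b m = mut ?q m + mut a m"
      using d mut_radd_left[OF pr(1) ab(2) m] mut_radd_left[OF pr(2) ab(1) m] unfolding diff_eq_def by simp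
    then have "ennreal (en ?p m + en b m) = ennreal (en ?q m + en a m)"
      using f fp fq by (simp add: en_def ennreal_plus)
    then have "en ?p m + en b m = en ?q m + en a m" using en_nn[of ?p m] en_nn[of b m] en_nn[of ?q m] en_nn[of a m]
      by (subst (asm) ennreal_inj) auto
    then show ?thesis using fp fq by simp
  qed
  note m1 = main[OF pos_radon_pos_var fin(1,3)] and m2 = main[OF pos_radon_neg_var fin(2,4)]
  have plus: "energy_plus \<kappa> \<eta> \<xi> = ennreal (en ?p (pos_var \<xi>) + en ?q (neg_var \<xi>))"
    unfolding energy_plus_eq using m1 m2 by (simp add: en_def ennreal_plus)
  have minus: "energy_minus \<kappa> \<eta> \<xi> = ennreal (en ?p (neg_var \<xi>) + en ?q (pos_var \<xi>))"
    unfolding energy_minus_eq using m1 m2 by (simp add: en_def ennreal_plus)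
  show "energy_defined \<kappa> \<eta> \<xi>" unfolding energy_defined_def plus by (simp del: ennreal_plus)
  have "energy \<kappa> \<eta> \<xi> = ereal (en ?p (pos_var \<xi>) + en ?q (neg_var \<xi>) - (en ?p (neg_var \<xi>) + en ?q (pos_var \<xi>)))"
    unfolding energy_def plus minus by (simp add: enn2ereal_ennreal en_nn del: ennreal_plus)
  moreover have "en ?p (pos_var \<xi>) + en ?q (neg_var \<xi>) - (en ?p (neg_var \<xi>) + en ?q (pos_var \<xi>)) =
      (en a (pos_var \<xi>) - en b (pos_var \<xi>)) - (en a (neg_var \<xi>) - en b (neg_var \<xi>))"
    using m1 m2 by linarith
  ultimately show "energy \<kappa> \<eta> \<xi> = ereal ((en a (pos_var \<xi>) - en b (pos_var \<xi>)) - (en a (neg_var \<xi>) - en b (neg_var \<xi>)))" by simp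
qed

end

section \<open>The characterization of swept measures\<close>

context balayage_space
begin

lemma sweepable_bal_exists:
  assumes \<omega>: "pos_radon \<omega>" and s: "sweepable \<kappa> A (of_pos_radon \<omega>)"
  shows "\<exists>\<eta>. bal \<omega> A \<eta>"
proof -
  have fin: "emeasure \<omega> UNIV < \<infinity>" using s \<omega> by (simp add: sweepable_def bounded_radon_def)
  define S where "S = (SUP x\<in>A. potential \<kappa> (of_pos_radon \<omega>) x)"
  have S: "S < \<infinity>" using s unfolding sweepable_def S_def by simp
  \<comment> \<open>The maximum keeps the constant positive, also for empty \<open>A\<close>, where
    the supremum is minus infinity.\<close>
  define c where "c = max 1 (real_of_ereal S)"
  have c: "0 < c" unfolding c_def by simp
  have Sc: "S \<le> ereal c" using S unfolding c_def by (cases S) auto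
  have le: "pot \<omega> x \<le> ennreal c" if "x \<in> A" for x
  proof -
    have "potential \<kappa> (of_pos_radon \<omega>) x \<le> S" unfolding S_def using that by (rule SUP_upper)
    then have "enn2ereal (pot \<omega> x) \<le> ereal c" using Sc unfolding potential_of_pos_radon[OF \<omega>] by (rule order_trans)
    then show ?thesis using c by (simp add: less_eq_ennreal.rep_eq enn2ereal_ennreal)
  qed
  show ?thesis
  proof (rule bal_bounded_exists[OF \<omega> fin c le])
    fix K assume K: "compact K" "K \<subseteq> A"
    have ck: "continuous_on K (potential \<kappa> (of_pos_radon \<omega>))" using s K unfolding sweepable_def by blast
    have "continuous_on K (\<lambda>x. real_of_ereal (potential \<kappa> (of_pos_radon \<omega>) x))"
    proof (rule continuous_on_compose2[OF continuous_on_real ck])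
      show "potential \<kappa> (of_pos_radon \<omega>) ` K \<subseteq> UNIV - {\<infinity>, - \<infinity>}"
      proof
        fix y assume "y \<in> potential \<kappa> (of_pos_radon \<omega>) ` K"
        then obtain x where x: "x \<in> K" "y = enn2ereal (pot \<omega> x)" by (auto simp: potential_of_pos_radon[OF \<omega>])
        have "pot \<omega> x < \<infinity>" using le[of x] x(1) K(2) by (auto simp: le_less_trans[OF _ ennreal_less_top])
        then have "y \<noteq> \<infinity>" using x(2) by (simp add: enn2ereal_eq_top_iff)
        moreover have "0 \<le> y" using x(2) by (simp add: enn2ereal_nonneg)
        ultimately show "y \<in> UNIV - {\<infinity>, - \<infinity>}" by auto
      qed
    qed
    then show "continuous_on K (\<lambda>x. enn2real (pot \<omega> x))"
      unfolding potential_of_pos_radon[OF \<omega>] enn2real_def .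
  qed
qed

text \<open>The choice of capacity enters only through the identification of swept measures in
  \<open>swept\<close>. Reciprocity rewrites both sides of the relation as mutual energies of
  \<open>\<eta>1\<close> and \<open>\<eta>2\<close> with elements of \<open>P\<close>.\<close>

lemma determined:
  assumes E: "E \<subseteq> P" and total: "\<And>a b. a \<in> P \<Longrightarrow> b \<in> P \<Longrightarrow> (\<And>\<theta>. \<theta> \<in> E \<Longrightarrow> en a \<theta> = en b \<theta>) \<Longrightarrow> a = b"
    and s: "sweepable \<kappa> A (pos_part \<xi>)" "sweepable \<kappa> A (neg_part \<xi>)"
    and swept: "\<And>\<sigma> \<sigma>'. \<sigma> \<in> P \<Longrightarrow> bal \<sigma> A \<sigma>' \<Longrightarrow> swept_energy cap \<kappa> A (of_pos_radon \<sigma>) = of_pos_radon \<sigma>'"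
  shows "determined_within_energy_space cap \<kappa> (of_pos_radon ` E) A \<xi>"
proof -
  let ?p = "pos_var \<xi>" and ?q = "neg_var \<xi>"
  note pr = pos_radon_pos_var[of \<xi>] pos_radon_neg_var[of \<xi>]
  obtain \<eta>1 where \<eta>1: "bal ?p A \<eta>1" using sweepable_bal_exists[OF pr(1)] s(1) unfolding pos_part_def by blast
  obtain \<eta>2 where \<eta>2: "bal ?q A \<eta>2" using sweepable_bal_exists[OF pr(2)] s(2) unfolding neg_part_def by blast
  note P1 = bal_P[OF \<eta>1] and P2 = bal_P[OF \<eta>2]
  define \<zeta>0 where "\<zeta>0 = of_pos_radon \<eta>1 - of_pos_radon \<eta>2"
  have sw: "swept cap \<kappa> A \<xi> = \<zeta>0"
    unfolding swept_def pos_part_def neg_part_def \<zeta>0_def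
    by (simp only: swept_pos_eq[OF pr(1) \<eta>1 swept] swept_pos_eq[OF pr(2) \<eta>2 swept])
  have d0: "diff_eq (pos_var \<zeta>0) (neg_var \<zeta>0) \<eta>1 \<eta>2"
    unfolding \<zeta>0_def by (rule minus_of_pos_radon[OF P_radon[OF P1] P_radon[OF P2]])
  have null: "null_measure borel \<in> P" by (rule PA_P[OF null_PA])
  \<comment> \<open>The negative part of a positive \<open>\<theta>\<close> is the null measure,
    whose swept measure has to be carried along; reciprocity shows that it contributes
    nothing.\<close>
  obtain z where z: "bal (null_measure borel) A z" using bal_limit_energy[OF null, of A] by blast
  note zP = bal_P[OF z]
  have zm: "mut z \<omega> = 0" if "pos_radon \<omega>" "bal \<omega> A \<eta>" for \<omega> \<eta>
    using bal_reciprocity[OF that null z] by simp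
  have e0: "energy_defined \<kappa> \<zeta>0 (of_pos_radon t) \<and> energy \<kappa> \<zeta>0 (of_pos_radon t) = ereal (en \<eta>1 t - en \<eta>2 t)" if t: "t \<in> P" for t
  proof -
    note tr = P_radon[OF t]
    have f: "mut \<eta>1 (pos_var (of_pos_radon t)) < \<infinity>" "mut \<eta>1 (neg_var (of_pos_radon t)) < \<infinity>"
      "mut \<eta>2 (pos_var (of_pos_radon t)) < \<infinity>" "mut \<eta>2 (neg_var (of_pos_radon t)) < \<infinity>"
      using mut_finite[OF P1 t] mut_finite[OF P2 t] by (simp_all add: tr)
    from energy_diff_mutual[OF d0 P_radon[OF P1] P_radon[OF P2] f]
    show ?thesis by (simp add: tr en_def)
  qed
  have e1: "energy_defined \<kappa> (swept_energy_signed cap \<kappa> A (of_pos_radon t)) \<xi> \<and>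
      energy \<kappa> (swept_energy_signed cap \<kappa> A (of_pos_radon t)) \<xi> = ereal (en \<eta>1 t - en \<eta>2 t)" if t: "t \<in> P" for t
  proof -
    note tr = P_radon[OF t]
    obtain t' where t': "bal t A t'" using bal_limit_energy[OF t, of A] by blast
    note t'P = bal_P[OF t']
    have "swept_energy_signed cap \<kappa> A (of_pos_radon t) = of_pos_radon t' - of_pos_radon z"
      unfolding swept_energy_signed_def pos_part_def neg_part_def
      by (simp add: tr swept[OF t t'] swept[OF null z])
    then have d: "diff_eq (pos_var (swept_energy_signed cap \<kappa> A (of_pos_radon t))) (neg_var (swept_energy_signed cap \<kappa> A (of_pos_radon t))) t' z"
      using minus_of_pos_radon[OF P_radon[OF t'P] P_radon[OF zP]] by simp
    have m: "mut t' ?p = mut \<eta>1 t" "mut t' ?q = mut \<eta>2 t" "mut z ?p = 0" "mut z ?q = 0"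
      using bal_reciprocity[OF pr(1) \<eta>1 t t'] bal_reciprocity[OF pr(2) \<eta>2 t t'] zm[OF pr(1) \<eta>1] zm[OF pr(2) \<eta>2] by auto
    have f: "mut t' ?p < \<infinity>" "mut t' ?q < \<infinity>" "mut z ?p < \<infinity>" "mut z ?q < \<infinity>"
      unfolding m using mut_finite[OF P1 t] mut_finite[OF P2 t] by simp_all
    from energy_diff_mutual[OF d P_radon[OF t'P] P_radon[OF zP] f]
    show ?thesis by (simp add: en_def m)
  qed
  show ?thesis
    unfolding determined_within_energy_space_def sw
  proof (intro conjI ballI impI)
    show "\<zeta>0 \<in> energy_space \<kappa>" unfolding energy_space_iff_P using energy_diff_eq(1,2)[OF d0 P1 P2] by simp
    show "energies_agree \<kappa> \<zeta>0 \<theta> (swept_energy_signed cap \<kappa> A \<theta>) \<xi>" if \<theta>: "\<theta> \<in> of_pos_radon ` E" for \<theta>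
    proof -
      obtain t where t: "t \<in> P" "\<theta> = of_pos_radon t" using \<theta> E by blast
      show ?thesis unfolding energies_agree_def t(2) using e0[OF t(1)] e1[OF t(1)] by simp
    qed
    fix \<zeta> assume \<zeta>: "\<zeta> \<in> energy_space \<kappa>"
      and a: "\<forall>\<theta>\<in>of_pos_radon ` E. energies_agree \<kappa> \<zeta> \<theta> (swept_energy_signed cap \<kappa> A \<theta>) \<xi>"
    have \<zeta>P: "pos_var \<zeta> \<in> P" "neg_var \<zeta> \<in> P" using \<zeta> unfolding energy_space_iff_P by auto
    \<comment> \<open>Negative terms are moved across, so that totality of \<open>E\<close> is
      applied to two positive measures of finite energy.\<close>
    have "radd (pos_var \<zeta>) \<eta>2 = radd (neg_var \<zeta>) \<eta>1"
    proof (rule total[OF radd_P[OF \<zeta>P(1) P2] radd_P[OF \<zeta>P(2) P1]])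
      fix t assume tE: "t \<in> E"
      then have t: "t \<in> P" using E by blast
      note tr = P_radon[OF t]
      have "energy \<kappa> \<zeta> (of_pos_radon t) = ereal (en \<eta>1 t - en \<eta>2 t)"
        using a tE e1[OF t] unfolding energies_agree_def by auto
      moreover have "energy \<kappa> \<zeta> (of_pos_radon t) = ereal (en (pos_var \<zeta>) t - en (neg_var \<zeta>) t)"
        using energy_P(2)[OF \<zeta>P, of "of_pos_radon t"] t null by (simp add: tr en_def)
      ultimately show "en (radd (pos_var \<zeta>) \<eta>2) t = en (radd (neg_var \<zeta>) \<eta>1) t"
        using \<zeta>P P1 P2 t by (simp add: en_add_left)
    qed
    then have "diff_eq (pos_var \<zeta>) (neg_var \<zeta>) \<eta>1 \<eta>2" unfolding diff_eq_def .
    then show "\<zeta> = \<zeta>0" by (rule diff_eq_unique[OF P_radon[OF P1] P_radon[OF P2] _ d0])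
  qed
qed

end

theorem theorem5p2:
  fixes \<kappa> :: "'a::{second_countable_topology, t2_space} kernel" and h :: real
  assumes "locally_compact_space (euclidean :: 'a topology)"
    and "perfect_kernel \<kappa>"
    and "domination_principle \<kappa>"
    and "1 \<le> h" and "ugaheri_principle h \<kappa>"
    and "inductive_limit_topology closure_of (C0_potentials \<kappa>) = C0"
  shows "\<exists>\<E>\<^sub>0. countable \<E>\<^sub>0 \<and> \<E>\<^sub>0 \<subseteq> energy_space \<kappa> \<and>
    (\<forall>A \<xi>. inner_cap \<kappa> A > 0 \<and> sweepable \<kappa> A (pos_part \<xi>) \<and> sweepable \<kappa> A (neg_part \<xi>) \<longrightarrow>
       determined_within_energy_space (inner_cap \<kappa>) \<kappa> \<E>\<^sub>0 A \<xi> \<and>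
       (A \<in> sets borel \<longrightarrow> determined_within_energy_space (outer_cap \<kappa>) \<kappa> \<E>\<^sub>0 A \<xi>))"
proof -
  interpret balayage_space \<kappa> h
    by unfold_locales (use assms in \<open>auto simp: perfect_kernel_def\<close>)
  obtain E where E: "countable E" "E \<subseteq> P" and total: "\<forall>a\<in>P. \<forall>b\<in>P. (\<forall>\<theta>\<in>E. en a \<theta> = en b \<theta>) \<longrightarrow> a = b"
    using countable_total_set by blast
  have inner: "swept_energy (inner_cap \<kappa>) \<kappa> A (of_pos_radon \<sigma>) = of_pos_radon \<sigma>'" if "\<sigma> \<in> P" "bal \<sigma> A \<sigma>'" for A \<sigma> \<sigma>'
    by (rule swept_energy_eq[where cap="inner_cap \<kappa>", OF that bal_exceptional_inner_cap[OF that(2)]])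
  \<comment> \<open>Borel measurability of \<open>A\<close> enters through the exceptional set,
    which is then capacitable and of outer capacity zero.\<close>
  have outer: "swept_energy (outer_cap \<kappa>) \<kappa> A (of_pos_radon \<sigma>) = of_pos_radon \<sigma>'"
    if "A \<in> sets borel" "\<sigma> \<in> P" "bal \<sigma> A \<sigma>'" for A \<sigma> \<sigma>'
    by (rule swept_energy_eq[where cap="outer_cap \<kappa>", OF that(2,3) bal_exceptional_outer_cap[OF that(2,3,1)]]) (rule outer_cap_0_imp_inner_cap_0)
  show ?thesis
  proof (intro exI[of _ "of_pos_radon ` E"] conjI allI impI)
    show "countable (of_pos_radon ` E)" using E(1) by (rule countable_image)
    show "of_pos_radon ` E \<subseteq> energy_space \<kappa>"
      using E(2) of_pos_radon_energy_cone unfolding energy_cone_def by blast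
    fix A \<xi> assume "inner_cap \<kappa> A > 0 \<and> sweepable \<kappa> A (pos_part \<xi>) \<and> sweepable \<kappa> A (neg_part \<xi>)"
    then have s: "sweepable \<kappa> A (pos_part \<xi>)" "sweepable \<kappa> A (neg_part \<xi>)" by auto
    show "determined_within_energy_space (inner_cap \<kappa>) \<kappa> (of_pos_radon ` E) A \<xi>"
      by (rule determined[OF E(2) _ s inner]) (use total in blast)
    assume "A \<in> sets borel"
    then show "determined_within_energy_space (outer_cap \<kappa>) \<kappa> (of_pos_radon ` E) A \<xi>"
      by (intro determined[OF E(2) _ s outer]) (use total in blast)
  qed
qed

end
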